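(* Let $\mathscr{D}$ be an admissible operator with spectral growth order $p>1$. Let $n\ge1$ and $r_i\ge2$ for $i=1,\dots,n$ be integers. Let $w_{ij}\in\mathbb{R}$ be weights and $u_{ij}\in\mathbb{S}^2$ be pairwise distinct positions, for $i=1,\dots,n$ and $j=1,\dots,r_i$. Fix $\eta>0$. Then the optimization problem $$\min_{g\in\mathbb{H}_p}\ \frac{(4\pi)^2}{n}\sum_{i=1}^n\frac{1}{r_i(r_i-1)}\sum_{1\le j\ne k\le r_i}(w_{ij}w_{ik}-g(u_{ij},u_{ik}))^2+\eta\,\|(\mathscr{D}\otimes\mathscr{D})g\|^2_{L^2(\mathbb{S}^2\times\mathbb{S}^2)}$$ has a unique solution $R_\eta\in\mathbb{H}_p$, which is given by $$R_\eta=\sum_{i=1}^n\frac1{\sqrt{r_i(r_i-1)}}\sum_{1\le j\ne k\le r_i}\beta_{ijk}\,\psi_{\mathscr{D}^*\mathscr{D}}(\langle\cdot,u_{ij}\rangle)\otimes\psi_{\mathscr{D}^*\mathscr{D}}(\langle\cdot,u_{ik}\rangle)$$ for some real coefficients $(\beta_{ijk})_{1\le i\le n,\,1\le j\ne k\le r_i}$, where $\psi_{\mathscr{D}^*\mathscr{D}}$ is the zonal Green's kernel of $\mathscr{D}^*\mathscr{D}$. The coefficients are computed as follows. Let $L=\sum_{i=1}^nr_i(r_i-1)$, and fix an enumeration (vectorization) of the triplets $(i,j,k)$, $1\le i\le n$, $1\le j\ne k\le r_i$, by indices $\ell\in\{1,\dots,L\}$. Let $\boldsymbol{\beta}\in\mathbb{R}^L$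 be the vectorized version of $(\beta_{ijk})$, let $\boldsymbol{z}\in\mathbb{R}^L$ be the vectorized version of $\big(w_{ij}w_{ik}/\sqrt{r_i(r_i-1)}\big)$, and let $\mathbf{H}\in\mathbb{R}^{L\times L}$ be the matrix with entries $$H_{\ell_1\ell_2}=\frac{\psi_{\mathscr{D}^*\mathscr{D}}(\langle u_{i_1j_1},u_{i_2j_2}\rangle)\,\psi_{\mathscr{D}^*\mathscr{D}}(\langle u_{i_1k_1},u_{i_2k_2}\rangle)}{\sqrt{r_{i_1}(r_{i_1}-1)r_{i_2}(r_{i_2}-1)}},$$ where $\ell_1$ (resp. $\ell_2$) corresponds to $(i_1,j_1,k_1)$ (resp. $(i_2,j_2,k_2)$). Then $$\boldsymbol{\beta}=\Big(\mathbf{H}+\frac{\eta n}{(4\pi)^2}\mathbf{I}_L\Big)^{-1}\boldsymbol{z},$$ where $\mathbf{I}_L$ is the $L\times L$ identity matrix. Moreover, $R_\eta$ is symmetric: $R_\eta(u,v)=R_\eta(v,u)$ for all $u,v\in\mathbb{S}^2$.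
   Context: $\mathbb{S}^2\subset\mathbb{R}^3$ is the unit sphere with surface measure (total mass $4\pi$), $\langle u,v\rangle$ for $u,v\in\mathbb{S}^2$ is the Euclidean inner product, and $\{Y_{\ell,m}\}_{\ell\in\mathbb{N},-\ell\le m\le\ell}$ is a standard real orthonormal basis of spherical harmonics of $L^2(\mathbb{S}^2)$ (real-valued functions). $(f_1\otimes f_2)(u,v)=f_1(u)f_2(v)$. For $p\ge0$, $\mathcal{H}_p=\{f\in L^2(\mathbb{S}^2):\|f\|_{\mathcal{H}_p}^2=\sum_{\ell\ge0}(1+\ell(\ell+1))^p\sum_{m=-\ell}^{\ell}\langle f,Y_{\ell,m}\rangle_{L^2(\mathbb S^2)}^2<\infty\}$ and $\mathbb{H}_p=\mathcal{H}_p\otimes\mathcal{H}_p\subset L^2(\mathbb{S}^2\times\mathbb{S}^2)$ is the Hilbert tensor product, with norm $\|g\|_{\mathbb{H}_p}^2=\sum_{\ell,\ell'}(1+\ell(\ell+1))^p(1+\ell'(\ell'+1))^p\sum_{m,m'}\langle g,Y_{\ell,m}\otimes Y_{\ell',m'}\rangle_{L^2(\mathbb{S}^2\times\mathbb{S}^2)}^2$. For $p>1$ elements of $\mathbb{H}_p$ are identified with their continuous representatives. An admissible operator $\mathscr{D}$ with spectral growth order $p\ge 0$ is a linear operator $\mathscr{D}f=\sum_{\ell\ge0}D_\ell\sum_{m=-\ell}^{\ell}\langle f,Y_{\ell,m}\rangle_{L^2(\mathbb S^2)}\,Y_{\ell,m}$ on smooth functions $f$, where $(D_\ell)_{\ell\in\mathbb{N}}$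 are non-zero real numbers with $C_1(1+\ell)^p\le|D_\ell|\le C_2(1+\ell)^p$ for all $\ell\in\mathbb{N}$ and some constants $C_1,C_2>0$. It extends by the same formula to $\mathcal{H}_p\to L^2(\mathbb{S}^2)$, and its inverse (multiplication of the Fourier coefficients by $1/D_\ell$) extends to distributions. $\mathscr{D}\otimes\mathscr{D}$ is the linear operator with $(\mathscr{D}\otimes\mathscr{D})(f_1\otimes f_2)=(\mathscr{D}f_1)\otimes(\mathscr{D}f_2)$, extended continuously to $\mathbb{H}_p\to L^2(\mathbb{S}^2\times\mathbb{S}^2)$. The operator $\mathscr{D}^*\mathscr{D}$ is the admissible operator with coefficients $D_\ell^2$. For an admissible operator $\mathscr{E}$ and $u\in\mathbb{S}^2$, the Green's function of $\mathscr{E}$ at $u$ is $\Psi^{\mathscr{E}}_u=\mathscr{E}^{-1}\delta_u$ ($\delta_u$ the Dirac distribution at $u$); the zonal Green's kernel of $\mathscr{E}$ is the function $\psi_{\mathscr{E}}:[-1,1]\to\mathbb{R}$ such that $\Psi^{\mathscr{E}}_u(v)=\psi_{\mathscr{E}}(\langle u,v\rangle)$ for all $u,v\in\mathbb{S}^2$. *)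

theory Defs
  imports
    "HOL-Analysis.Analysis"
    "Jordan_Normal_Form.Gauss_Jordan_Elimination"
begin

type_synonym pt = "real ^ 3"

abbreviation S2 :: "pt set" where
  "S2 \<equiv> sphere 0 1"

(* Surface measure in polar coordinates: the area of A is 3 times the volume of the cone
   {t x | x : A, 0 < t < 1}. *)
definition sph :: "pt measure" where
  "sph = scale_measure 3
     (distr (restrict_space lborel (ball 0 1 - {0})) (restrict_space borel S2)
        (\<lambda>x. x /\<^sub>R norm x))"

lemma space_sph [simp]: "space sph = S2"
  by (simp add: sph_def space_scale_measure space_restrict_space)

lemma emeasure_sph_space: "emeasure sph S2 = ennreal (4 * pi)"
proof -
  let ?B = "ball (0::pt) 1 - {0}"
  have "(\<lambda>x::pt. x /\<^sub>R norm x) \<in> borel_measurable borel"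
    by measurable
  then have "(\<lambda>x::pt. x /\<^sub>R norm x) \<in> restrict_space lborel ?B \<rightarrow>\<^sub>M restrict_space borel S2"
    by (intro measurable_restrict_space2 measurable_restrict_space1)
       (auto simp: space_restrict_space)
  moreover have "(\<lambda>x::pt. x /\<^sub>R norm x) -` S2 \<inter> space (restrict_space lborel ?B) = ?B"
    by (auto simp: space_restrict_space)
  moreover have "S2 \<in> sets (restrict_space borel S2)"
    by (simp add: sets_restrict_space_iff)
  moreover have "emeasure (restrict_space lborel ?B) ?B = emeasure lborel ?B"
    by (intro emeasure_restrict_space) auto
  moreover have "emeasure lborel ?B = emeasure lborel (ball (0::pt) 1)"
    by (subst emeasure_Diff) auto
  moreover have "emeasure lborel (ball (0::pt) 1) = ennreal (4 / 3 * pi)"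
    by (simp add: emeasure_ball unit_ball_vol_3)
  ultimately have "emeasure sph S2 = 3 * ennreal (4 / 3 * pi)"
    by (simp add: sph_def emeasure_distr)
  also have "\<dots> = ennreal (3 * (4 / 3 * pi))"
    by (subst ennreal_mult) auto
  finally show ?thesis by simp
qed


section \<open>Square-integrable functions\<close>

(* Elements of L^2 are represented by functions, not by equivalence classes. *)
definition L2 :: "'a measure \<Rightarrow> ('a \<Rightarrow> real) set" where
  "L2 M = {f \<in> borel_measurable M. integrable M (\<lambda>x. (f x)\<^sup>2)}"

definition L2_inner :: "'a measure \<Rightarrow> ('a \<Rightarrow> real) \<Rightarrow> ('a \<Rightarrow> real) \<Rightarrow> real" where
  "L2_inner M f g = (\<integral>x. f x * g x \<partial>M)"

definition L2_norm :: "'a measure \<Rightarrow> ('a \<Rightarrow> real) \<Rightarrow> real" where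
  "L2_norm M f = sqrt (L2_inner M f f)"

abbreviation sph2 :: "(pt \<times> pt) measure" where
  "sph2 \<equiv> sph \<Otimes>\<^sub>M sph"

definition tensor :: "(pt \<Rightarrow> real) \<Rightarrow> (pt \<Rightarrow> real) \<Rightarrow> pt \<times> pt \<Rightarrow> real" where
  "tensor f1 f2 = (\<lambda>(u, v). f1 u * f2 v)"


section \<open>Spherical harmonics\<close>

definition laplacian :: "(pt \<Rightarrow> real) \<Rightarrow> pt \<Rightarrow> real" where
  "laplacian P x = (\<Sum>b\<in>Basis. (deriv ^^ 2) (\<lambda>t. P (x + t *\<^sub>R b)) 0)"

definition spherical_harmonic :: "nat \<Rightarrow> (pt \<Rightarrow> real) \<Rightarrow> bool" where
  "spherical_harmonic l f \<longleftrightarrow>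
     (\<exists>P. real_polynomial_function P \<and> (\<forall>c x. P (c *\<^sub>R x) = c ^ l * P x) \<and>
          (\<forall>x. laplacian P x = 0) \<and> (\<forall>x\<in>S2. f x = P x))"

type_synonym harmonics = "nat \<Rightarrow> int \<Rightarrow> pt \<Rightarrow> real"

abbreviation orders :: "nat \<Rightarrow> int set" where
  "orders l \<equiv> {- int l..int l}"

definition spherical_harmonics_basis :: "harmonics \<Rightarrow> bool" where
  "spherical_harmonics_basis Y \<longleftrightarrow>
     (\<forall>l. \<forall>m\<in>orders l. spherical_harmonic l (Y l m)) \<and>
     (\<forall>l l'. \<forall>m\<in>orders l. \<forall>m'\<in>orders l'.
        L2_inner sph (Y l m) (Y l' m') = (if l = l' \<and> m = m' then 1 else 0)) \<and>
     (\<forall>f\<in>L2 sph. (\<forall>l. \<forall>m\<in>orders l. L2_inner sph f (Y l m) = 0) \<longrightarrow> (AE x in sph. f x = 0))"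


section \<open>Sobolev spaces\<close>

definition sobolev_weight :: "real \<Rightarrow> nat \<Rightarrow> real" where
  "sobolev_weight p l = (1 + real l * (real l + 1)) powr p"

definition H_sqnorm :: "harmonics \<Rightarrow> real \<Rightarrow> (pt \<Rightarrow> real) \<Rightarrow> ennreal" where
  "H_sqnorm Y p f =
     (\<Sum>l. ennreal (sobolev_weight p l * (\<Sum>m\<in>orders l. (L2_inner sph f (Y l m))\<^sup>2)))"

definition H :: "harmonics \<Rightarrow> real \<Rightarrow> (pt \<Rightarrow> real) set" where
  "H Y p = {f \<in> L2 sph. H_sqnorm Y p f < \<infinity>}"

definition HH_sqnorm :: "harmonics \<Rightarrow> real \<Rightarrow> (pt \<times> pt \<Rightarrow> real) \<Rightarrow> ennreal" where
  "HH_sqnorm Y p g =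
     (\<Sum>l. \<Sum>l'. ennreal (sobolev_weight p l * sobolev_weight p l' *
        (\<Sum>m\<in>orders l. \<Sum>m'\<in>orders l'. (L2_inner sph2 g (tensor (Y l m) (Y l' m')))\<^sup>2)))"

definition algebraic_tensor_product ::
  "(pt \<Rightarrow> real) set \<Rightarrow> (pt \<Rightarrow> real) set \<Rightarrow> (pt \<times> pt \<Rightarrow> real) set" where
  "algebraic_tensor_product A B =
     {\<lambda>x. \<Sum>i<N. tensor (a i) (b i) x | (a :: nat \<Rightarrow> pt \<Rightarrow> real) b (N :: nat).
        \<forall>i<N. a i \<in> A \<and> b i \<in> B}"

(* Hilbert tensor product of H Y p with itself, realised inside L^2 as the closure of the
   algebraic tensor product in the tensor norm. *)
definition HH :: "harmonics \<Rightarrow> real \<Rightarrow> (pt \<times> pt \<Rightarrow> real) set" where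
  "HH Y p = {g \<in> L2 sph2.
     \<exists>s. (\<forall>N. s N \<in> algebraic_tensor_product (H Y p) (H Y p)) \<and>
         (\<lambda>N::nat. HH_sqnorm Y p (\<lambda>x. g x - s N x)) \<longlonglongrightarrow> 0}"

(* Continuous representatives, normalised off S2 \<times> S2 so that equality of functions is equality
   on S2 \<times> S2. Meant for p > 1, where every element of HH has such a representative. *)
definition HH_cont :: "harmonics \<Rightarrow> real \<Rightarrow> (pt \<times> pt \<Rightarrow> real) set" where
  "HH_cont Y p = {g \<in> HH Y p. continuous_on (S2 \<times> S2) g \<and> g \<in> extensional (S2 \<times> S2)}"


section \<open>Admissible operators\<close>

definition admissible :: "(nat \<Rightarrow> real) \<Rightarrow> real \<Rightarrow> bool" where
  "admissible D p \<longleftrightarrow> p \<ge> 0 \<and> (\<forall>l. D l \<noteq> 0) \<and>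
     (\<exists>C1>0. \<exists>C2>0. \<forall>l. C1 * (1 + real l) powr p \<le> \<bar>D l\<bar> \<and> \<bar>D l\<bar> \<le> C2 * (1 + real l) powr p)"

(* The series defining the operator converges in L^2 norm; its sum is determined up to a null
   set, so a representative is chosen. *)
definition admissible_op :: "harmonics \<Rightarrow> (nat \<Rightarrow> real) \<Rightarrow> (pt \<Rightarrow> real) \<Rightarrow> pt \<Rightarrow> real" where
  "admissible_op Y D f = (SOME h. h \<in> L2 sph \<and>
     (\<lambda>N. L2_norm sph (\<lambda>x. h x - (\<Sum>l<N. D l * (\<Sum>m\<in>orders l. L2_inner sph f (Y l m) * Y l m x))))
       \<longlonglongrightarrow> 0)"

(* T is the continuous linear extension of f1 \<otimes> f2 \<mapsto> D f1 \<otimes> D f2 to HH Y p. *)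
definition is_tensor_op ::
  "harmonics \<Rightarrow> real \<Rightarrow> (nat \<Rightarrow> real) \<Rightarrow> ((pt \<times> pt \<Rightarrow> real) \<Rightarrow> pt \<times> pt \<Rightarrow> real) \<Rightarrow> bool" where
  "is_tensor_op Y p D T \<longleftrightarrow>
     (\<forall>g\<in>HH Y p. T g \<in> L2 sph2) \<and>
     (\<forall>g\<in>HH Y p. \<forall>h\<in>HH Y p. \<forall>a b.
        AE x in sph2. T (\<lambda>y. a * g y + b * h y) x = a * T g x + b * T h x) \<and>
     (\<exists>C\<ge>0. \<forall>g\<in>HH Y p. ennreal ((L2_norm sph2 (T g))\<^sup>2) \<le> ennreal C * HH_sqnorm Y p g) \<and>
     (\<forall>f1\<in>H Y p. \<forall>f2\<in>H Y p.
        AE x in sph2. T (tensor f1 f2) x = tensor (admissible_op Y D f1) (admissible_op Y D f2) x)"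

(* Unique up to null sets for admissible D of order p. *)
definition tensor_op ::
  "harmonics \<Rightarrow> real \<Rightarrow> (nat \<Rightarrow> real) \<Rightarrow> (pt \<times> pt \<Rightarrow> real) \<Rightarrow> pt \<times> pt \<Rightarrow> real" where
  "tensor_op Y p D = (SOME T. is_tensor_op Y p D T)"


section \<open>Green's functions\<close>

(* A distribution enters only through its values on the basis functions, i.e. its Fourier
   coefficients, which determine it. *)
type_synonym functional = "(pt \<Rightarrow> real) \<Rightarrow> real"

definition dirac :: "pt \<Rightarrow> functional" where
  "dirac u = (\<lambda>\<phi>. \<phi> u)"

definition regular_distribution :: "(pt \<Rightarrow> real) \<Rightarrow> functional" where
  "regular_distribution f = (\<lambda>\<phi>. L2_inner sph f \<phi>)"

(* S is the image of T under the inverse of the operator with coefficients E. *)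
definition is_inverse_image ::
  "harmonics \<Rightarrow> (nat \<Rightarrow> real) \<Rightarrow> functional \<Rightarrow> functional \<Rightarrow> bool" where
  "is_inverse_image Y E T S \<longleftrightarrow> (\<forall>l. \<forall>m\<in>orders l. S (Y l m) = T (Y l m) / E l)"

(* Well defined if this distribution is a continuous function, which is the case for spectral
   growth order greater than 2. *)
definition green_function :: "harmonics \<Rightarrow> (nat \<Rightarrow> real) \<Rightarrow> pt \<Rightarrow> pt \<Rightarrow> real" where
  "green_function Y E u = (THE f. f \<in> extensional S2 \<and> continuous_on S2 f \<and>
     is_inverse_image Y E (dirac u) (regular_distribution f))"

definition zonal_green_kernel :: "harmonics \<Rightarrow> (nat \<Rightarrow> real) \<Rightarrow> real \<Rightarrow> real" where
  "zonal_green_kernel Y E = (THE \<psi>. \<psi> \<in> extensional {-1..1} \<and>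
     (\<forall>u\<in>S2. \<forall>v\<in>S2. green_function Y E u v = \<psi> (inner u v)))"


section \<open>The optimization problem\<close>

definition offdiag :: "nat \<Rightarrow> (nat \<times> nat) set" where
  "offdiag r = {(j, k). j \<in> {1..r} \<and> k \<in> {1..r} \<and> j \<noteq> k}"

definition triplets :: "nat \<Rightarrow> (nat \<Rightarrow> nat) \<Rightarrow> (nat \<times> nat \<times> nat) set" where
  "triplets n r = {(i, j, k). i \<in> {1..n} \<and> (j, k) \<in> offdiag (r i)}"

definition pairs_count :: "nat \<Rightarrow> real" where
  "pairs_count r = real r * (real r - 1)"

definition objective ::
  "harmonics \<Rightarrow> real \<Rightarrow> (nat \<Rightarrow> real) \<Rightarrow> nat \<Rightarrow> (nat \<Rightarrow> nat) \<Rightarrow>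
   (nat \<Rightarrow> nat \<Rightarrow> real) \<Rightarrow> (nat \<Rightarrow> nat \<Rightarrow> pt) \<Rightarrow> real \<Rightarrow> (pt \<times> pt \<Rightarrow> real) \<Rightarrow> real" where
  "objective Y p D n r w u \<eta> g =
     (4 * pi)\<^sup>2 / real n *
       (\<Sum>i=1..n. 1 / pairs_count (r i) *
          (\<Sum>(j, k)\<in>offdiag (r i). (w i j * w i k - g (u i j, u i k))\<^sup>2)) +
     \<eta> * (L2_norm sph2 (tensor_op Y p D g))\<^sup>2"

definition is_minimizer :: "('a \<Rightarrow> real) \<Rightarrow> 'a set \<Rightarrow> 'a \<Rightarrow> bool" where
  "is_minimizer J A x \<longleftrightarrow> x \<in> A \<and> (\<forall>y\<in>A. J x \<le> J y)"

definition vectorize ::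
  "nat \<Rightarrow> (nat \<Rightarrow> nat \<times> nat \<times> nat) \<Rightarrow> (nat \<Rightarrow> nat \<Rightarrow> nat \<Rightarrow> real) \<Rightarrow> real Matrix.vec" where
  "vectorize L \<tau> c = Matrix.vec L (\<lambda>l. case \<tau> l of (i, j, k) \<Rightarrow> c i j k)"

definition gram_matrix ::
  "(real \<Rightarrow> real) \<Rightarrow> (nat \<Rightarrow> nat) \<Rightarrow> (nat \<Rightarrow> nat \<Rightarrow> pt) \<Rightarrow>
   nat \<Rightarrow> (nat \<Rightarrow> nat \<times> nat \<times> nat) \<Rightarrow> real Matrix.mat" where
  "gram_matrix \<psi> r u L \<tau> = Matrix.mat L L (\<lambda>(l1, l2).
     case (\<tau> l1, \<tau> l2) of ((i1, j1, k1), (i2, j2, k2)) \<Rightarrow>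
       \<psi> (inner (u i1 j1) (u i2 j2)) * \<psi> (inner (u i1 k1) (u i2 k2)) /
       sqrt (pairs_count (r i1) * pairs_count (r i2)))"

end

theory Submission
  imports Defs "Jordan_Normal_Form.Determinant"
begin

text \<open>
By Parseval's identity the penalty is a weighted \<open>\<ell>\<^sup>2\<close> norm of Fourier coefficients:
\<open>\<parallel>(D \<otimes> D) g\<parallel>\<^sup>2\<close> is the sum of \<open>D\<^sub>l\<^sup>2 D\<^sub>l\<^sub>'\<^sup>2 \<langle>g, Y\<^sub>l\<^sub>m \<otimes> Y\<^sub>l\<^sub>'\<^sub>m\<^sub>'\<rangle>\<^sup>2\<close> (\<open>tensor_op_energy\<close>).
The addition theorem gives \<open>\<Sum>\<^sub>m Y\<^sub>l\<^sub>m(u)\<^sup>2 = (2l + 1) / 4\<pi>\<close>, so for \<open>p > 1\<close> the sum of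
\<open>Y\<^sub>l\<^sub>m(u)\<^sup>2 / D\<^sub>l\<^sup>2\<close> over all \<open>l\<close> and \<open>m\<close> is finite and the same for all \<open>u\<close>. By the
Cauchy-Schwarz inequality a continuous function of finite penalty then equals its Fourier series at
every point, and point evaluations are represented, for the inner product of the penalty, by a kernel:
the product of two copies of
\<open>k(u, v) = \<Sum> Y\<^sub>l\<^sub>m(u) Y\<^sub>l\<^sub>m(v) / D\<^sub>l\<^sup>2\<close>. The Fourier coefficients of \<open>k(u, \<cdot>)\<close> are those of the
Green's function of \<open>D\<^sup>*D\<close> at \<open>u\<close>, and \<open>k(u, v)\<close> depends on \<open>\<langle>u, v\<rangle>\<close> only, so \<open>k\<close> is the zonal
Green's kernel (\<open>zonal_green_kernel_eq\<close>).

The problem has thus become ridge regression in a reproducing kernel Hilbert space. If the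
coefficients of a kernel combination \<open>R\<close> satisfy the stationarity equations, completing the square
shows that the objective at \<open>g\<close> exceeds the objective at \<open>R\<close> by exactly the penalty of \<open>g - R\<close>
plus a nonnegative misfit (\<open>regularised_least_squares\<close>); this gives minimality and uniqueness at
once. The equations are those of a positive semidefinite Gram matrix plus a positive multiple of
the identity, hence uniquely solvable. Since exchanging \<open>j\<close> and \<open>k\<close> permutes the equations, it
fixes their solution, and \<open>R\<close> is symmetric.

Two points need work beyond this. The kernel is zonal because the span of the \<open>Y\<^sub>l\<^sub>m\<close> of a fixed
degree is invariant under rotations: it consists of all spherical harmonics of that degree, since a
harmonic homogeneous polynomial is determined by \<open>2l + 1\<close> of its coefficients
(\<open>spherical_harmonic_expansion\<close>). And \<open>D \<otimes> D\<close> is specified only by its values on elementary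
tensors, linearity and continuity; its action on Fourier coefficients follows by density, and its
existence from the Riesz-Fischer theorem (\<open>tensor_op_coefficients\<close>, \<open>tensor_op_exists\<close>).
\<close>

section \<open>Square-integrable functions\<close>

lemma L2_D:
  assumes "f \<in> L2 M"
  shows "f \<in> borel_measurable M" "integrable M (\<lambda>x. (f x)\<^sup>2)"
  using assms by (auto simp: L2_def)

lemma L2_mult_integrable:
  assumes "f \<in> L2 M" "g \<in> L2 M"
  shows "integrable M (\<lambda>x. f x * g x)"
proof (rule Bochner_Integration.integrable_bound[where f="\<lambda>x. (f x)\<^sup>2 + (g x)\<^sup>2"])
  show "integrable M (\<lambda>x. (f x)\<^sup>2 + (g x)\<^sup>2)"
    using assms by (intro Bochner_Integration.integrable_add) (auto dest: L2_D)
  show "(\<lambda>x. f x * g x) \<in> borel_measurable M"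
    using assms by (intro borel_measurable_times) (auto dest: L2_D)
  show "AE x in M. norm (f x * g x) \<le> norm ((f x)\<^sup>2 + (g x)\<^sup>2)"
  proof (rule AE_I2)
    fix x
    have "2 * (\<bar>f x\<bar> * \<bar>g x\<bar>) \<le> \<bar>f x\<bar>\<^sup>2 + \<bar>g x\<bar>\<^sup>2"
      using sum_squares_bound[of "\<bar>f x\<bar>" "\<bar>g x\<bar>"] by (simp add: mult.assoc)
    moreover have "0 \<le> \<bar>f x\<bar> * \<bar>g x\<bar>" by simp
    ultimately have "\<bar>f x\<bar> * \<bar>g x\<bar> \<le> (f x)\<^sup>2 + (g x)\<^sup>2" by (simp only: power2_abs)
    then show "norm (f x * g x) \<le> norm ((f x)\<^sup>2 + (g x)\<^sup>2)"
      by (simp add: abs_mult)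
  qed
qed

lemma L2_lincomb:
  assumes "f \<in> L2 M" "g \<in> L2 M"
  shows "(\<lambda>x. a * f x + b * g x) \<in> L2 M"
proof -
  have "(\<lambda>x. (a * f x + b * g x)\<^sup>2)
      = (\<lambda>x. a\<^sup>2 * (f x)\<^sup>2 + b\<^sup>2 * (g x)\<^sup>2 + (2 * a * b) * (f x * g x))"
    by (auto simp: power2_eq_square algebra_simps)
  moreover have "integrable M (\<lambda>x. a\<^sup>2 * (f x)\<^sup>2 + b\<^sup>2 * (g x)\<^sup>2 + (2 * a * b) * (f x * g x))"
    using assms L2_mult_integrable[OF assms]
    by (intro Bochner_Integration.integrable_add integrable_mult_right) (auto dest: L2_D)
  ultimately have "integrable M (\<lambda>x. (a * f x + b * g x)\<^sup>2)"
    by simp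
  moreover have "(\<lambda>x. a * f x + b * g x) \<in> borel_measurable M"
    using assms by (intro borel_measurable_add borel_measurable_times) (auto dest: L2_D(1))
  ultimately show ?thesis by (simp add: L2_def)
qed

lemma L2_zero: "(\<lambda>x. 0) \<in> L2 M"
  by (simp add: L2_def)

lemma L2_scale: "f \<in> L2 M \<Longrightarrow> (\<lambda>x. a * f x) \<in> L2 M"
  using L2_lincomb[of f M f a 0] by simp

lemma L2_add: "f \<in> L2 M \<Longrightarrow> g \<in> L2 M \<Longrightarrow> (\<lambda>x. f x + g x) \<in> L2 M"
  using L2_lincomb[of f M g 1 1] by simp

lemma L2_diff: "f \<in> L2 M \<Longrightarrow> g \<in> L2 M \<Longrightarrow> (\<lambda>x. f x - g x) \<in> L2 M"
  using L2_lincomb[of f M g 1 "-1"] by simp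

lemma L2_sum:
  "(\<And>i. i \<in> F \<Longrightarrow> f i \<in> L2 M) \<Longrightarrow> (\<lambda>x. \<Sum>i\<in>F. f i x) \<in> L2 M"
  by (induction F rule: infinite_finite_induct) (auto simp: L2_zero intro!: L2_add)

lemma L2_inner_commute: "L2_inner M f g = L2_inner M g f"
  by (simp add: L2_inner_def mult.commute)

lemma L2_inner_lincomb:
  assumes "f \<in> L2 M" "g \<in> L2 M" "h \<in> L2 M"
  shows "L2_inner M (\<lambda>x. a * f x + b * g x) h = a * L2_inner M f h + b * L2_inner M g h"
proof -
  have "L2_inner M (\<lambda>x. a * f x + b * g x) h
      = (\<integral>x. a * (f x * h x) + b * (g x * h x) \<partial>M)"
    unfolding L2_inner_def by (rule Bochner_Integration.integral_cong) (auto simp: algebra_simps)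
  also have "\<dots> = a * L2_inner M f h + b * L2_inner M g h"
    using assms
    by (subst Bochner_Integration.integral_add)
      (auto simp: L2_inner_def intro!: L2_mult_integrable)
  finally show ?thesis .
qed

lemma L2_inner_scale: "L2_inner M (\<lambda>x. a * f x) h = a * L2_inner M f h"
  by (simp add: L2_inner_def mult.assoc)

lemma L2_inner_add:
  "f \<in> L2 M \<Longrightarrow> g \<in> L2 M \<Longrightarrow> h \<in> L2 M \<Longrightarrow>
    L2_inner M (\<lambda>x. f x + g x) h = L2_inner M f h + L2_inner M g h"
  using L2_inner_lincomb[of f M g h 1 1] by simp

lemma L2_inner_diff:
  "f \<in> L2 M \<Longrightarrow> g \<in> L2 M \<Longrightarrow> h \<in> L2 M \<Longrightarrow>
    L2_inner M (\<lambda>x. f x - g x) h = L2_inner M f h - L2_inner M g h"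
  using L2_inner_lincomb[of f M g h 1 "-1"] by simp

lemma L2_inner_sum:
  assumes "\<And>i. i \<in> F \<Longrightarrow> f i \<in> L2 M" "h \<in> L2 M"
  shows "L2_inner M (\<lambda>x. \<Sum>i\<in>F. c i * f i x) h = (\<Sum>i\<in>F. c i * L2_inner M (f i) h)"
  using assms(1)
proof (induction F rule: infinite_finite_induct)
  case (insert i F)
  have "L2_inner M (\<lambda>x. c i * f i x + (\<Sum>i\<in>F. c i * f i x)) h
      = L2_inner M (\<lambda>x. c i * f i x) h + L2_inner M (\<lambda>x. \<Sum>i\<in>F. c i * f i x) h"
    using insert assms by (intro L2_inner_add L2_sum L2_scale) auto
  with insert show ?case by (simp add: L2_inner_scale)
qed (simp_all add: L2_inner_def)

lemma L2_inner_self_nonneg: "0 \<le> L2_inner M f f"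
  by (simp add: L2_inner_def)

lemma L2_norm_squared: "(L2_norm M f)\<^sup>2 = L2_inner M f f"
  by (simp add: L2_norm_def L2_inner_self_nonneg)

lemma L2_inner_cong_AE:
  assumes "f \<in> borel_measurable M" "f' \<in> borel_measurable M" "g \<in> borel_measurable M"
    "g' \<in> borel_measurable M"
    and "AE x in M. f x = f' x" "AE x in M. g x = g' x"
  shows "L2_inner M f g = L2_inner M f' g'"
  unfolding L2_inner_def
  by (rule integral_cong_AE) (use assms in \<open>auto intro!: borel_measurable_times\<close>)

lemma L2_inner_cong:
  "(\<And>x. x \<in> space M \<Longrightarrow> f x = f' x) \<Longrightarrow> (\<And>x. x \<in> space M \<Longrightarrow> g x = g' x) \<Longrightarrow>
    L2_inner M f g = L2_inner M f' g'"
  unfolding L2_inner_def by (rule Bochner_Integration.integral_cong) auto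

lemma L2_cong:
  assumes "\<And>x. x \<in> space M \<Longrightarrow> f x = g x"
  shows "f \<in> L2 M \<longleftrightarrow> g \<in> L2 M"
proof -
  have "f \<in> borel_measurable M \<longleftrightarrow> g \<in> borel_measurable M"
    by (rule measurable_cong) (rule assms)
  moreover have "integrable M (\<lambda>x. (f x)\<^sup>2) \<longleftrightarrow> integrable M (\<lambda>x. (g x)\<^sup>2)"
    by (rule Bochner_Integration.integrable_cong) (simp_all add: assms)
  ultimately show ?thesis by (simp add: L2_def)
qed

lemma L2_inner_self_lincomb:
  assumes "f \<in> L2 M" "g \<in> L2 M"
  shows "L2_inner M (\<lambda>x. a * f x + b * g x) (\<lambda>x. a * f x + b * g x)
    = a\<^sup>2 * L2_inner M f f + 2 * a * b * L2_inner M f g + b\<^sup>2 * L2_inner M g g"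
proof -
  let ?h = "\<lambda>x. a * f x + b * g x"
  have "L2_inner M ?h ?h = a * L2_inner M f ?h + b * L2_inner M g ?h"
    by (rule L2_inner_lincomb[OF assms L2_lincomb[OF assms]])
  also have "L2_inner M f ?h = a * L2_inner M f f + b * L2_inner M f g"
    using L2_inner_lincomb[OF assms assms(1), of a b]
    by (simp only: L2_inner_commute[of M f ?h] L2_inner_commute[of M f g])
  also have "L2_inner M g ?h = a * L2_inner M f g + b * L2_inner M g g"
    using L2_inner_lincomb[OF assms assms(2), of a b]
    by (simp only: L2_inner_commute[of M g ?h])
  finally show ?thesis by (simp add: power2_eq_square algebra_simps)
qed

text \<open>The quadratic form \<open>\<parallel>s f + t g\<parallel>\<^sup>2\<close> in \<open>(s, t)\<close> is nonnegative, so its discriminant is not positive.\<close>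

lemma L2_Cauchy_Schwarz:
  assumes f: "f \<in> L2 M" and g: "g \<in> L2 M"
  shows "(L2_inner M f g)\<^sup>2 \<le> L2_inner M f f * L2_inner M g g"
proof -
  let ?a = "L2_inner M f f" and ?b = "L2_inner M f g" and ?c = "L2_inner M g g"
  have q: "0 \<le> s\<^sup>2 * ?a + 2 * s * t * ?b + t\<^sup>2 * ?c" for s t
    using L2_inner_self_nonneg[of M "\<lambda>x. s * f x + t * g x"] L2_inner_self_lincomb[OF f g] by metis
  show ?thesis
  proof (cases "?c = 0")
    case True
    have "?b = 0"
    proof (rule ccontr)
      assume "?b \<noteq> 0"
      have "0 \<le> ?a + 2 * (- (?a + 1) / (2 * ?b)) * ?b"
        using q[of 1 "- (?a + 1) / (2 * ?b)"] True by simp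
      with \<open>?b \<noteq> 0\<close> show False by (simp add: field_simps)
    qed
    then show ?thesis by (simp add: True)
  next
    case False
    then have c: "?c > 0" using L2_inner_self_nonneg[of M g] by simp
    have "0 \<le> ?c\<^sup>2 * ?a + 2 * ?c * (- ?b) * ?b + (- ?b)\<^sup>2 * ?c" by (rule q)
    also have "\<dots> = ?c * (?a * ?c - ?b\<^sup>2)" by (simp add: power2_eq_square algebra_simps)
    finally show ?thesis using c by (simp add: zero_le_mult_iff)
  qed
qed

lemma L2_inner_tendsto:
  assumes s: "\<And>k. s k \<in> L2 M" and f: "f \<in> L2 M" and h: "h \<in> L2 M"
    and lim: "(\<lambda>k::nat. L2_inner M (\<lambda>x. f x - s k x) (\<lambda>x. f x - s k x)) \<longlonglongrightarrow> 0"
  shows "(\<lambda>k. L2_inner M (s k) h) \<longlonglongrightarrow> L2_inner M f h"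
proof -
  let ?d = "\<lambda>k. L2_inner M (\<lambda>x. f x - s k x) (\<lambda>x. f x - s k x)"
  have "(\<lambda>k. L2_inner M f h - L2_inner M (s k) h) \<longlonglongrightarrow> 0"
  proof (rule Lim_null_comparison)
    show "\<forall>\<^sub>F k in sequentially.
        norm (L2_inner M f h - L2_inner M (s k) h) \<le> sqrt (?d k * L2_inner M h h)"
    proof (rule always_eventually, rule allI)
      fix k
      have "(L2_inner M (\<lambda>x. f x - s k x) h)\<^sup>2 \<le> ?d k * L2_inner M h h"
        by (intro L2_Cauchy_Schwarz L2_diff f s h)
      then have "\<bar>L2_inner M (\<lambda>x. f x - s k x) h\<bar> \<le> sqrt (?d k * L2_inner M h h)"
        by (metis real_sqrt_abs real_sqrt_le_iff)
      then show "norm (L2_inner M f h - L2_inner M (s k) h) \<le> sqrt (?d k * L2_inner M h h)"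
        using L2_inner_diff[OF f s h] by simp
    qed
    show "(\<lambda>k. sqrt (?d k * L2_inner M h h)) \<longlonglongrightarrow> 0"
      using tendsto_real_sqrt[OF tendsto_mult_left_zero[OF lim, of "L2_inner M h h"]] by simp
  qed
  then have "(\<lambda>k. L2_inner M f h - (L2_inner M f h - L2_inner M (s k) h)) \<longlonglongrightarrow> L2_inner M f h - 0"
    by (intro tendsto_diff tendsto_const)
  then show ?thesis by simp
qed

lemma L2_inner_self_tendsto:
  assumes s: "\<And>k. s k \<in> L2 M" and f: "f \<in> L2 M"
    and lim: "(\<lambda>k::nat. L2_inner M (\<lambda>x. f x - s k x) (\<lambda>x. f x - s k x)) \<longlonglongrightarrow> 0"
  shows "(\<lambda>k. L2_inner M (s k) (s k)) \<longlonglongrightarrow> L2_inner M f f"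
proof -
  let ?d = "\<lambda>k. L2_inner M (\<lambda>x. f x - s k x) (\<lambda>x. f x - s k x)"
  have "?d k = L2_inner M f f - 2 * L2_inner M (s k) f + L2_inner M (s k) (s k)" for k
    using L2_inner_self_lincomb[OF f s, of 1 "-1" k] by (simp add: L2_inner_commute[of M f "s k"])
  then have "L2_inner M (s k) (s k) = ?d k + 2 * L2_inner M (s k) f - L2_inner M f f" for k
    by simp
  moreover have "(\<lambda>k. ?d k + 2 * L2_inner M (s k) f - L2_inner M f f)
      \<longlonglongrightarrow> 0 + 2 * L2_inner M f f - L2_inner M f f"
    by (intro tendsto_intros lim L2_inner_tendsto s f)
  ultimately show ?thesis by simp
qed

text \<open>On a finite measure space the \<open>L\<^sup>2\<close> bound also bounds the \<open>L\<^sup>1\<close> norms of the increments by a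
geometric sequence. The telescoping series of increments therefore converges absolutely almost
everywhere, and Fatou's lemma turns the pointwise limit into a limit in \<open>L\<^sup>2\<close>.\<close>

lemma (in finite_measure) L2_complete:
  fixes s :: "nat \<Rightarrow> 'a \<Rightarrow> real"
  assumes s: "\<And>k. s k \<in> L2 M"
    and bound: "\<And>j k. k \<le> j \<Longrightarrow>
      L2_inner M (\<lambda>x. s j x - s k x) (\<lambda>x. s j x - s k x) \<le> (1/4) ^ k"
  obtains f where "f \<in> L2 M"
    "(\<lambda>k. L2_inner M (\<lambda>x. f x - s k x) (\<lambda>x. f x - s k x)) \<longlonglongrightarrow> 0"
proof -
  define d where "d k x = \<bar>s (Suc k) x - s k x\<bar>" for k x
  have s_meas [measurable]: "s k \<in> borel_measurable M" for k
    using s by (auto dest: L2_D)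
  have d_meas [measurable]: "d k \<in> borel_measurable M" for k
    unfolding d_def by measurable
  have one: "(\<lambda>x. 1) \<in> L2 M" by (simp add: L2_def)
  define \<mu> where "\<mu> = L2_inner M (\<lambda>x. 1) (\<lambda>x. 1)"
  have dL2: "d k \<in> L2 M" for k
    using L2_diff[OF s s, of "Suc k" k] unfolding L2_def d_def by simp
  have d_int: "integrable M (d k)" for k
    using L2_mult_integrable[OF dL2 one] by simp
  have d_bound: "(\<integral>x. d k x \<partial>M) \<le> (1/2) ^ k * sqrt \<mu>" for k
  proof -
    have "(L2_inner M (d k) (\<lambda>x. 1))\<^sup>2 \<le> L2_inner M (d k) (d k) * \<mu>"
      unfolding \<mu>_def by (intro L2_Cauchy_Schwarz dL2 one)
    also have "L2_inner M (d k) (d k)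
        = L2_inner M (\<lambda>x. s (Suc k) x - s k x) (\<lambda>x. s (Suc k) x - s k x)"
      unfolding L2_inner_def d_def by simp
    also have "\<dots> * \<mu> \<le> (1/4) ^ k * \<mu>"
      by (intro mult_right_mono bound) (auto simp: \<mu>_def L2_inner_self_nonneg)
    also have "(1/4::real) ^ k = ((1/2) ^ k)\<^sup>2"
      by (simp add: power2_eq_square flip: power_mult_distrib)
    finally have "L2_inner M (d k) (\<lambda>x. 1) \<le> sqrt (((1/2) ^ k)\<^sup>2 * \<mu>)"
      by (simp add: real_le_rsqrt)
    then show ?thesis by (simp add: L2_inner_def real_sqrt_mult)
  qed
  have "AE x in M. summable (\<lambda>k. d k x)"
  \<comment> \<open>A nonnegative function with finite integral is finite almost everywhere.\<close>
  proof -
    have "(\<integral>\<^sup>+x. (\<Sum>k. ennreal (d k x)) \<partial>M) = (\<Sum>k. \<integral>\<^sup>+x. ennreal (d k x) \<partial>M)"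
      by (rule nn_integral_suminf) auto
    also have "\<dots> = (\<Sum>k. ennreal (\<integral>x. d k x \<partial>M))"
      by (intro suminf_cong nn_integral_eq_integral d_int) (auto simp: d_def)
    also have "\<dots> \<le> (\<Sum>k. ennreal ((1/2) ^ k * sqrt \<mu>))"
      by (intro suminf_le ennreal_leI d_bound) auto
    also have "\<dots> = ennreal (\<Sum>k. (1/2) ^ k * sqrt \<mu>)"
      by (intro suminf_ennreal2 summable_mult2 summable_geometric)
        (auto simp: \<mu>_def L2_inner_self_nonneg)
    finally have "(\<integral>\<^sup>+x. (\<Sum>k. ennreal (d k x)) \<partial>M) \<noteq> \<infinity>"
      by (auto simp: top_unique)
    then have "AE x in M. (\<Sum>k. ennreal (d k x)) \<noteq> \<infinity>"
      by (intro nn_integral_PInf_AE) auto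
    then show ?thesis
    proof eventually_elim
      case (elim x)
      show ?case
        by (rule summable_suminf_not_top) (use elim in \<open>auto simp: d_def\<close>)
    qed
  qed
  then have conv: "AE x in M. (\<lambda>k. s k x) \<longlonglongrightarrow> lim (\<lambda>k. s k x)"
  proof eventually_elim
    case (elim x)
    have "summable (\<lambda>k. s (Suc k) x - s k x)"
      by (rule summable_rabs_cancel) (use elim in \<open>simp add: d_def\<close>)
    then have "convergent (\<lambda>n. \<Sum>k<n. s (Suc k) x - s k x)"
      by (simp add: summable_iff_convergent)
    then have "convergent (\<lambda>n. s n x - s 0 x)"
      using sum_lessThan_telescope[of "\<lambda>k. s k x"] by simp
    then obtain l where "(\<lambda>n. s n x - s 0 x) \<longlonglongrightarrow> l" by (auto simp: convergent_def)
    then have "(\<lambda>n. (s n x - s 0 x) + s 0 x) \<longlonglongrightarrow> l + s 0 x"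
      by (intro tendsto_intros)
    then show ?case by (auto simp: limI)
  qed
  define f where "f x = lim (\<lambda>k. s k x)" for x
  have [measurable]: "f \<in> borel_measurable M"
    unfolding f_def by (rule borel_measurable_lim_metric) simp
  have fatou: "(\<integral>\<^sup>+x. ennreal ((f x - s k x)\<^sup>2) \<partial>M) \<le> ennreal ((1/4) ^ k)" for k
  proof -
    have "(\<integral>\<^sup>+x. ennreal ((f x - s k x)\<^sup>2) \<partial>M)
        \<le> (\<integral>\<^sup>+x. liminf (\<lambda>j. ennreal ((s j x - s k x)\<^sup>2)) \<partial>M)"
    proof (rule nn_integral_mono_AE, use conv in eventually_elim)
      case (elim x)
      have "(\<lambda>j. ennreal ((s j x - s k x)\<^sup>2)) \<longlonglongrightarrow> ennreal ((f x - s k x)\<^sup>2)"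
        unfolding f_def by (intro tendsto_intros tendsto_ennrealI elim)
      then have "liminf (\<lambda>j. ennreal ((s j x - s k x)\<^sup>2)) = ennreal ((f x - s k x)\<^sup>2)"
        by (intro lim_imp_Liminf) auto
      then show ?case by simp
    qed
    also have "\<dots> \<le> liminf (\<lambda>j. \<integral>\<^sup>+x. ennreal ((s j x - s k x)\<^sup>2) \<partial>M)"
      by (rule nn_integral_liminf) measurable
    also have "\<dots> \<le> ennreal ((1/4) ^ k)"
    proof (rule Liminf_le)
      show "\<forall>\<^sub>F j in sequentially. (\<integral>\<^sup>+x. ennreal ((s j x - s k x)\<^sup>2) \<partial>M) \<le> ennreal ((1/4) ^ k)"
        using eventually_ge_at_top[of k]
      proof eventually_elim
        case (elim j)
        have "(\<integral>\<^sup>+x. ennreal ((s j x - s k x)\<^sup>2) \<partial>M)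
            = ennreal (\<integral>x. (s j x - s k x)\<^sup>2 \<partial>M)"
          by (intro nn_integral_eq_integral L2_D L2_diff s) auto
        also have "\<dots> \<le> ennreal ((1/4) ^ k)"
          using bound[OF elim] by (intro ennreal_leI) (simp add: L2_inner_def power2_eq_square)
        finally show ?case .
      qed
    qed simp
    finally show ?thesis .
  qed
  have diffL2: "(\<lambda>x. f x - s k x) \<in> L2 M" for k
  proof -
    have "(\<integral>\<^sup>+x. ennreal ((f x - s k x)\<^sup>2) \<partial>M) < \<infinity>"
      using fatou[of k] by (rule le_less_trans) simp
    then have "integrable M (\<lambda>x. (f x - s k x)\<^sup>2)"
      by (intro integrableI_bounded) auto
    then show ?thesis by (simp add: L2_def)
  qed
  show ?thesis
  proof (rule that)
    show "f \<in> L2 M" using L2_add[OF diffL2[of 0] s[of 0]] by simp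
    show "(\<lambda>k. L2_inner M (\<lambda>x. f x - s k x) (\<lambda>x. f x - s k x)) \<longlonglongrightarrow> 0"
    proof (rule tendsto_sandwich[OF always_eventually always_eventually])
      show "\<forall>k. 0 \<le> L2_inner M (\<lambda>x. f x - s k x) (\<lambda>x. f x - s k x)"
        by (simp add: L2_inner_self_nonneg)
      show "\<forall>k. L2_inner M (\<lambda>x. f x - s k x) (\<lambda>x. f x - s k x) \<le> (1/4) ^ k"
      proof
        fix k
        have "ennreal (\<integral>x. (f x - s k x)\<^sup>2 \<partial>M) \<le> ennreal ((1/4) ^ k)"
          using fatou[of k] nn_integral_eq_integral[OF L2_D(2)[OF diffL2[of k]]] by simp
        then show "L2_inner M (\<lambda>x. f x - s k x) (\<lambda>x. f x - s k x) \<le> (1/4) ^ k"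
          by (simp add: L2_inner_def power2_eq_square)
      qed
      show "(\<lambda>k. (1/4::real) ^ k) \<longlonglongrightarrow> 0"
        by (intro LIMSEQ_power_zero) simp
    qed simp
  qed
qed


section \<open>Orthonormal bases\<close>

text \<open>Sums over index sets without a chosen enumeration are approximated along finite subsets; this
supplies the finite sets that replace partial sums.\<close>

lemma infsum_finite_approximation:
  fixes f :: "'i \<Rightarrow> real"
  assumes f: "f summable_on J" and \<delta>: "0 < \<delta>"
  shows "\<exists>F. finite F \<and> F \<subseteq> J \<and> infsum f J - \<delta> \<le> (\<Sum>i\<in>F. f i)"
proof (rule ccontr)
  assume *: "\<not> ?thesis"
  have "infsum f J \<le> infsum f J - \<delta>"
  proof (rule infsum_le_finite_sums[OF f])
    fix F assume "finite F" "F \<subseteq> J"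
    with * have "\<not> infsum f J - \<delta> \<le> (\<Sum>i\<in>F. f i)" by blast
    then show "(\<Sum>i\<in>F. f i) \<le> infsum f J - \<delta>" by linarith
  qed
  with \<delta> show False by linarith
qed

locale orthonormal_basis = finite_measure M for M :: "'a measure" +
  fixes I :: "'i set" and e :: "'i \<Rightarrow> 'a \<Rightarrow> real"
  assumes e_L2: "i \<in> I \<Longrightarrow> e i \<in> L2 M"
    and orthonormal: "i \<in> I \<Longrightarrow> j \<in> I \<Longrightarrow> L2_inner M (e i) (e j) = (if i = j then 1 else 0)"
    and complete: "f \<in> L2 M \<Longrightarrow> (\<And>i. i \<in> I \<Longrightarrow> L2_inner M f (e i) = 0) \<Longrightarrow> AE x in M. f x = 0"
begin

lemma coefficients_determine:
  assumes "f \<in> L2 M" "g \<in> L2 M" "\<And>i. i \<in> I \<Longrightarrow> L2_inner M f (e i) = L2_inner M g (e i)"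
  shows "AE x in M. f x = g x"
proof -
  have "AE x in M. f x - g x = 0"
    using assms by (intro complete L2_diff) (auto simp: L2_inner_diff e_L2)
  then show ?thesis by simp
qed

lemma finite_expansion_L2: "F \<subseteq> I \<Longrightarrow> (\<lambda>x. \<Sum>i\<in>F. c i * e i x) \<in> L2 M"
  by (intro L2_sum L2_scale e_L2) auto

lemma finite_expansion_coefficient:
  assumes "finite F" "F \<subseteq> I" "i \<in> I"
  shows "L2_inner M (\<lambda>x. \<Sum>i\<in>F. c i * e i x) (e i) = (if i \<in> F then c i else 0)"
proof -
  have "L2_inner M (\<lambda>x. \<Sum>i\<in>F. c i * e i x) (e i) = (\<Sum>j\<in>F. c j * L2_inner M (e j) (e i))"
    using assms by (intro L2_inner_sum) (auto intro: e_L2)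
  also have "\<dots> = (\<Sum>j\<in>F. if j = i then c j else 0)"
    using assms by (intro sum.cong) (auto simp: orthonormal)
  finally show ?thesis using assms by simp
qed

lemma inner_finite_expansion:
  assumes "finite F" "F \<subseteq> I" "f \<in> L2 M"
  shows "L2_inner M f (\<lambda>x. \<Sum>i\<in>F. c i * e i x) = (\<Sum>i\<in>F. c i * L2_inner M f (e i))"
proof -
  have "L2_inner M (\<lambda>x. \<Sum>i\<in>F. c i * e i x) f = (\<Sum>j\<in>F. c j * L2_inner M (e j) f)"
    using assms by (intro L2_inner_sum) (auto intro: e_L2)
  then show ?thesis
    unfolding L2_inner_commute[of M f "\<lambda>x. \<Sum>i\<in>F. c i * e i x"] by (simp add: L2_inner_commute[of M "e _" f])
qed

lemma finite_expansion_norm: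
  assumes "finite F" "F \<subseteq> I"
  shows "L2_inner M (\<lambda>x. \<Sum>i\<in>F. c i * e i x) (\<lambda>x. \<Sum>i\<in>F. c i * e i x) = (\<Sum>i\<in>F. (c i)\<^sup>2)"
proof -
  have "L2_inner M (\<lambda>x. \<Sum>i\<in>F. c i * e i x) (\<lambda>x. \<Sum>i\<in>F. c i * e i x)
      = (\<Sum>i\<in>F. c i * L2_inner M (\<lambda>x. \<Sum>i\<in>F. c i * e i x) (e i))"
    by (rule inner_finite_expansion[OF assms finite_expansion_L2[OF assms(2)]])
  also have "\<dots> = (\<Sum>i\<in>F. c i * c i)"
    using assms by (intro sum.cong refl) (auto simp: finite_expansion_coefficient subsetD)
  finally show ?thesis by (simp add: power2_eq_square)
qed

lemma Bessel:
  assumes "finite F" "F \<subseteq> I" "f \<in> L2 M"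
  shows "(\<Sum>i\<in>F. (L2_inner M f (e i))\<^sup>2) \<le> L2_inner M f f"
proof -
  let ?c = "\<lambda>i. L2_inner M f (e i)"
  let ?s = "\<lambda>x. \<Sum>i\<in>F. ?c i * e i x"
  have "0 \<le> L2_inner M (\<lambda>x. 1 * f x + (-1) * ?s x) (\<lambda>x. 1 * f x + (-1) * ?s x)"
    by (rule L2_inner_self_nonneg)
  also have "\<dots> = L2_inner M f f - 2 * L2_inner M f ?s + L2_inner M ?s ?s"
    using L2_inner_self_lincomb[OF assms(3) finite_expansion_L2[OF assms(2)], of 1 "-1" ?c] by simp
  also have "L2_inner M f ?s = (\<Sum>i\<in>F. (?c i)\<^sup>2)"
    using inner_finite_expansion[OF assms] by (simp add: power2_eq_square)
  also have "L2_inner M ?s ?s = (\<Sum>i\<in>F. (?c i)\<^sup>2)"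
    by (rule finite_expansion_norm[OF assms(1,2)])
  finally show ?thesis by simp
qed

lemma coefficients_summable:
  assumes "f \<in> L2 M"
  shows "(\<lambda>i. (L2_inner M f (e i))\<^sup>2) summable_on I"
  by (rule nonneg_bounded_partial_sums_imp_summable_on[where C="L2_inner M f f"])
    (auto intro!: eventually_finite_subsets_at_top_weakI Bessel assms)

text \<open>The partial sums run over an increasing sequence of finite sets whose complements carry at most
\<open>4\<^sup>-\<^sup>k\<close> of the total \<open>\<Sum> (c i)\<^sup>2\<close>. This rate is what makes them a rapid Cauchy sequence, and an index
that none of these sets contains has coefficient zero.\<close>

lemma Riesz_Fischer:
  assumes sm: "(\<lambda>i. (c i)\<^sup>2) summable_on I"
  obtains f where "f \<in> L2 M" "\<And>i. i \<in> I \<Longrightarrow> L2_inner M f (e i) = c i"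
    "L2_inner M f f = (\<Sum>\<^sub>\<infinity>i\<in>I. (c i)\<^sup>2)"
proof -
  let ?S = "\<Sum>\<^sub>\<infinity>i\<in>I. (c i)\<^sup>2"
  have "\<forall>k. \<exists>F. finite F \<and> F \<subseteq> I \<and> ?S - (1/4) ^ k \<le> (\<Sum>i\<in>F. (c i)\<^sup>2)"
    by (intro allI infsum_finite_approximation[OF sm]) simp
  from choice[OF this] obtain F0 where F0: "\<And>k. finite (F0 k)" "\<And>k. F0 k \<subseteq> I"
      "\<And>k. ?S - (1/4) ^ k \<le> (\<Sum>i\<in>F0 k. (c i)\<^sup>2)"
    by blast
  define F where "F k = (\<Union>j\<le>k. F0 j)" for k
  have F: "finite (F k)" "F k \<subseteq> I" for k
    using F0 by (auto simp: F_def)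
  have F_mono: "F k \<subseteq> F j" if "k \<le> j" for k j
    using that unfolding F_def by (intro UN_mono) auto
  have F_ge: "?S - (1/4) ^ k \<le> (\<Sum>i\<in>F k. (c i)\<^sup>2)" for k
  proof -
    have "(\<Sum>i\<in>F0 k. (c i)\<^sup>2) \<le> (\<Sum>i\<in>F k. (c i)\<^sup>2)"
      using F by (intro sum_mono2) (auto simp: F_def)
    with F0(3)[of k] show ?thesis by simp
  qed
  have F_le: "(\<Sum>i\<in>G. (c i)\<^sup>2) \<le> ?S" if "finite G" "G \<subseteq> I" for G
    by (rule finite_sum_le_infsum[OF sm that]) simp
  define s where "s k x = (\<Sum>i\<in>F k. c i * e i x)" for k x
  have s: "s k \<in> L2 M" for k
    unfolding s_def by (rule finite_expansion_L2[OF F(2)])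
  have bound: "L2_inner M (\<lambda>x. s j x - s k x) (\<lambda>x. s j x - s k x) \<le> (1/4) ^ k" if "k \<le> j" for j k
  proof -
    have "(\<lambda>x. s j x - s k x) = (\<lambda>x. \<Sum>i\<in>F j - F k. c i * e i x)"
      unfolding s_def using F F_mono[OF that] by (auto simp: sum_diff)
    then have "L2_inner M (\<lambda>x. s j x - s k x) (\<lambda>x. s j x - s k x) = (\<Sum>i\<in>F j - F k. (c i)\<^sup>2)"
      using finite_expansion_norm[of "F j - F k" c] F[of j] by (metis Diff_subset finite_Diff subset_trans)
    also have "\<dots> = (\<Sum>i\<in>F j. (c i)\<^sup>2) - (\<Sum>i\<in>F k. (c i)\<^sup>2)"
      by (rule sum_diff[OF F(1) F_mono[OF that]])
    finally show ?thesis using F_ge[of k] F_le[OF F(1) F(2), of j] by linarith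
  qed
  obtain f where f: "f \<in> L2 M" "(\<lambda>k. L2_inner M (\<lambda>x. f x - s k x) (\<lambda>x. f x - s k x)) \<longlonglongrightarrow> 0"
    by (rule L2_complete[of s, OF s bound])
  show ?thesis
  proof (rule that[OF f(1)])
    fix i assume i: "i \<in> I"
    have "(\<lambda>k. L2_inner M (s k) (e i)) \<longlonglongrightarrow> L2_inner M f (e i)"
      by (rule L2_inner_tendsto[OF s f(1) e_L2[OF i] f(2)])
    moreover have "(\<lambda>k. L2_inner M (s k) (e i)) \<longlonglongrightarrow> c i"
    proof -
      have sk: "L2_inner M (s k) (e i) = (if i \<in> F k then c i else 0)" for k
        unfolding s_def[abs_def] by (rule finite_expansion_coefficient[OF F i])
      have c: "(L2_inner M (s k) (e i) - c i)\<^sup>2 \<le> (1/4) ^ k" for k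
      proof (cases "i \<in> F k")
        case False
        have "(\<Sum>i\<in>insert i (F k). (c i)\<^sup>2) \<le> ?S"
          using F[of k] i by (intro F_le) auto
        then show ?thesis
          using F_ge[of k] F(1)[of k] False by (simp add: sk)
      qed (simp add: sk)
      have "(\<lambda>k. (L2_inner M (s k) (e i) - c i)\<^sup>2) \<longlonglongrightarrow> 0"
      proof (rule Lim_null_comparison)
        show "\<forall>\<^sub>F k in sequentially. norm ((L2_inner M (s k) (e i) - c i)\<^sup>2) \<le> (1/4) ^ k"
          using c by simp
        show "(\<lambda>k. (1/4::real) ^ k) \<longlonglongrightarrow> 0" by (rule LIMSEQ_power_zero) simp
      qed
      from tendsto_real_sqrt[OF this] have "(\<lambda>k. L2_inner M (s k) (e i) - c i) \<longlonglongrightarrow> 0"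
        by (simp add: tendsto_rabs_zero_iff)
      then show ?thesis by (simp add: LIM_zero_iff)
    qed
    ultimately show "L2_inner M f (e i) = c i" by (rule LIMSEQ_unique)
  next
    have "(\<lambda>k. L2_inner M (s k) (s k)) \<longlonglongrightarrow> L2_inner M f f"
      by (rule L2_inner_self_tendsto[OF s f])
    moreover have "(\<lambda>k. L2_inner M (s k) (s k)) \<longlonglongrightarrow> ?S"
    proof (rule tendsto_sandwich[OF always_eventually always_eventually])
      have sk: "L2_inner M (s k) (s k) = (\<Sum>i\<in>F k. (c i)\<^sup>2)" for k
        unfolding s_def[abs_def] by (rule finite_expansion_norm[OF F])
      show "\<forall>k. ?S - (1/4) ^ k \<le> L2_inner M (s k) (s k)" using F_ge by (simp add: sk)
      show "\<forall>k. L2_inner M (s k) (s k) \<le> ?S" using F_le[OF F] by (simp add: sk)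
      have "(\<lambda>k. ?S - (1/4) ^ k) \<longlonglongrightarrow> ?S - 0"
        by (intro tendsto_intros LIMSEQ_power_zero) simp
      then show "(\<lambda>k. ?S - (1/4) ^ k) \<longlonglongrightarrow> ?S" by simp
    qed simp
    ultimately show "L2_inner M f f = ?S" by (rule LIMSEQ_unique)
  qed
qed

text \<open>A function with the same coefficients is produced by the Riesz-Fischer theorem together with its
norm; completeness of the system identifies the two almost everywhere.\<close>

lemma Parseval:
  assumes f: "f \<in> L2 M"
  shows "L2_inner M f f = (\<Sum>\<^sub>\<infinity>i\<in>I. (L2_inner M f (e i))\<^sup>2)"
proof -
  obtain g where g: "g \<in> L2 M" "\<And>i. i \<in> I \<Longrightarrow> L2_inner M g (e i) = L2_inner M f (e i)"
    "L2_inner M g g = (\<Sum>\<^sub>\<infinity>i\<in>I. (L2_inner M f (e i))\<^sup>2)"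
    using Riesz_Fischer[OF coefficients_summable[OF f]] by blast
  have "AE x in M. f x = g x"
    using f g by (intro coefficients_determine) auto
  then have "L2_inner M f f = L2_inner M g g"
    using f g by (intro L2_inner_cong_AE) (auto dest: L2_D)
  with g show ?thesis by simp
qed

end

section \<open>Reproducing kernels\<close>

lemma has_sum_finite_sum:
  fixes f :: "'t \<Rightarrow> 'i \<Rightarrow> real"
  assumes "finite T" "\<And>t. t \<in> T \<Longrightarrow> (f t has_sum s t) I"
  shows "((\<lambda>i. \<Sum>t\<in>T. f t i) has_sum (\<Sum>t\<in>T. s t)) I"
  using assms by (induction T) (auto intro!: has_sum_add)

text \<open>A Hilbert space of continuous functions described by Fourier coefficients: \<open>q\<close> weights the squared
coefficients, and the bound on \<open>\<Sum> (e i x)\<^sup>2 / q i\<close> says that point evaluations are bounded, uniformly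
in the point. The last condition identifies a continuous function with its class in \<open>L\<^sup>2\<close>.\<close>

locale mercer_system = orthonormal_basis M I e
  for M :: "'a::topological_space measure" and I :: "'i set" and e :: "'i \<Rightarrow> 'a \<Rightarrow> real" +
  fixes q :: "'i \<Rightarrow> real" and B :: real
  assumes q_pos: "i \<in> I \<Longrightarrow> 0 < q i"
    and e_continuous: "i \<in> I \<Longrightarrow> continuous_on (space M) (e i)"
    and B_nonneg: "0 \<le> B"
    and kernel_bound: "x \<in> space M \<Longrightarrow> finite F \<Longrightarrow> F \<subseteq> I \<Longrightarrow> (\<Sum>i\<in>F. (e i x)\<^sup>2 / q i) \<le> B"
    and continuous_L2: "continuous_on (space M) f \<Longrightarrow> f \<in> L2 M"
    and full_support:
      "continuous_on (space M) f \<Longrightarrow> AE x in M. f x = 0 \<Longrightarrow> x \<in> space M \<Longrightarrow> f x = 0"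
begin

definition finite_energy :: "('a \<Rightarrow> real) \<Rightarrow> bool" where
  "finite_energy f \<longleftrightarrow> (\<lambda>i. q i * (L2_inner M f (e i))\<^sup>2) summable_on I"

definition energy :: "('a \<Rightarrow> real) \<Rightarrow> real" where
  "energy f = (\<Sum>\<^sub>\<infinity>i\<in>I. q i * (L2_inner M f (e i))\<^sup>2)"

definition kernel :: "'a \<Rightarrow> 'a \<Rightarrow> real" where
  "kernel x y = (\<Sum>\<^sub>\<infinity>i\<in>I. e i x / q i * e i y)"

text \<open>Cauchy-Schwarz after splitting \<open>c i * e i x\<close> as \<open>(sqrt (q i) * c i) * (e i x / sqrt (q i))\<close>.\<close>

lemma weighted_Cauchy_Schwarz:
  assumes "x \<in> space M" "finite F" "F \<subseteq> I"
  shows "(\<Sum>i\<in>F. \<bar>c i * e i x\<bar>) \<le> sqrt (\<Sum>i\<in>F. q i * (c i)\<^sup>2) * sqrt B"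
proof -
  have q: "0 < q i" if "i \<in> F" for i using q_pos that assms by auto
  have "(\<Sum>i\<in>F. \<bar>c i * e i x\<bar>) = (\<Sum>i\<in>F. (sqrt (q i) * \<bar>c i\<bar>) * (\<bar>e i x\<bar> / sqrt (q i)))"
    by (rule sum.cong) (use q in \<open>auto simp: abs_mult dest: q\<close>)
  also have "\<dots> \<le> sqrt ((\<Sum>i\<in>F. (sqrt (q i) * \<bar>c i\<bar>)\<^sup>2) * (\<Sum>i\<in>F. (\<bar>e i x\<bar> / sqrt (q i))\<^sup>2))"
    by (rule real_le_rsqrt[OF Cauchy_Schwarz_ineq_sum])
  also have "(\<Sum>i\<in>F. (sqrt (q i) * \<bar>c i\<bar>)\<^sup>2) = (\<Sum>i\<in>F. q i * (c i)\<^sup>2)"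
    by (rule sum.cong) (auto simp: power_mult_distrib less_imp_le q)
  also have "(\<Sum>i\<in>F. (\<bar>e i x\<bar> / sqrt (q i))\<^sup>2) = (\<Sum>i\<in>F. (e i x)\<^sup>2 / q i)"
    by (rule sum.cong) (auto simp: power_divide less_imp_le q)
  also have "sqrt ((\<Sum>i\<in>F. q i * (c i)\<^sup>2) * (\<Sum>i\<in>F. (e i x)\<^sup>2 / q i))
      \<le> sqrt (\<Sum>i\<in>F. q i * (c i)\<^sup>2) * sqrt B"
    unfolding real_sqrt_mult using kernel_bound[OF assms]
    by (intro mult_left_mono real_sqrt_le_mono real_sqrt_ge_zero sum_nonneg)
      (auto simp: less_imp_le q)
  finally show ?thesis .
qed

text \<open>The terms need not be dominated by a summable sequence that is independent of \<open>x\<close>, so the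
Weierstrass test is not the reason for uniform convergence: instead the tail at \<open>x\<close> is at most
\<open>sqrt B\<close> times the square root of the tail of \<open>\<Sum> q c\<^sup>2\<close>.\<close>

lemma Fourier_series:
  assumes sm: "(\<lambda>i. q i * (c i)\<^sup>2) summable_on I"
  obtains f where "continuous_on (space M) f" "\<And>i. i \<in> I \<Longrightarrow> L2_inner M f (e i) = c i"
    "\<And>x. x \<in> space M \<Longrightarrow> ((\<lambda>i. c i * e i x) has_sum f x) I"
proof -
  define S where "S = (\<Sum>\<^sub>\<infinity>i\<in>I. q i * (c i)\<^sup>2)"
  have nonneg: "0 \<le> q i * (c i)\<^sup>2" if "i \<in> I" for i
    using q_pos[OF that] by simp
  have S_ge: "(\<Sum>i\<in>F. q i * (c i)\<^sup>2) \<le> S" if "finite F" "F \<subseteq> I" for F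
    unfolding S_def by (rule finite_sum_le_infsum[OF sm that]) (use nonneg in auto)
  have abs_sm: "(\<lambda>i. \<bar>c i * e i x\<bar>) summable_on I" if x: "x \<in> space M" for x
  proof (rule nonneg_bounded_partial_sums_imp_summable_on)
    show "\<forall>\<^sub>F F in finite_subsets_at_top I. (\<Sum>i\<in>F. \<bar>c i * e i x\<bar>) \<le> sqrt S * sqrt B"
    proof (rule eventually_finite_subsets_at_top_weakI)
      fix F assume F: "finite F" "F \<subseteq> I"
      have "(\<Sum>i\<in>F. \<bar>c i * e i x\<bar>) \<le> sqrt (\<Sum>i\<in>F. q i * (c i)\<^sup>2) * sqrt B"
        by (rule weighted_Cauchy_Schwarz[OF x F])
      also have "\<dots> \<le> sqrt S * sqrt B"
        using S_ge[OF F] B_nonneg by (intro mult_right_mono real_sqrt_le_mono) auto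
      finally show "(\<Sum>i\<in>F. \<bar>c i * e i x\<bar>) \<le> sqrt S * sqrt B" .
    qed
  qed simp
  define f where "f x = (\<Sum>\<^sub>\<infinity>i\<in>I. c i * e i x)" for x
  have abs_sm': "(\<lambda>i. norm (c i * e i x)) summable_on I" if "x \<in> space M" for x
    using abs_sm[OF that] by simp
  have f_sum: "((\<lambda>i. c i * e i x) has_sum f x) I" if "x \<in> space M" for x
    unfolding f_def by (rule has_sum_infsum[OF abs_summable_summable[OF abs_sm'[OF that]]])
  \<comment> \<open>The tail of the series at \<open>x\<close> is controlled by the tail of \<open>\<Sum> q c\<^sup>2\<close>, uniformly in \<open>x\<close>.\<close>
  have tail: "\<exists>F0. finite F0 \<and> F0 \<subseteq> I \<and> (\<forall>F. finite F \<and> F0 \<subseteq> F \<and> F \<subseteq> I \<longrightarrow>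
      (\<forall>x\<in>space M. \<bar>f x - (\<Sum>i\<in>F. c i * e i x)\<bar> \<le> \<epsilon>))" if "\<epsilon> > 0" for \<epsilon> :: real
  proof -
    \<comment> \<open>Chosen so that \<open>sqrt \<delta> * sqrt B \<le> \<epsilon>\<close>; the summand 1 covers \<open>B = 0\<close>.\<close>
    define \<delta> where "\<delta> = (\<epsilon> / (sqrt B + 1))\<^sup>2"
    have B1: "sqrt B + 1 > 0" using B_nonneg by (simp add: add_nonneg_pos)
    then have "\<delta> > 0" using \<open>\<epsilon> > 0\<close> by (simp add: \<delta>_def)
    have "\<exists>F0. finite F0 \<and> F0 \<subseteq> I \<and> S - \<delta> \<le> (\<Sum>i\<in>F0. q i * (c i)\<^sup>2)"
      unfolding S_def by (rule infsum_finite_approximation[OF sm \<open>\<delta> > 0\<close>])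
    then obtain F0 where F0: "finite F0" "F0 \<subseteq> I" "S - \<delta> \<le> (\<Sum>i\<in>F0. q i * (c i)\<^sup>2)"
      by blast
    have unif: "\<bar>f x - (\<Sum>i\<in>F. c i * e i x)\<bar> \<le> \<epsilon>"
      if F: "finite F" "F0 \<subseteq> F" "F \<subseteq> I" and x: "x \<in> space M" for F x
    proof -
      have sm1: "(\<lambda>i. c i * e i x) summable_on I"
        using f_sum[OF x] by (rule has_sum_imp_summable)
      have "f x - (\<Sum>i\<in>F. c i * e i x) = (\<Sum>\<^sub>\<infinity>i\<in>I - F. c i * e i x)"
        using infsum_Diff[OF sm1 summable_on_finite[OF F(1)] F(3)] F(1) by (simp add: f_def)
      also have "\<bar>\<dots>\<bar> \<le> (\<Sum>\<^sub>\<infinity>i\<in>I - F. \<bar>c i * e i x\<bar>)"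
        using norm_infsum_bound[of "\<lambda>i. c i * e i x" "I - F"]
          summable_on_subset_banach[OF abs_sm[OF x], of "I - F"] by simp
      also have "\<dots> \<le> sqrt \<delta> * sqrt B"
      proof (rule infsum_le_finite_sums)
        show "(\<lambda>i. \<bar>c i * e i x\<bar>) summable_on I - F"
          by (rule summable_on_subset_banach[OF abs_sm[OF x]]) auto
        fix G assume G: "finite G" "G \<subseteq> I - F"
        have "(\<Sum>i\<in>G. q i * (c i)\<^sup>2) + (\<Sum>i\<in>F. q i * (c i)\<^sup>2) = (\<Sum>i\<in>G \<union> F. q i * (c i)\<^sup>2)"
          using G F by (intro sum.union_disjoint[symmetric]) auto
        also have "\<dots> \<le> S" using G F by (intro S_ge) auto
        finally have "(\<Sum>i\<in>G. q i * (c i)\<^sup>2) \<le> S - (\<Sum>i\<in>F. q i * (c i)\<^sup>2)" by simp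
        also have "(\<Sum>i\<in>F0. q i * (c i)\<^sup>2) \<le> (\<Sum>i\<in>F. q i * (c i)\<^sup>2)"
          by (rule sum_mono2[OF F(1,2)]) (use F nonneg in blast)
        then have "S - (\<Sum>i\<in>F. q i * (c i)\<^sup>2) \<le> \<delta>" using F0(3) by linarith
        finally have Gd: "(\<Sum>i\<in>G. q i * (c i)\<^sup>2) \<le> \<delta>" .
        have "(\<Sum>i\<in>G. \<bar>c i * e i x\<bar>) \<le> sqrt (\<Sum>i\<in>G. q i * (c i)\<^sup>2) * sqrt B"
          using G by (intro weighted_Cauchy_Schwarz x) auto
        also have "\<dots> \<le> sqrt \<delta> * sqrt B"
          using Gd B_nonneg by (intro mult_right_mono real_sqrt_le_mono) auto
        finally show "(\<Sum>i\<in>G. \<bar>c i * e i x\<bar>) \<le> sqrt \<delta> * sqrt B" .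
      qed
      also have "\<dots> = \<epsilon> * (sqrt B / (sqrt B + 1))"
        using \<open>\<epsilon> > 0\<close> B1 by (simp add: \<delta>_def)
      also have "\<dots> \<le> \<epsilon> * 1"
        using \<open>\<epsilon> > 0\<close> B1 by (intro mult_left_mono) auto
      finally show ?thesis by simp
    qed
    show ?thesis
      by (intro exI[of _ F0] conjI allI impI ballI F0 unif) auto
  qed
  have "uniform_limit (space M) (\<lambda>F x. \<Sum>i\<in>F. c i * e i x) f (finite_subsets_at_top I)"
  proof (rule uniform_limitI)
    fix \<epsilon> :: real assume "\<epsilon> > 0"
    then obtain F0 where F0: "finite F0" "F0 \<subseteq> I" "\<And>F x. finite F \<Longrightarrow> F0 \<subseteq> F \<Longrightarrow> F \<subseteq> I \<Longrightarrow>
        x \<in> space M \<Longrightarrow> \<bar>f x - (\<Sum>i\<in>F. c i * e i x)\<bar> \<le> \<epsilon> / 2"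
      using tail[of "\<epsilon> / 2"] by (auto simp del: divide_le_eq_numeral1 le_divide_eq_numeral1)
    show "\<forall>\<^sub>F F in finite_subsets_at_top I.
        \<forall>x\<in>space M. dist (\<Sum>i\<in>F. c i * e i x) (f x) < \<epsilon>"
      unfolding eventually_finite_subsets_at_top
    proof (intro exI[of _ F0] conjI allI impI ballI F0)
      fix F x assume F: "finite F \<and> F0 \<subseteq> F \<and> F \<subseteq> I" and x: "x \<in> space M"
      have "\<bar>f x - (\<Sum>i\<in>F. c i * e i x)\<bar> \<le> \<epsilon> / 2"
        by (rule F0(3)) (use F x in auto)
      then show "dist (\<Sum>i\<in>F. c i * e i x) (f x) < \<epsilon>"
        using \<open>\<epsilon> > 0\<close> by (simp add: dist_real_def abs_minus_commute)
    qed
  qed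
  then have f_cont: "continuous_on (space M) f"
  proof (rule uniform_limit_theorem[rotated])
    show "\<forall>\<^sub>F F in finite_subsets_at_top I. continuous_on (space M) (\<lambda>x. \<Sum>i\<in>F. c i * e i x)"
      by (rule eventually_finite_subsets_at_top_weakI)
        (intro continuous_on_sum continuous_on_mult continuous_on_const e_continuous, auto)
  qed simp
  have f_L2: "f \<in> L2 M" by (rule continuous_L2[OF f_cont])
  have "L2_inner M f (e i) = c i" if i: "i \<in> I" for i
  proof -
    let ?\<mu> = "measure M (space M)"
    have "\<bar>L2_inner M f (e i) - c i\<bar> \<le> \<epsilon> * sqrt ?\<mu>" if "\<epsilon> > 0" for \<epsilon>
    proof -
      obtain F0 where F0: "finite F0" "F0 \<subseteq> I" "\<And>F x. finite F \<Longrightarrow> F0 \<subseteq> F \<Longrightarrow> F \<subseteq> I \<Longrightarrow>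
          x \<in> space M \<Longrightarrow> \<bar>f x - (\<Sum>i\<in>F. c i * e i x)\<bar> \<le> \<epsilon>"
        using tail[OF \<open>\<epsilon> > 0\<close>] by auto
      define F where "F = insert i F0"
      have F: "finite F" "F0 \<subseteq> F" "F \<subseteq> I" "i \<in> F" using F0 i by (auto simp: F_def)
      define s where "s x = (\<Sum>i\<in>F. c i * e i x)" for x
      have s: "s \<in> L2 M" unfolding s_def by (rule finite_expansion_L2[OF F(3)])
      have d: "(\<lambda>x. f x - s x) \<in> L2 M" by (rule L2_diff[OF f_L2 s])
      have "L2_inner M (\<lambda>x. f x - s x) (e i) = L2_inner M f (e i) - L2_inner M s (e i)"
        by (rule L2_inner_diff[OF f_L2 s e_L2[OF i]])
      also have "L2_inner M s (e i) = c i"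
        using finite_expansion_coefficient[OF F(1) F(3) i, of c] F(4) by (simp add: s_def[abs_def])
      finally have "(L2_inner M f (e i) - c i)\<^sup>2
          \<le> L2_inner M (\<lambda>x. f x - s x) (\<lambda>x. f x - s x) * L2_inner M (e i) (e i)"
        using L2_Cauchy_Schwarz[OF d e_L2[OF i]] by simp
      also have "\<dots> = L2_inner M (\<lambda>x. f x - s x) (\<lambda>x. f x - s x)"
        using orthonormal[OF i i] by simp
      also have "\<dots> = (\<integral>x. (f x - s x)\<^sup>2 \<partial>M)"
        by (simp add: L2_inner_def power2_eq_square)
      also have "\<dots> \<le> (\<integral>x. \<epsilon>\<^sup>2 \<partial>M)"
      proof (rule integral_mono)
        show "integrable M (\<lambda>x. (f x - s x)\<^sup>2)" by (rule L2_D(2)[OF d])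
        show "(f x - s x)\<^sup>2 \<le> \<epsilon>\<^sup>2" if "x \<in> space M" for x
          using F0(3)[OF F(1,2,3) that] \<open>\<epsilon> > 0\<close> by (simp add: s_def abs_le_square_iff[symmetric])
      qed simp
      also have "\<dots> = \<epsilon>\<^sup>2 * ?\<mu>" by simp
      finally have "\<bar>L2_inner M f (e i) - c i\<bar> \<le> sqrt (\<epsilon>\<^sup>2 * ?\<mu>)"
        by (metis real_sqrt_abs real_sqrt_le_iff)
      then show ?thesis using \<open>\<epsilon> > 0\<close> by (simp add: real_sqrt_mult)
    qed note * = this
    show ?thesis
    proof (rule ccontr)
      assume ne: "\<not> ?thesis"
      define \<epsilon> where "\<epsilon> = \<bar>L2_inner M f (e i) - c i\<bar> / (2 * (sqrt ?\<mu> + 1))"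
      have mu: "sqrt ?\<mu> \<ge> 0" by simp
      then have mu1: "sqrt ?\<mu> + 1 > 0" by linarith
      then have "\<epsilon> > 0" using ne by (simp add: \<epsilon>_def)
      have "2 * (sqrt ?\<mu> + 1) \<noteq> 0"
        using mult_pos_pos[OF zero_less_numeral mu1] by (metis less_irrefl)
      from iffD1[OF nonzero_eq_divide_eq[OF this] \<epsilon>_def] *[OF \<open>\<epsilon> > 0\<close>]
      have "\<epsilon> * (2 * (sqrt ?\<mu> + 1)) \<le> \<epsilon> * sqrt ?\<mu>" by simp
      moreover have "\<epsilon> * sqrt ?\<mu> \<ge> 0" using mu \<open>\<epsilon> > 0\<close> by simp
      ultimately show False using \<open>\<epsilon> > 0\<close> by (simp add: algebra_simps)
    qed
  qed
  with f_cont f_sum show ?thesis by (intro that) auto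
qed

lemma continuous_determined:
  assumes "continuous_on (space M) f" "continuous_on (space M) g"
    "\<And>i. i \<in> I \<Longrightarrow> L2_inner M f (e i) = L2_inner M g (e i)" "x \<in> space M"
  shows "f x = g x"
proof -
  have "AE x in M. f x = g x"
    using assms by (intro coefficients_determine continuous_L2)
  then have "AE x in M. f x - g x = 0" by simp
  then have "f x - g x = 0"
    using assms by (intro full_support[where f="\<lambda>x. f x - g x"] continuous_on_diff)
  then show ?thesis by simp
qed

text \<open>This is the reproducing property in coordinates: the right-hand side is the weighted inner product
of \<open>g\<close> with the kernel section at \<open>x\<close>, whose coefficients are \<open>e i x / q i\<close>.\<close>

lemma pointwise_Fourier_series:
  assumes g: "continuous_on (space M) g" "finite_energy g" and x: "x \<in> space M"
  shows "((\<lambda>i. L2_inner M g (e i) * e i x) has_sum g x) I"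
proof -
  obtain f where f: "continuous_on (space M) f"
      "\<And>i. i \<in> I \<Longrightarrow> L2_inner M f (e i) = L2_inner M g (e i)"
      "\<And>x. x \<in> space M \<Longrightarrow> ((\<lambda>i. L2_inner M g (e i) * e i x) has_sum f x) I"
    using Fourier_series[of "\<lambda>i. L2_inner M g (e i)"] g(2) unfolding finite_energy_def by blast
  have "f x = g x" by (rule continuous_determined[OF f(1) g(1) f(2) x])
  with f(3)[OF x] show ?thesis by simp
qed

lemma kernel_coefficients_summable:
  assumes "x \<in> space M"
  shows "(\<lambda>i. q i * (e i x / q i)\<^sup>2) summable_on I"
proof (rule nonneg_bounded_partial_sums_imp_summable_on)
  show "0 \<le> q i * (e i x / q i)\<^sup>2" if "i \<in> I" for i
    using q_pos[OF that] by simp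
  show "\<forall>\<^sub>F F in finite_subsets_at_top I. (\<Sum>i\<in>F. q i * (e i x / q i)\<^sup>2) \<le> B"
  proof (rule eventually_finite_subsets_at_top_weakI)
    fix F assume F: "finite F" "F \<subseteq> I"
    have "(\<Sum>i\<in>F. q i * (e i x / q i)\<^sup>2) = (\<Sum>i\<in>F. (e i x)\<^sup>2 / q i)"
      using F q_pos by (intro sum.cong) (auto simp: power_divide power2_eq_square)
    with kernel_bound[OF assms F] show "(\<Sum>i\<in>F. q i * (e i x / q i)\<^sup>2) \<le> B" by simp
  qed
qed

lemma kernel_section:
  assumes x: "x \<in> space M"
  shows "continuous_on (space M) (kernel x)"
    and "i \<in> I \<Longrightarrow> L2_inner M (kernel x) (e i) = e i x / q i"
    and "finite_energy (kernel x)"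
    and "y \<in> space M \<Longrightarrow> ((\<lambda>i. e i x / q i * e i y) has_sum kernel x y) I"
proof -
  obtain f where f: "continuous_on (space M) f" "\<And>i. i \<in> I \<Longrightarrow> L2_inner M f (e i) = e i x / q i"
    "\<And>y. y \<in> space M \<Longrightarrow> ((\<lambda>i. e i x / q i * e i y) has_sum f y) I"
    using Fourier_series[OF kernel_coefficients_summable[OF x]] by blast
  have eq: "kernel x y = f y" if "y \<in> space M" for y
    unfolding kernel_def using f(3)[OF that] by (rule infsumI)
  show "continuous_on (space M) (kernel x)"
    using f(1) by (simp add: eq cong: continuous_on_cong)
  show c: "L2_inner M (kernel x) (e i) = e i x / q i" if "i \<in> I" for i
    using f(2)[OF that] L2_inner_cong[of M "kernel x" f "e i" "e i"] by (simp add: eq)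
  show "finite_energy (kernel x)"
    using kernel_coefficients_summable[OF x] unfolding finite_energy_def
    by (simp add: c cong: summable_on_cong)
  show "((\<lambda>i. e i x / q i * e i y) has_sum kernel x y) I" if "y \<in> space M"
    using f(3)[OF that] eq[OF that] by simp
qed

lemma finite_energy_lincomb:
  assumes "f \<in> L2 M" "g \<in> L2 M" "finite_energy f" "finite_energy g"
  shows "finite_energy (\<lambda>x. a * f x + b * g x)"
  unfolding finite_energy_def
proof (rule summable_on_comparison_test)
  let ?f = "\<lambda>i. L2_inner M f (e i)" and ?g = "\<lambda>i. L2_inner M g (e i)"
  show "(\<lambda>i. 2 * a\<^sup>2 * (q i * (?f i)\<^sup>2) + 2 * b\<^sup>2 * (q i * (?g i)\<^sup>2)) summable_on I"
    using assms(3,4) unfolding finite_energy_def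
    by (intro summable_on_add summable_on_cmult_right)
  show "0 \<le> q i * (L2_inner M (\<lambda>x. a * f x + b * g x) (e i))\<^sup>2" if "i \<in> I" for i
    using q_pos[OF that] by simp
  show "q i * (L2_inner M (\<lambda>x. a * f x + b * g x) (e i))\<^sup>2
      \<le> 2 * a\<^sup>2 * (q i * (?f i)\<^sup>2) + 2 * b\<^sup>2 * (q i * (?g i)\<^sup>2)" if i: "i \<in> I" for i
  proof -
    have "0 \<le> (a * ?f i - b * ?g i)\<^sup>2" by simp
    then have "(a * ?f i + b * ?g i)\<^sup>2 \<le> 2 * a\<^sup>2 * (?f i)\<^sup>2 + 2 * b\<^sup>2 * (?g i)\<^sup>2"
      by (simp add: power2_eq_square algebra_simps)
    from mult_left_mono[OF this less_imp_le[OF q_pos[OF i]]]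
    show ?thesis
      using L2_inner_lincomb[OF assms(1,2) e_L2[OF i], of a b] by (simp add: algebra_simps)
  qed
qed

lemma kernel_combination:
  assumes "finite T" "\<And>t. t \<in> T \<Longrightarrow> x t \<in> space M"
  shows "continuous_on (space M) (\<lambda>y. \<Sum>t\<in>T. b t * kernel (x t) y)"
    and "finite_energy (\<lambda>y. \<Sum>t\<in>T. b t * kernel (x t) y)"
    and "i \<in> I \<Longrightarrow> L2_inner M (\<lambda>y. \<Sum>t\<in>T. b t * kernel (x t) y) (e i)
      = (\<Sum>t\<in>T. b t * e i (x t)) / q i"
proof -
  show "continuous_on (space M) (\<lambda>y. \<Sum>t\<in>T. b t * kernel (x t) y)"
    using assms by (intro continuous_on_sum continuous_on_mult continuous_on_const kernel_section)
  show "finite_energy (\<lambda>y. \<Sum>t\<in>T. b t * kernel (x t) y)"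
    using assms
  proof (induction T)
    case empty
    show ?case by (simp add: finite_energy_def L2_inner_def)
  next
    case (insert t T)
    have k: "kernel (x s) \<in> L2 M" if "s \<in> insert t T" for s
      by (intro continuous_L2 kernel_section(1) insert.prems that)
    have "finite_energy (\<lambda>y. b t * kernel (x t) y + 1 * (\<Sum>t\<in>T. b t * kernel (x t) y))"
      using insert k by (intro finite_energy_lincomb L2_sum L2_scale kernel_section) auto
    with insert show ?case by simp
  qed
  show "L2_inner M (\<lambda>y. \<Sum>t\<in>T. b t * kernel (x t) y) (e i) = (\<Sum>t\<in>T. b t * e i (x t)) / q i"
    if i: "i \<in> I"
  proof -
    have "L2_inner M (\<lambda>y. \<Sum>t\<in>T. b t * kernel (x t) y) (e i)
        = (\<Sum>t\<in>T. b t * L2_inner M (kernel (x t)) (e i))"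
      using assms i by (intro L2_inner_sum continuous_L2 kernel_section(1) e_L2) auto
    also have "\<dots> = (\<Sum>t\<in>T. b t * (e i (x t) / q i))"
      using assms i by (intro sum.cong) (auto simp: kernel_section(2))
    finally show ?thesis by (simp add: sum_divide_distrib)
  qed
qed

text \<open>The mixed term in the expansion of \<open>energy (R + (g - R))\<close> is a combination of inner products of
\<open>g - R\<close> with kernel sections, which the reproducing property turns into point values.\<close>

lemma energy_expansion:
  fixes b :: "'t \<Rightarrow> real"
  assumes T: "finite T" "\<And>t. t \<in> T \<Longrightarrow> x t \<in> space M"
    and g: "continuous_on (space M) g" "finite_energy g"
  defines "R \<equiv> \<lambda>y. \<Sum>t\<in>T. b t * kernel (x t) y"
  shows "energy g = energy R + 2 * (\<Sum>t\<in>T. b t * (g (x t) - R (x t))) + energy (\<lambda>y. g y - R y)"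
    and "finite_energy (\<lambda>y. g y - R y)"
proof -
  define h where "h = (\<lambda>y. g y - R y)"
  have R: "continuous_on (space M) R" "finite_energy R"
    "\<And>i. i \<in> I \<Longrightarrow> L2_inner M R (e i) = (\<Sum>t\<in>T. b t * e i (x t)) / q i"
    unfolding R_def by (rule kernel_combination[OF T]; assumption)+
  have h: "continuous_on (space M) h" "finite_energy h"
    using finite_energy_lincomb[OF continuous_L2[OF g(1)] continuous_L2[OF R(1)] g(2) R(2), of 1 "-1"]
      continuous_on_diff[OF g(1) R(1)] by (auto simp: h_def)
  show "finite_energy (\<lambda>y. g y - R y)" using h(2) by (simp add: h_def)
  have hx: "((\<lambda>i. L2_inner M h (e i) * e i (x t)) has_sum h (x t)) I" if "t \<in> T" for t
    by (rule pointwise_Fourier_series[OF h T(2)[OF that]])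
  have cross: "((\<lambda>i. \<Sum>t\<in>T. b t * (L2_inner M h (e i) * e i (x t))) has_sum
      (\<Sum>t\<in>T. b t * h (x t))) I"
    by (intro has_sum_finite_sum T(1) has_sum_cmult_right hx)
  have "((\<lambda>i. q i * (L2_inner M R (e i))\<^sup>2
        + 2 * (\<Sum>t\<in>T. b t * (L2_inner M h (e i) * e i (x t))) + q i * (L2_inner M h (e i))\<^sup>2)
      has_sum (energy R + 2 * (\<Sum>t\<in>T. b t * h (x t)) + energy h)) I"
    using R(2) h(2) unfolding finite_energy_def energy_def
    by (intro has_sum_add has_sum_cmult_right cross has_sum_infsum)
  also have "?this \<longleftrightarrow> ((\<lambda>i. q i * (L2_inner M g (e i))\<^sup>2)
      has_sum (energy R + 2 * (\<Sum>t\<in>T. b t * h (x t)) + energy h)) I"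
  proof (rule has_sum_cong)
    fix i assume i: "i \<in> I"
    let ?r = "L2_inner M R (e i)" and ?h = "L2_inner M h (e i)"
    have "L2_inner M g (e i) = ?r + ?h"
      unfolding h_def
      using L2_inner_diff[OF continuous_L2[OF g(1)] continuous_L2[OF R(1)] e_L2[OF i]] by simp
    moreover have "(\<Sum>t\<in>T. b t * (?h * e i (x t))) = ?h * (\<Sum>t\<in>T. b t * e i (x t))"
      by (simp add: sum_distrib_left algebra_simps)
    then have "(\<Sum>t\<in>T. b t * (?h * e i (x t))) = q i * (?r * ?h)"
      using q_pos[OF i] by (simp add: R(3)[OF i])
    ultimately show "q i * ?r\<^sup>2 + 2 * (\<Sum>t\<in>T. b t * (?h * e i (x t))) + q i * ?h\<^sup>2
        = q i * (L2_inner M g (e i))\<^sup>2"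
      by (simp add: power2_eq_square algebra_simps)
  qed
  finally show "energy g
      = energy R + 2 * (\<Sum>t\<in>T. b t * (g (x t) - R (x t))) + energy (\<lambda>y. g y - R y)"
    unfolding energy_def[of g] h_def by (rule infsumI)
qed

lemma energy_nonneg: "0 \<le> energy f"
  unfolding energy_def using q_pos by (intro infsum_nonneg) (simp add: less_imp_le)

lemma energy_eq_0:
  assumes "continuous_on (space M) h" "finite_energy h" "energy h \<le> 0" "x \<in> space M"
  shows "h x = 0"
proof -
  have "q i * (L2_inner M h (e i))\<^sup>2 = 0" if "i \<in> I" for i
    using assms(2,3) q_pos that unfolding finite_energy_def energy_def
    by (intro nonneg_infsum_le_0D[where f="\<lambda>i. q i * (L2_inner M h (e i))\<^sup>2"])
      (auto simp: less_imp_le)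
  then have "L2_inner M h (e i) = 0" if "i \<in> I" for i
    using q_pos[OF that] that by fastforce
  then show ?thesis
    by (intro continuous_determined[OF assms(1) continuous_on_const _ assms(4)])
      (auto simp: L2_inner_def)
qed

text \<open>The quadratic form is the energy of the kernel combination with coefficients \<open>b\<close>: expand the energy
of the zero function around that combination.\<close>

lemma kernel_positive_semidefinite:
  fixes b :: "'t \<Rightarrow> real"
  assumes T: "finite T" "\<And>t. t \<in> T \<Longrightarrow> x t \<in> space M"
  shows "0 \<le> (\<Sum>t\<in>T. b t * (\<Sum>s\<in>T. b s * kernel (x s) (x t)))"
proof -
  let ?R = "\<lambda>y. \<Sum>t\<in>T. b t * kernel (x t) y"
  have "energy (\<lambda>y. 0) = energy ?R + 2 * (\<Sum>t\<in>T. b t * (0 - ?R (x t))) + energy (\<lambda>y. 0 - ?R y)"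
    by (rule energy_expansion(1)[OF T]) (auto simp: finite_energy_def L2_inner_def)
  also have "energy (\<lambda>y. 0 - ?R y) = energy ?R"
    unfolding energy_def L2_inner_def by simp
  finally have "(\<Sum>t\<in>T. b t * ?R (x t)) = energy ?R"
    by (simp add: energy_def L2_inner_def sum_negf)
  then show ?thesis using energy_nonneg[of ?R] by simp
qed

text \<open>Stationarity is the condition under which the terms of first order in \<open>g - R\<close> cancel, those from the
misfit against those from the energy. What remains is an identity, not merely an inequality, so it
yields minimality and uniqueness together.\<close>

theorem regularised_least_squares:
  fixes y P b :: "'t \<Rightarrow> real" and \<kappa> \<eta> :: real
  assumes T: "finite T" "\<And>t. t \<in> T \<Longrightarrow> x t \<in> space M"
    and P: "\<And>t. t \<in> T \<Longrightarrow> P t > 0"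
    and g: "continuous_on (space M) g" "finite_energy g"
  defines "R \<equiv> \<lambda>z. \<Sum>t\<in>T. b t * kernel (x t) z"
    and "J \<equiv> \<lambda>f. \<kappa> * (\<Sum>t\<in>T. (y t - f (x t))\<^sup>2 / P t) + \<eta> * energy f"
  assumes stationary: "\<And>t. t \<in> T \<Longrightarrow> \<eta> * b t = \<kappa> * ((y t - R (x t)) / P t)"
  shows "J g = J R + \<kappa> * (\<Sum>t\<in>T. (g (x t) - R (x t))\<^sup>2 / P t) + \<eta> * energy (\<lambda>z. g z - R z)"
proof -
  have "\<eta> * (\<Sum>t\<in>T. b t * (g (x t) - R (x t))) = (\<Sum>t\<in>T. (\<eta> * b t) * (g (x t) - R (x t)))"
    by (simp add: sum_distrib_left mult.assoc)
  also have "\<dots> = (\<Sum>t\<in>T. \<kappa> * ((y t - R (x t)) * (g (x t) - R (x t)) / P t))"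
    by (intro sum.cong refl) (simp add: stationary)
  also have "\<dots> = \<kappa> * (\<Sum>t\<in>T. (y t - R (x t)) * (g (x t) - R (x t)) / P t)"
    by (simp add: sum_distrib_left)
  finally have cross: "\<eta> * (\<Sum>t\<in>T. b t * (g (x t) - R (x t)))
      = \<kappa> * (\<Sum>t\<in>T. (y t - R (x t)) * (g (x t) - R (x t)) / P t)" .
  have "(\<Sum>t\<in>T. (y t - g (x t))\<^sup>2 / P t) = (\<Sum>t\<in>T. (y t - R (x t))\<^sup>2 / P t
      - 2 * ((y t - R (x t)) * (g (x t) - R (x t)) / P t) + (g (x t) - R (x t))\<^sup>2 / P t)"
    by (intro sum.cong refl)
      (simp add: power2_eq_square algebra_simps add_divide_distrib[symmetric] diff_divide_distrib[symmetric])
  also have "\<dots> = (\<Sum>t\<in>T. (y t - R (x t))\<^sup>2 / P t)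
      - 2 * (\<Sum>t\<in>T. (y t - R (x t)) * (g (x t) - R (x t)) / P t)
      + (\<Sum>t\<in>T. (g (x t) - R (x t))\<^sup>2 / P t)"
    by (simp only: sum.distrib sum_subtractf sum_distrib_left)
  finally have misfit: "(\<Sum>t\<in>T. (y t - g (x t))\<^sup>2 / P t) = \<dots>" .
  have "energy g = energy R + 2 * (\<Sum>t\<in>T. b t * (g (x t) - R (x t))) + energy (\<lambda>z. g z - R z)"
    unfolding R_def by (rule energy_expansion(1)[OF T g])
  then have "\<eta> * energy g = \<eta> * energy R + 2 * (\<eta> * (\<Sum>t\<in>T. b t * (g (x t) - R (x t))))
      + \<eta> * energy (\<lambda>z. g z - R z)"
    by (simp only: distrib_left mult.left_commute)
  then show ?thesis
    unfolding J_def misfit cross by (simp only: distrib_left right_diff_distrib mult.left_commute)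
qed

end

section \<open>Tensor products of orthonormal bases\<close>

context finite_measure
begin

lemma pair_finite: "finite_measure (M \<Otimes>\<^sub>M M)"
proof -
  interpret P: pair_sigma_finite M M ..
  show ?thesis
    by (rule finite_measureI)
      (auto simp: space_pair_measure emeasure_pair_measure_Times ennreal_mult_eq_top_iff)
qed

lemma AE_section_L2:
  assumes "g \<in> L2 (M \<Otimes>\<^sub>M M)"
  shows "AE u in M. (\<lambda>v. g (u, v)) \<in> L2 M"
proof -
  interpret P: pair_sigma_finite M M ..
  have [measurable]: "g \<in> borel_measurable (M \<Otimes>\<^sub>M M)" by (rule L2_D(1)[OF assms])
  have "AE u in M. integrable M (\<lambda>v. (g (u, v))\<^sup>2)"
    using P.AE_integrable_fst'[OF L2_D(2)[OF assms]] by simp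
  with AE_space show ?thesis
    by eventually_elim (auto simp: L2_def)
qed

end

lemma tensor_apply: "tensor f g (x, y) = f x * g y"
  by (simp add: tensor_def)

lemma tensor_product:
  fixes M :: "pt measure"
  assumes M: "finite_measure M" and f: "integrable M f" and g: "integrable M g"
  shows "integrable (M \<Otimes>\<^sub>M M) (tensor f g)"
    and "(\<integral>x. tensor f g x \<partial>(M \<Otimes>\<^sub>M M)) = (\<integral>x. f x \<partial>M) * (\<integral>x. g x \<partial>M)"
proof -
  interpret finite_measure M by fact
  interpret P: pair_sigma_finite M M ..
  have [measurable]: "f \<in> borel_measurable M" "g \<in> borel_measurable M" using f g by auto
  show I: "integrable (M \<Otimes>\<^sub>M M) (tensor f g)"
  proof (rule P.Fubini_integrable)
    show "tensor f g \<in> borel_measurable (M \<Otimes>\<^sub>M M)" unfolding tensor_def by measurable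
    show "integrable M (\<lambda>x. \<integral>y. norm (tensor f g (x, y)) \<partial>M)"
      using f by (simp add: tensor_apply abs_mult)
    show "AE x in M. integrable M (\<lambda>y. tensor f g (x, y))"
      using g by (simp add: tensor_apply)
  qed
  show "(\<integral>x. tensor f g x \<partial>(M \<Otimes>\<^sub>M M)) = (\<integral>x. f x \<partial>M) * (\<integral>x. g x \<partial>M)"
    using P.integral_fst'[OF I] by (simp add: tensor_apply)
qed

lemma tensor_mult: "tensor f g x * tensor f' g' x = tensor (\<lambda>x. f x * f' x) (\<lambda>x. g x * g' x) x"
  by (cases x) (simp add: tensor_apply algebra_simps)

lemma tensor_L2:
  assumes M: "finite_measure M" and f: "f \<in> L2 M" and g: "g \<in> L2 M"
  shows "tensor f g \<in> L2 (M \<Otimes>\<^sub>M M)"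
proof -
  interpret finite_measure M by fact
  have [measurable]: "f \<in> borel_measurable M" "g \<in> borel_measurable M"
    using f g by (auto dest: L2_D)
  have "(tensor f g x)\<^sup>2 = tensor (\<lambda>x. (f x)\<^sup>2) (\<lambda>x. (g x)\<^sup>2) x" for x
    by (simp add: power2_eq_square tensor_mult)
  then have "integrable (M \<Otimes>\<^sub>M M) (\<lambda>x. (tensor f g x)\<^sup>2)"
    using tensor_product(1)[OF M L2_D(2)[OF f] L2_D(2)[OF g]] by simp
  moreover have "tensor f g \<in> borel_measurable (M \<Otimes>\<^sub>M M)" unfolding tensor_def by measurable
  ultimately show ?thesis by (simp add: L2_def)
qed

lemma tensor_inner:
  assumes M: "finite_measure M" and "f \<in> L2 M" "g \<in> L2 M" "f' \<in> L2 M" "g' \<in> L2 M"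
  shows "L2_inner (M \<Otimes>\<^sub>M M) (tensor f g) (tensor f' g') = L2_inner M f f' * L2_inner M g g'"
  unfolding L2_inner_def tensor_mult
  using assms by (intro tensor_product(2) L2_mult_integrable)

text \<open>The product system, indexed by pairs so that the orthonormal basis locale applies to it.\<close>

definition tensor_family :: "('i \<Rightarrow> pt \<Rightarrow> real) \<Rightarrow> 'i \<times> 'i \<Rightarrow> pt \<times> pt \<Rightarrow> real" where
  "tensor_family e = (\<lambda>(i, j). tensor (e i) (e j))"

text \<open>Completeness: if all coefficients of \<open>g\<close> vanish, then for each \<open>j\<close> the function
\<open>u \<mapsto> \<langle>g(u, \<cdot>), e j\<rangle>\<close> is square-integrable with vanishing coefficients, hence zero almost everywhere.
As there are countably many \<open>j\<close>, almost every section \<open>g(u, \<cdot>)\<close> has vanishing coefficients.\<close>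

lemma orthonormal_basis_tensor:
  assumes basis: "orthonormal_basis M I e" and I: "countable I"
  shows "orthonormal_basis (M \<Otimes>\<^sub>M M) (I \<times> I) (tensor_family e)"
proof -
  interpret orthonormal_basis M I e by fact
  interpret P: pair_sigma_finite M M ..
  interpret PM: finite_measure "M \<Otimes>\<^sub>M M" by (rule pair_finite)
  have M: "finite_measure M" by (rule finite_measure_axioms)
  show ?thesis
  proof
    show "tensor_family e i \<in> L2 (M \<Otimes>\<^sub>M M)" if "i \<in> I \<times> I" for i
      using that by (auto simp: tensor_family_def intro!: tensor_L2 M e_L2)
    show "L2_inner (M \<Otimes>\<^sub>M M) (tensor_family e i) (tensor_family e j) = (if i = j then 1 else 0)"
      if "i \<in> I \<times> I" "j \<in> I \<times> I" for i j
      using that by (cases i; cases j) (simp add: tensor_family_def tensor_inner[OF M] e_L2 orthonormal)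
  next
    fix g assume g: "g \<in> L2 (M \<Otimes>\<^sub>M M)"
      and zero: "\<And>i. i \<in> I \<times> I \<Longrightarrow> L2_inner (M \<Otimes>\<^sub>M M) g (tensor_family e i) = 0"
    have [measurable]: "g \<in> borel_measurable (M \<Otimes>\<^sub>M M)" by (rule L2_D(1)[OF g])
    have sq_int: "integrable M (\<lambda>u. \<integral>v. (g (u, v))\<^sup>2 \<partial>M)"
      using P.integrable_fst'[OF L2_D(2)[OF g]] by simp
    note sec = AE_section_L2[OF g]
    define G where "G j u = L2_inner M (\<lambda>v. g (u, v)) (e j)" for j u
    have G0: "AE u in M. G j u = 0" if j: "j \<in> I" for j
    proof (rule complete)
      have [measurable]: "e j \<in> borel_measurable M" by (rule L2_D(1)[OF e_L2[OF j]])
      have [measurable]: "G j \<in> borel_measurable M"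
        unfolding G_def[abs_def] L2_inner_def by measurable
      have "integrable M (\<lambda>u. (G j u)\<^sup>2)"
      proof (rule Bochner_Integration.integrable_bound[OF sq_int])
        show "AE u in M. norm ((G j u)\<^sup>2) \<le> norm (\<integral>v. (g (u, v))\<^sup>2 \<partial>M)"
          using sec
        proof eventually_elim
          case (elim u)
          from L2_Cauchy_Schwarz[OF elim e_L2[OF j]] orthonormal[OF j j]
          have "(G j u)\<^sup>2 \<le> L2_inner M (\<lambda>v. g (u, v)) (\<lambda>v. g (u, v))"
            by (simp add: G_def)
          then show ?case by (simp add: L2_inner_def power2_eq_square)
        qed
      qed simp
      then show "G j \<in> L2 M" by (simp add: L2_def)
      fix i assume i: "i \<in> I"
      have [measurable]: "e i \<in> borel_measurable M" by (rule L2_D(1)[OF e_L2[OF i]])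
      have "integrable (M \<Otimes>\<^sub>M M) (\<lambda>x. g x * tensor (e i) (e j) x)"
        by (intro L2_mult_integrable g tensor_L2 M e_L2 i j)
      from P.integral_fst'[OF this]
      have "L2_inner (M \<Otimes>\<^sub>M M) g (tensor_family e (i, j))
          = (\<integral>u. (\<integral>v. g (u, v) * (e i u * e j v) \<partial>M) \<partial>M)"
        by (simp add: L2_inner_def tensor_family_def tensor_apply)
      also have "\<dots> = (\<integral>u. G j u * e i u \<partial>M)"
        by (intro Bochner_Integration.integral_cong refl)
          (simp add: G_def L2_inner_def mult.left_commute mult.commute[of _ "e i _"]
            flip: integral_mult_right_zero)
      finally show "L2_inner M (G j) (e i) = 0"
        using zero[of "(i, j)"] i j by (simp add: L2_inner_def)
    qed
    have "AE u in M. \<forall>j\<in>I. G j u = 0"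
      by (rule AE_ball_countable'[OF G0 I])
    with sec have "AE u in M. AE v in M. g (u, v) = 0"
      by eventually_elim (auto intro!: complete simp: G_def)
    then show "AE x in M \<Otimes>\<^sub>M M. g x = 0"
      by (intro P.AE_pair_measure) auto
  qed
qed

lemma continuous_on_compact_L2:
  fixes f :: "'a::t2_space \<Rightarrow> real"
  assumes M: "finite_measure M" and comp: "compact (space M)"
    and id: "(\<lambda>x. x) \<in> M \<rightarrow>\<^sub>M borel" and f: "continuous_on (space M) f"
  shows "f \<in> L2 M"
proof -
  interpret finite_measure M by fact
  have "(\<lambda>x. if x \<in> space M then f x else 0) \<in> borel_measurable borel"
    using compact_imp_closed[OF comp] f
    by (intro borel_measurable_continuous_on_if continuous_on_const borel_closed)
  from measurable_compose[OF id this] have meas: "f \<in> borel_measurable M"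
    by (rule measurable_cong[THEN iffD1, rotated]) simp
  have "bounded (f ` space M)"
    by (rule compact_imp_bounded[OF compact_continuous_image[OF f comp]])
  then obtain C where C: "\<And>x. x \<in> space M \<Longrightarrow> \<bar>f x\<bar> \<le> C"
    by (auto simp: bounded_iff)
  have "integrable M (\<lambda>x. (f x)\<^sup>2)"
  proof (rule integrable_const_bound[of _ "C\<^sup>2"])
    show "AE x in M. norm ((f x)\<^sup>2) \<le> C\<^sup>2"
      using C power_mono[of "\<bar>f _\<bar>" C 2] by (intro AE_I2) simp
  qed (use meas in simp)
  with meas show ?thesis by (simp add: L2_def)
qed

text \<open>The diagonal sums over a finite set of pairs are bounded by those over the product of its two
projections, which factorise. Full support passes to the product by applying it to one variable at a
time.\<close>

lemma mercer_system_tensor: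
  assumes mercer: "mercer_system M I e q B" and I: "countable I"
    and comp: "compact (space M)" and id: "(\<lambda>x. x) \<in> M \<rightarrow>\<^sub>M borel"
  shows "mercer_system (M \<Otimes>\<^sub>M M) (I \<times> I) (tensor_family e) (\<lambda>(i, j). q i * q j) (B * B)"
proof -
  interpret mercer_system M I e q B by fact
  interpret O: orthonormal_basis "M \<Otimes>\<^sub>M M" "I \<times> I" "tensor_family e"
    by (rule orthonormal_basis_tensor[OF orthonormal_basis_axioms I])
  interpret P: pair_sigma_finite M M ..
  have sp: "space (M \<Otimes>\<^sub>M M) = space M \<times> space M" by (rule space_pair_measure)
  have cont_L2: "f \<in> L2 (M \<Otimes>\<^sub>M M)" if "continuous_on (space (M \<Otimes>\<^sub>M M)) f" for f
  proof (rule continuous_on_compact_L2[OF _ _ _ that])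
    show "finite_measure (M \<Otimes>\<^sub>M M)" by (rule O.finite_measure_axioms)
    show "compact (space (M \<Otimes>\<^sub>M M))" unfolding sp by (intro compact_Times comp)
    have "(\<lambda>x. (fst x, snd x)) \<in> M \<Otimes>\<^sub>M M \<rightarrow>\<^sub>M borel \<Otimes>\<^sub>M borel"
      by (intro measurable_Pair measurable_compose[OF measurable_fst id]
          measurable_compose[OF measurable_snd id])
    then show "(\<lambda>x. x) \<in> M \<Otimes>\<^sub>M M \<rightarrow>\<^sub>M borel" by (simp add: borel_prod)
  qed
  show ?thesis
  proof
    show "0 < (case i of (i, j) \<Rightarrow> q i * q j)" if "i \<in> I \<times> I" for i
      using that q_pos by auto
    show "continuous_on (space (M \<Otimes>\<^sub>M M)) (tensor_family e i)" if I2: "i \<in> I \<times> I" for i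
    proof -
      obtain j k where i: "i = (j, k)" "j \<in> I" "k \<in> I" using I2 by (rule SigmaE)
      have "continuous_on (space M \<times> space M) (\<lambda>x. e j (fst x) * e k (snd x))"
        by (intro continuous_on_mult continuous_on_compose2[OF e_continuous[OF i(2)]]
            continuous_on_compose2[OF e_continuous[OF i(3)]] continuous_on_fst continuous_on_snd
            continuous_on_id) auto
      then show ?thesis by (simp add: i sp tensor_family_def tensor_def case_prod_beta')
    qed
    show "0 \<le> B * B" by simp
    show "f \<in> L2 (M \<Otimes>\<^sub>M M)" if "continuous_on (space (M \<Otimes>\<^sub>M M)) f" for f
      by (rule cont_L2[OF that])
  next
    fix x F assume x: "x \<in> space (M \<Otimes>\<^sub>M M)" and F: "finite F" "F \<subseteq> I \<times> I"
    obtain u v where uv: "x = (u, v)" "u \<in> space M" "v \<in> space M" using x unfolding sp by (rule SigmaE)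
    let ?g = "\<lambda>i. (tensor_family e i x)\<^sup>2 / (case i of (i, j) \<Rightarrow> q i * q j)"
    have pos: "0 \<le> ?g i" if "i \<in> I \<times> I" for i
      using that q_pos by (auto simp: less_imp_le)
    have F': "fst ` F \<subseteq> I" "snd ` F \<subseteq> I" using F(2) by auto
    have "(\<Sum>i\<in>F. ?g i) \<le> (\<Sum>i\<in>fst ` F \<times> snd ` F. ?g i)"
    proof (rule sum_mono2)
      show "0 \<le> ?g i" if "i \<in> fst ` F \<times> snd ` F - F" for i
        using that F' by (intro pos) auto
    qed (use F(1) in \<open>auto simp: rev_image_eqI\<close>)
    also have "\<dots> = (\<Sum>i\<in>fst ` F. (e i u)\<^sup>2 / q i) * (\<Sum>j\<in>snd ` F. (e j v)\<^sup>2 / q j)"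
      by (simp add: sum_product sum.cartesian_product tensor_family_def tensor_apply uv
          power_mult_distrib case_prod_beta')
    also have "\<dots> \<le> B * B"
      using F F' uv q_pos
      by (intro mult_mono kernel_bound B_nonneg sum_nonneg) (auto simp: less_imp_le subset_iff)
    finally show "(\<Sum>i\<in>F. ?g i) \<le> B * B" .
  next
    fix f :: "pt \<times> pt \<Rightarrow> real" and x assume f: "continuous_on (space (M \<Otimes>\<^sub>M M)) f" "AE x in M \<Otimes>\<^sub>M M. f x = 0"
      and x: "x \<in> space (M \<Otimes>\<^sub>M M)"
    obtain u v where uv: "x = (u, v)" "u \<in> space M" "v \<in> space M" using x unfolding sp by (rule SigmaE)
    have c1: "continuous_on (space M) (\<lambda>b. f (a, b))" if "a \<in> space M" for a
      using that by (intro continuous_on_compose2[OF f(1)] continuous_intros) (auto simp: sp)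
    have c2: "continuous_on (space M) (\<lambda>a. f (a, b))" if "b \<in> space M" for b
      using that by (intro continuous_on_compose2[OF f(1)] continuous_intros) (auto simp: sp)
    have "AE a in M. AE b in M. f (a, b) = 0" by (rule P.AE_pair[OF f(2)])
    with AE_space have "AE a in M. f (a, v) = 0"
    proof eventually_elim
      case (elim a)
      show ?case
        by (rule full_support[where f="\<lambda>b. f (a, b)", OF c1[OF elim(1)] elim(2) uv(3)])
    qed
    then have "f (u, v) = 0"
      by (rule full_support[where f="\<lambda>a. f (a, v)", OF c2[OF uv(3)] _ uv(2)])
    then show "f x = 0" by (simp add: uv(1))
  qed
qed

text \<open>Both sides are continuous in \<open>y\<close> and have the same Fourier coefficients.\<close>

lemma mercer_kernel_tensor:
  assumes mercer: "mercer_system M I e q B" and I: "countable I"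
    and comp: "compact (space M)" and id: "(\<lambda>x. x) \<in> M \<rightarrow>\<^sub>M borel"
    and x: "x \<in> space (M \<Otimes>\<^sub>M M)" and y: "y \<in> space (M \<Otimes>\<^sub>M M)"
  shows "mercer_system.kernel (I \<times> I) (tensor_family e) (\<lambda>(i, j). q i * q j) x y
    = tensor (mercer_system.kernel I e q (fst x)) (mercer_system.kernel I e q (snd x)) y"
proof -
  interpret A: mercer_system M I e q B by fact
  interpret T: mercer_system "M \<Otimes>\<^sub>M M" "I \<times> I" "tensor_family e" "\<lambda>(i, j). q i * q j" "B * B"
    by (rule mercer_system_tensor[OF mercer I comp id])
  have M: "finite_measure M" by (rule A.finite_measure_axioms)
  have sp: "space (M \<Otimes>\<^sub>M M) = space M \<times> space M" by (rule space_pair_measure)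
  have x': "fst x \<in> space M" "snd x \<in> space M" using x unfolding sp by (simp_all add: mem_Times_iff)
  show ?thesis
  proof (rule T.continuous_determined[OF T.kernel_section(1)[OF x] _ _ y])
    have "continuous_on (space M \<times> space M) (\<lambda>y. A.kernel (fst x) (fst y) * A.kernel (snd x) (snd y))"
      by (intro continuous_on_mult continuous_on_compose2[OF A.kernel_section(1)[OF x'(1)]]
          continuous_on_compose2[OF A.kernel_section(1)[OF x'(2)]] continuous_on_fst continuous_on_snd
          continuous_on_id) auto
    then show "continuous_on (space (M \<Otimes>\<^sub>M M)) (tensor (A.kernel (fst x)) (A.kernel (snd x)))"
      by (simp add: sp tensor_def case_prod_beta')
    fix i assume i: "i \<in> I \<times> I"
    obtain j k where jk: "i = (j, k)" "j \<in> I" "k \<in> I" using i by (rule SigmaE)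
    have "L2_inner (M \<Otimes>\<^sub>M M) (T.kernel x) (tensor_family e i) = e j (fst x) / q j * (e k (snd x) / q k)"
      using T.kernel_section(2)[OF x i] by (simp add: jk tensor_family_def tensor_def case_prod_beta')
    also have "\<dots> = L2_inner (M \<Otimes>\<^sub>M M) (tensor (A.kernel (fst x)) (A.kernel (snd x))) (tensor_family e i)"
      using jk x' unfolding jk(1) tensor_family_def
      by (simp add: tensor_inner[OF M] A.continuous_L2 A.kernel_section A.e_L2)
    finally show "L2_inner (M \<Otimes>\<^sub>M M) (T.kernel x) (tensor_family e i) = \<dots>" .
  qed
qed

section \<open>The surface measure of the sphere\<close>

definition cone_over :: "pt set \<Rightarrow> pt set" where
  "cone_over A = {x \<in> ball 0 1 - {0}. x /\<^sub>R norm x \<in> A}"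

lemma cone_over_measurable:
  assumes "A \<in> sets borel"
  shows "cone_over A \<in> sets borel"
proof -
  have "(\<lambda>x::pt. x /\<^sub>R norm x) \<in> borel_measurable borel" by measurable
  from measurable_sets[OF this assms] have "(\<lambda>x. x /\<^sub>R norm x) -` A \<in> sets borel" by simp
  moreover have "cone_over A = (ball 0 1 - {0}) \<inter> (\<lambda>x. x /\<^sub>R norm x) -` A"
    by (auto simp: cone_over_def)
  ultimately show ?thesis by simp
qed

lemma sets_sph: "sets sph = sets (restrict_space borel S2)"
  by (simp add: sph_def)

lemma sph_Int_measurable:
  assumes "A \<in> sets borel"
  shows "A \<inter> S2 \<in> sets sph"
  unfolding sets_sph sets_restrict_space using assms by (auto simp: Int_commute)

text \<open>Reduces statements about the surface measure to Lebesgue measure, where openness and orthogonal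
invariance can be used.\<close>

lemma emeasure_sph_Int:
  assumes A: "A \<in> sets borel"
  shows "emeasure sph (A \<inter> S2) = 3 * emeasure lborel (cone_over A)"
proof -
  let ?B = "ball (0::pt) 1 - {0}"
  have "(\<lambda>x::pt. x /\<^sub>R norm x) \<in> borel_measurable borel"
    by measurable
  then have m: "(\<lambda>x::pt. x /\<^sub>R norm x) \<in> restrict_space lborel ?B \<rightarrow>\<^sub>M restrict_space borel S2"
    by (intro measurable_restrict_space2 measurable_restrict_space1)
       (auto simp: space_restrict_space)
  have eq: "(\<lambda>x::pt. x /\<^sub>R norm x) -` (A \<inter> S2) \<inter> space (restrict_space lborel ?B) = cone_over A"
    by (auto simp: space_restrict_space cone_over_def)
  have "emeasure sph (A \<inter> S2) = 3 * emeasure (restrict_space lborel ?B) (cone_over A)"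
    using emeasure_distr[OF m sph_Int_measurable[OF A, unfolded sets_sph]]
    by (simp only: sph_def emeasure_scale_measure eq)
  also have "emeasure (restrict_space lborel ?B) (cone_over A) = emeasure lborel (cone_over A)"
    by (intro emeasure_restrict_space) (auto simp: cone_over_def)
  finally show ?thesis .
qed

lemma finite_measure_sph: "finite_measure sph"
  by (rule finite_measureI) (simp add: emeasure_sph_space)

lemma compact_space_sph: "compact (space sph)"
  by (simp add: compact_sphere)

lemma id_measurable_sph: "(\<lambda>x. x) \<in> sph \<rightarrow>\<^sub>M borel"
  unfolding measurable_cong_sets[OF sets_sph refl]
  by (rule measurable_restrict_space1) simp

text \<open>A nonempty relatively open part of the sphere spans a nonempty open cone, which is not negligible.\<close>

lemma sph_full_support:
  fixes f :: "pt \<Rightarrow> real"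
  assumes f: "continuous_on S2 f" and zero: "AE x in sph. f x = 0" and x: "x \<in> S2"
  shows "f x = 0"
proof (rule ccontr)
  assume "f x \<noteq> 0"
  have "openin (top_of_set S2) (S2 \<inter> f -` (- {0}))"
    by (rule continuous_openin_preimage_gen[OF f]) (simp add: open_Compl)
  then obtain U where U: "open U" "S2 \<inter> f -` (- {0}) = S2 \<inter> U"
    by (auto simp: openin_open)
  have "x \<in> U" using U(2) x \<open>f x \<noteq> 0\<close> by blast
  have "AE y in sph. y \<notin> U \<inter> S2"
    using zero by eventually_elim (use U(2) in blast)
  then have "emeasure sph (U \<inter> S2) = 0"
    using AE_iff_null_sets[OF sph_Int_measurable[of U]] U(1) by auto
  then have "emeasure lborel (cone_over U) = 0"
    using emeasure_sph_Int[of U] U(1) by simp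
  then have "cone_over U \<in> null_sets lborel"
    using cone_over_measurable[of U] U(1) by (auto simp: null_sets_def)
  then have "negligible (cone_over U)"
    by (simp add: negligible_iff_null_sets null_sets_completionI)
  moreover have "open (cone_over U)"
  proof -
    have "open ((ball 0 1 - {0}) \<inter> (\<lambda>x::pt. x /\<^sub>R norm x) -` U)"
      by (intro continuous_open_preimage continuous_intros U(1)) auto
    also have "(ball 0 1 - {0}) \<inter> (\<lambda>x::pt. x /\<^sub>R norm x) -` U = cone_over U"
      by (auto simp: cone_over_def)
    finally show ?thesis .
  qed
  moreover have "(1/2) *\<^sub>R x \<in> cone_over U"
    using x \<open>x \<in> U\<close> by (auto simp: cone_over_def)
  ultimately show False using open_not_negligible by blast
qed

lemma orthogonal_transformation_borel:
  fixes h :: "pt \<Rightarrow> pt"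
  assumes "orthogonal_transformation h"
  shows "h \<in> borel_measurable borel"
  by (intro borel_measurable_continuous_onI linear_continuous_on
      linear_conv_bounded_linear[THEN iffD1] orthogonal_transformation_linear assms)

lemma emeasure_lborel_orthogonal_vimage:
  assumes h: "orthogonal_transformation (h :: pt \<Rightarrow> pt)" and W: "W \<in> sets borel" "bounded W"
  shows "emeasure lborel (h -` W) = emeasure lborel W"
proof -
  have bij: "bij h" by (rule orthogonal_transformation_bij[OF h])
  have i: "orthogonal_transformation (inv_into UNIV h)" by (rule orthogonal_transformation_inv[OF h])
  note hm = orthogonal_transformation_borel[OF h]
  have hW: "h -` W = inv_into UNIV h ` W" using bij by (simp add: bij_vimage_eq_inv_image)
  have meas: "h -` W \<in> sets borel" using measurable_sets[OF hm W(1)] by simp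
  have lm: "W \<in> lmeasurable"
    using bounded_set_imp_lmeasurable[OF W(2)] W(1) by simp
  have lm': "h -` W \<in> lmeasurable"
    unfolding hW by (rule measurable_orthogonal_image[OF i lm])
  have "measure lebesgue (h -` W) = measure lebesgue W"
    unfolding hW by (rule measure_orthogonal_image[OF i lm])
  then have "emeasure lebesgue (h -` W) = emeasure lebesgue W"
    using lm lm' by (simp add: emeasure_eq_measure2 fmeasurableD2 emeasure_eq_ennreal_measure)
  then show ?thesis using W(1) meas by simp
qed

lemma sph_orthogonal_measurable:
  assumes h: "orthogonal_transformation h"
  shows "h \<in> sph \<rightarrow>\<^sub>M sph"
proof -
  note hm = orthogonal_transformation_borel[OF h]
  show ?thesis
    unfolding measurable_cong_sets[OF sets_sph sets_sph]
    by (intro measurable_restrict_space2 measurable_restrict_space1 hm)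
      (auto simp: space_restrict_space orthogonal_transformation_norm[OF h])
qed

lemma sph_orthogonal_invariant:
  assumes h: "orthogonal_transformation h"
  shows "distr sph sph h = sph"
proof (rule measure_eqI)
  fix A assume "A \<in> sets (distr sph sph h)"
  then have "A \<in> sets sph" by simp
  then obtain C where C: "C \<in> sets borel" "A = C \<inter> S2"
    unfolding sets_sph by (auto simp: sets_restrict_space)
  note hm = orthogonal_transformation_borel[OF h]
  have vC: "h -` C \<in> sets borel" using measurable_sets[OF hm C(1)] by simp
  have "bounded (cone_over C)"
    by (rule bounded_subset[OF bounded_ball[of 0 1]]) (auto simp: cone_over_def)
  note W = cone_over_measurable[OF C(1)] this
  have hn: "norm (h x) = norm x" for x by (rule orthogonal_transformation_norm[OF h])
  have h0: "h x = 0 \<longleftrightarrow> x = 0" for x using hn[of x] by (metis norm_eq_zero)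
  have "emeasure (distr sph sph h) A = emeasure sph (h -` A \<inter> space sph)"
    using sph_Int_measurable[OF C(1)] by (intro emeasure_distr sph_orthogonal_measurable[OF h]) (simp add: C(2))
  also have "h -` A \<inter> space sph = h -` C \<inter> S2"
    by (auto simp: C(2) orthogonal_transformation_norm[OF h])
  also have "emeasure sph \<dots> = 3 * emeasure lborel (cone_over (h -` C))"
    by (rule emeasure_sph_Int[OF vC])
  also have "cone_over (h -` C) = h -` cone_over C"
    by (auto simp: cone_over_def orthogonal_transformation_scaleR[OF h] hn h0)
  also have "emeasure lborel \<dots> = emeasure lborel (cone_over C)"
    by (rule emeasure_lborel_orthogonal_vimage[OF h W])
  also have "3 * \<dots> = emeasure sph A"
    using emeasure_sph_Int[OF C(1)] C(2) by simp
  finally show "emeasure (distr sph sph h) A = emeasure sph A" .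
qed simp

lemma L2_inner_sph_orthogonal:
  assumes h: "orthogonal_transformation h" and f: "f \<in> borel_measurable sph" "g \<in> borel_measurable sph"
  shows "L2_inner sph (\<lambda>x. f (h x)) (\<lambda>x. g (h x)) = L2_inner sph f g"
proof -
  have "(\<integral>x. f x * g x \<partial>distr sph sph h) = (\<integral>x. f (h x) * g (h x) \<partial>sph)"
    using f by (intro integral_distr sph_orthogonal_measurable[OF h]) simp
  then show ?thesis by (simp add: L2_inner_def sph_orthogonal_invariant[OF h])
qed

lemma orthogonal_transformation_reflection:
  fixes d :: pt
  shows "orthogonal_transformation (\<lambda>x. x - (2 * inner x d / inner d d) *\<^sub>R d)"
proof (cases "d = 0")
  case True
  then show ?thesis by simp
next
  case False
  define c where "c = 2 / inner d d"
  have c: "c * inner d d = 2" using False by (simp add: c_def)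
  have eq: "(\<lambda>x. x - (2 * inner x d / inner d d) *\<^sub>R d) = (\<lambda>x. x - (c * inner x d) *\<^sub>R d)"
    by (simp add: c_def)
  show ?thesis
    unfolding eq orthogonal_transformation_def
  proof (intro conjI allI)
    show "linear (\<lambda>x. x - (c * inner x d) *\<^sub>R d)"
      by (rule linearI) (simp_all add: inner_add_left distrib_left scaleR_add_left
          scaleR_right_diff_distrib mult.left_commute)
    fix v w
    have "inner (v - (c * inner v d) *\<^sub>R d) (w - (c * inner w d) *\<^sub>R d)
        = inner v w - 2 * c * inner v d * inner w d + c * inner v d * inner w d * (c * inner d d)"
      by (simp add: inner_diff_left inner_diff_right inner_commute[of d w] algebra_simps)
    then show "inner (v - (c * inner v d) *\<^sub>R d) (w - (c * inner w d) *\<^sub>R d) = inner v w"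
      by (simp add: c)
  qed
qed

text \<open>After moving \<open>u\<close> to \<open>u'\<close>, reflect in the hyperplane orthogonal to \<open>d\<close>, the difference of the image
of \<open>v\<close> and \<open>v'\<close>. The reflection exchanges these two unit vectors, and it fixes \<open>u'\<close> because both
have the same inner product with \<open>u'\<close>.\<close>

lemma orthogonal_transformation_pair:
  assumes S: "u \<in> S2" "v \<in> S2" "u' \<in> S2" "v' \<in> S2" and eq: "inner u v = inner u' v'"
  obtains h where "orthogonal_transformation h" "h u = u'" "h v = v'"
proof -
  obtain g where g: "orthogonal_transformation g" "g u = u'"
    using orthogonal_transformation_exists_1[of u u'] S by auto
  define d where "d = g v - v'"
  define k where "k x = x - (2 * inner x d / inner d d) *\<^sub>R d" for x
  have k: "orthogonal_transformation k"
    unfolding k_def[abs_def] by (rule orthogonal_transformation_reflection)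
  have gv: "inner (g v) (g v) = 1" "inner v' v' = 1"
    using S orthogonal_transformation_norm[OF g(1), of v] by (simp_all add: dot_square_norm)
  have "inner u' (g v) = inner u v"
    using g by (metis orthogonal_transformation_def)
  then have "inner u' d = 0" by (simp add: d_def inner_diff_right eq)
  then have "k u' = u'" by (simp add: k_def)
  moreover have "k (g v) = v'"
  proof (cases "d = 0")
    case False
    have "2 * inner (g v) d = inner d d"
      using gv by (simp add: d_def inner_diff_left inner_diff_right inner_commute[of v' "g v"])
    then have "k (g v) = g v - d" using False by (simp add: k_def)
    then show ?thesis by (simp add: d_def)
  qed (simp add: k_def d_def)
  ultimately show ?thesis
    using orthogonal_transformation_compose[OF k g(1)] g(2) by (intro that[of "k \<circ> g"]) auto
qed

section \<open>Harmonic polynomials\<close>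

text \<open>Gaussian elimination, one equation at a time: an unknown with nonzero coefficient is solved for and
substituted into the remaining equations.\<close>

lemma underdetermined_linear_system:
  fixes a :: "'e \<Rightarrow> 'u \<Rightarrow> real"
  assumes "finite E" "finite U" "card E < card U"
  shows "\<exists>\<xi>. (\<exists>u\<in>U. \<xi> u \<noteq> 0) \<and> (\<forall>e\<in>E. (\<Sum>u\<in>U. a e u * \<xi> u) = 0)"
  using assms
proof (induction E arbitrary: U a rule: finite_induct)
  case empty
  then have "U \<noteq> {}" by auto
  then show ?case by (intro exI[of _ "\<lambda>_. 1"]) auto
next
  case (insert e E)
  show ?case
  proof (cases "\<forall>u\<in>U. a e u = 0")
    case True
    have "card E < card U" using insert.hyps insert.prems by simp
    from insert.IH[OF insert.prems(1) this, of a] obtain \<xi>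
      where \<xi>: "\<exists>u\<in>U. \<xi> u \<noteq> 0" "\<forall>e\<in>E. (\<Sum>u\<in>U. a e u * \<xi> u) = 0" by blast
    have "(\<Sum>u\<in>U. a e u * \<xi> u) = 0" using True by (intro sum.neutral) simp
    with \<xi> show ?thesis by (intro exI[of _ \<xi>]) simp
  next
    case False
    then obtain u0 where u0: "u0 \<in> U" "a e u0 \<noteq> 0" by blast
    define V where "V = U - {u0}"
    have V: "finite V" "card E < card V" "u0 \<notin> V" "U = insert u0 V"
      using insert.hyps insert.prems u0 by (auto simp: V_def)
    define a' where "a' f u = a f u - a f u0 * a e u / a e u0" for f u
    obtain \<xi> where \<xi>: "\<exists>u\<in>V. \<xi> u \<noteq> 0" "\<And>f. f \<in> E \<Longrightarrow> (\<Sum>u\<in>V. a' f u * \<xi> u) = 0"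
      using insert.IH[OF V(1,2), of a'] by blast
    define s where "s = (\<Sum>u\<in>V. a e u * \<xi> u)"
    define \<zeta> where "\<zeta> = (\<lambda>u. if u = u0 then - s / a e u0 else \<xi> u)"
    have sumV: "(\<Sum>u\<in>V. b u * \<zeta> u) = (\<Sum>u\<in>V. b u * \<xi> u)" for b :: "'u \<Rightarrow> real"
      using V(3) by (intro sum.cong refl) (auto simp: \<zeta>_def)
    have sumU: "(\<Sum>u\<in>U. b u * \<zeta> u) = b u0 * (- s / a e u0) + (\<Sum>u\<in>V. b u * \<xi> u)"
      for b :: "'u \<Rightarrow> real"
      using V(1,3) sumV[of b] by (simp add: V(4) \<zeta>_def)
    have "(\<Sum>u\<in>U. a f u * \<zeta> u) = 0" if f: "f \<in> insert e E" for f
    proof (cases "f = e")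
      case True
      then show ?thesis using u0(2) sumU[of "a e"] by (simp add: s_def)
    next
      case False
      then have "0 = (\<Sum>u\<in>V. a' f u * \<xi> u)" using f \<xi>(2) by auto
      also have "\<dots> = (\<Sum>u\<in>V. a f u * \<xi> u - a f u0 / a e u0 * (a e u * \<xi> u))"
        by (intro sum.cong refl) (simp add: a'_def left_diff_distrib)
      also have "\<dots> = (\<Sum>u\<in>V. a f u * \<xi> u) - a f u0 / a e u0 * s"
        by (simp add: sum_subtractf s_def sum_distrib_left)
      finally show ?thesis using sumU[of "a f"] by simp
    qed
    moreover have "\<exists>u\<in>U. \<zeta> u \<noteq> 0" using \<xi>(1) V(3,4) by (auto simp: \<zeta>_def)
    ultimately show ?thesis by blast
  qed
qed

definition monomial3 :: "nat \<Rightarrow> nat \<Rightarrow> nat \<Rightarrow> pt \<Rightarrow> real" where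
  "monomial3 a b c x = vec_nth x 1 ^ a * vec_nth x 2 ^ b * vec_nth x 3 ^ c"

lemma monomial3_mult: "monomial3 a b c x * monomial3 a' b' c' x = monomial3 (a + a') (b + b') (c + c') x"
  by (simp add: monomial3_def power_add)

lemma monomial3_scaleR: "monomial3 a b c (s *\<^sub>R x) = s ^ (a + b + c) * monomial3 a b c x"
  by (simp add: monomial3_def power_add power_mult_distrib)

text \<open>Polynomials in three variables as lists of terms, each a coefficient with three exponents. Repeated
exponents are allowed, which makes sums and products plain list operations.\<close>

fun eval_terms :: "(real \<times> nat \<times> nat \<times> nat) list \<Rightarrow> pt \<Rightarrow> real" where
  "eval_terms [] x = 0"
| "eval_terms ((\<alpha>, a, b, c) # ts) x = \<alpha> * monomial3 a b c x + eval_terms ts x"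

fun scale_terms :: "real \<times> nat \<times> nat \<times> nat \<Rightarrow> (real \<times> nat \<times> nat \<times> nat) list \<Rightarrow> (real \<times> nat \<times> nat \<times> nat) list" where
  "scale_terms (\<alpha>, a, b, c) [] = []"
| "scale_terms (\<alpha>, a, b, c) ((\<alpha>', a', b', c') # ts)
    = (\<alpha> * \<alpha>', a + a', b + b', c + c') # scale_terms (\<alpha>, a, b, c) ts"

lemma eval_terms_append: "eval_terms (ts @ ts') x = eval_terms ts x + eval_terms ts' x"
  by (induction ts x rule: eval_terms.induct) simp_all

lemma eval_scale_terms:
  "eval_terms (scale_terms (\<alpha>, a, b, c) ts) x = \<alpha> * monomial3 a b c x * eval_terms ts x"
proof (induction ts)
  case (Cons t ts)
  obtain \<alpha>' a' b' c' where t: "t = (\<alpha>', a', b', c')" by (cases t) auto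
  have "monomial3 (a + a') (b + b') (c + c') x = monomial3 a b c x * monomial3 a' b' c' x"
    by (simp add: monomial3_mult)
  then show ?case using Cons by (simp add: t algebra_simps)
qed simp

lemma eval_terms_product:
  "eval_terms (concat (map (\<lambda>t. scale_terms t ts') ts)) x = eval_terms ts x * eval_terms ts' x"
proof (induction ts)
  case (Cons t ts)
  obtain \<alpha> a b c where "t = (\<alpha>, a, b, c)" by (cases t) auto
  with Cons show ?case by (simp add: eval_terms_append eval_scale_terms algebra_simps)
qed simp

lemma polynomial_function_terms:
  fixes P :: "pt \<Rightarrow> real"
  assumes "real_polynomial_function P"
  shows "\<exists>ts. \<forall>x. P x = eval_terms ts x"
  using assms
proof (induction P rule: real_polynomial_function.induct)
  case (linear f)
  interpret bounded_linear f by fact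
  have "f x = eval_terms [(f (axis 1 1), 1, 0, 0), (f (axis 2 1), 0, 1, 0), (f (axis 3 1), 0, 0, 1)] x"
    for x :: pt
  proof -
    have "x = vec_nth x 1 *\<^sub>R axis 1 1 + vec_nth x 2 *\<^sub>R axis 2 1 + vec_nth x 3 *\<^sub>R axis 3 1"
      by (simp add: Finite_Cartesian_Product.vec_eq_iff forall_3 axis_def)
    then have "f x = f (vec_nth x 1 *\<^sub>R axis 1 1 + vec_nth x 2 *\<^sub>R axis 2 1 + vec_nth x 3 *\<^sub>R axis 3 1)"
      by simp
    also have "\<dots> = vec_nth x 1 * f (axis 1 1) + vec_nth x 2 * f (axis 2 1) + vec_nth x 3 * f (axis 3 1)"
      by (simp only: add scaleR real_scaleR_def)
    finally show ?thesis by (simp add: monomial3_def)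
  qed
  then show ?case by blast
next
  case (const c)
  have "c = eval_terms [(c, 0, 0, 0)] x" for x by (simp add: monomial3_def)
  then show ?case by blast
next
  case (add f g)
  then obtain ts ts' where "\<forall>x. f x = eval_terms ts x" "\<forall>x. g x = eval_terms ts' x" by blast
  then show ?case by (intro exI[of _ "ts @ ts'"]) (simp add: eval_terms_append)
next
  case (mult f g)
  then obtain ts ts' where "\<forall>x. f x = eval_terms ts x" "\<forall>x. g x = eval_terms ts' x" by blast
  then show ?case
    by (intro exI[of _ "concat (map (\<lambda>t. scale_terms t ts') ts)"]) (simp add: eval_terms_product)
qed

fun term_degree :: "real \<times> nat \<times> nat \<times> nat \<Rightarrow> nat" where
  "term_degree (\<alpha>, a, b, c) = a + b + c"

text \<open>Groups the terms by total degree, as coefficients of a polynomial in the scaling factor \<open>s\<close>.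
Comparing these coefficients with \<open>s\<^sup>l P(x)\<close> isolates the terms of degree \<open>l\<close>.\<close>

lemma eval_terms_by_degree:
  assumes "\<forall>t\<in>set ts. term_degree t \<le> N"
  shows "eval_terms ts (s *\<^sub>R x)
    = (\<Sum>k\<le>N. eval_terms (filter (\<lambda>t. term_degree t = k) ts) x * s ^ k)"
  using assms
proof (induction ts)
  case (Cons t ts)
  obtain \<alpha> a b c where t: "t = (\<alpha>, a, b, c)" by (cases t) auto
  have split: "eval_terms (filter (\<lambda>t. term_degree t = k) (t # ts)) x * s ^ k
      = (if a + b + c = k then \<alpha> * monomial3 a b c x * s ^ k else 0)
        + eval_terms (filter (\<lambda>t. term_degree t = k) ts) x * s ^ k" for k
    by (simp add: t algebra_simps)
  show ?case
    unfolding split sum.distrib using Cons by (simp add: t monomial3_scaleR)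
qed simp

text \<open>The exponent of the first variable is determined by the degree and the two others. The difference is
truncated at zero, so the coefficients with \<open>l < b + c\<close> have to vanish for this to be homogeneous.\<close>

definition homogeneous_eval :: "nat \<Rightarrow> (nat \<Rightarrow> nat \<Rightarrow> real) \<Rightarrow> pt \<Rightarrow> real" where
  "homogeneous_eval l A x = (\<Sum>b\<le>l. \<Sum>c\<le>l. A b c * monomial3 (l - b - c) b c x)"

lemma homogeneous_terms:
  assumes "\<forall>t\<in>set ts. term_degree t = l"
  shows "\<exists>A. (\<forall>b c. l < b + c \<longrightarrow> A b c = 0) \<and> (\<forall>x. eval_terms ts x = homogeneous_eval l A x)"
  using assms
proof (induction ts)
  case Nil
  then show ?case by (intro exI[of _ "\<lambda>_ _. 0"]) (simp add: homogeneous_eval_def)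
next
  case (Cons t ts)
  then obtain A where A: "\<forall>b c. l < b + c \<longrightarrow> A b c = 0"
    "\<forall>x. eval_terms ts x = homogeneous_eval l A x" by auto
  obtain \<alpha> a b c where t: "t = (\<alpha>, a, b, c)" by (cases t) auto
  have l: "a + b + c = l" using Cons.prems by (simp add: t)
  define D where "D b' c' = (if b' = b then if c' = c then \<alpha> else 0 else 0)" for b' c'
  have D: "(\<Sum>b'\<le>l. \<Sum>c'\<le>l. D b' c' * monomial3 (l - b' - c') b' c' x) = \<alpha> * monomial3 a b c x" for x
  proof -
    have "(\<Sum>c'\<le>l. D b' c' * monomial3 (l - b' - c') b' c' x)
        = (if b' = b then \<alpha> * monomial3 (l - b - c) b c x else 0)" for b'
    proof (cases "b' = b")
      case True
      have "(\<Sum>c'\<le>l. D b' c' * monomial3 (l - b' - c') b' c' x)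
          = (\<Sum>c'\<le>l. if c' = c then \<alpha> * monomial3 (l - b - c) b c x else 0)"
        by (intro sum.cong refl) (simp add: D_def True)
      then show ?thesis using l True by simp
    qed (simp add: D_def)
    then show ?thesis using l by auto
  qed
  show ?case
  proof (intro exI[of _ "\<lambda>b c. A b c + D b c"] conjI allI impI)
    show "A b' c' + D b' c' = 0" if "l < b' + c'" for b' c'
      using that A(1) l by (auto simp: D_def)
    show "eval_terms (t # ts) x = homogeneous_eval l (\<lambda>b c. A b c + D b c) x" for x
      using A(2) D[of x] by (simp add: t homogeneous_eval_def distrib_right sum.distrib)
  qed
qed

lemma homogeneous_polynomial:
  fixes P :: "pt \<Rightarrow> real"
  assumes "real_polynomial_function P" and hom: "\<And>c x. P (c *\<^sub>R x) = c ^ l * P x"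
  obtains A where "\<And>b c. l < b + c \<Longrightarrow> A b c = 0" "\<And>x. P x = homogeneous_eval l A x"
proof -
  obtain ts where ts: "\<And>x. P x = eval_terms ts x"
    using polynomial_function_terms[OF assms(1)] by blast
  define N where "N = Max (insert l (term_degree ` set ts))"
  have N: "\<forall>t\<in>set ts. term_degree t \<le> N" "l \<le> N" by (auto simp: N_def)
  have "P x = eval_terms (filter (\<lambda>t. term_degree t = l) ts) x" for x
  proof -
    let ?c = "\<lambda>k. eval_terms (filter (\<lambda>t. term_degree t = k) ts) x"
    have "(\<Sum>k\<le>N. ?c k * s ^ k) = (\<Sum>k\<le>N. (if k = l then P x else 0) * s ^ k)" for s
    proof -
      have "(\<Sum>k\<le>N. ?c k * s ^ k) = s ^ l * P x"
        using eval_terms_by_degree[OF N(1), of s x] hom[of s x] ts[of "s *\<^sub>R x"] by simp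
      also have "\<dots> = (\<Sum>k\<le>N. if k = l then P x * s ^ k else 0)"
        using N(2) by simp
      also have "\<dots> = (\<Sum>k\<le>N. (if k = l then P x else 0) * s ^ k)"
        by (intro sum.cong) auto
      finally show ?thesis .
    qed
    then have "\<forall>k\<le>N. ?c k = (if k = l then P x else 0)"
      by (subst polyfun_eq_coeffs[symmetric]) blast
    then show ?thesis using N(2) by auto
  qed
  moreover obtain A where "\<forall>b c. l < b + c \<longrightarrow> A b c = 0"
    "\<forall>x. eval_terms (filter (\<lambda>t. term_degree t = l) ts) x = homogeneous_eval l A x"
    using homogeneous_terms[of "filter (\<lambda>t. term_degree t = l) ts" l] by auto
  ultimately show ?thesis by (intro that[of A]) simp_all
qed

lemma second_derivative_sum_powers:
  fixes k :: "'i \<Rightarrow> real" and s :: real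
  shows "(deriv ^^ 2) (\<lambda>t. \<Sum>i\<in>S. k i * (s + t) ^ n i) 0
    = (\<Sum>i\<in>S. k i * (real (n i) * real (n i - 1) * s ^ (n i - 2)))"
proof -
  have d: "((\<lambda>t. \<Sum>i\<in>S. k i * (s + t) ^ n i) has_field_derivative
      (\<Sum>i\<in>S. k i * (real (n i) * (s + t) ^ (n i - 1)))) (at t)" for k :: "'i \<Rightarrow> real" and n t
    by (auto intro!: derivative_eq_intros sum.cong)
  have d1: "deriv (\<lambda>t. \<Sum>i\<in>S. k i * (s + t) ^ n i)
      = (\<lambda>t. \<Sum>i\<in>S. (k i * real (n i)) * (s + t) ^ (n i - 1))"
    by (rule ext, rule DERIV_imp_deriv[OF DERIV_cong[OF d]]) (simp add: mult.assoc)
  have "deriv (\<lambda>t. \<Sum>i\<in>S. (k i * real (n i)) * (s + t) ^ (n i - 1)) 0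
      = (\<Sum>i\<in>S. k i * real (n i) * (real (n i - 1) * s ^ (n i - 1 - 1)))"
    by (rule DERIV_imp_deriv[OF DERIV_cong[OF d]]) simp
  then show ?thesis
    by (simp add: numeral_2_eq_2 d1[simplified] mult.assoc)
qed

lemma sum_Basis_axis: "(\<Sum>b\<in>(Basis :: pt set). F b) = F (axis 1 1) + F (axis 2 1) + F (axis 3 1)"
proof -
  have "(Basis :: pt set) = range (\<lambda>i. axis i 1)"
    by (auto simp: Basis_vec_def)
  then have "(\<Sum>b\<in>(Basis :: pt set). F b) = (\<Sum>b\<in>range (\<lambda>i::3. axis i 1). F b)"
    by (rule arg_cong)
  also have "\<dots> = (\<Sum>i\<in>UNIV. F (axis i 1))"
    by (subst sum.reindex) (auto simp: inj_on_def axis_eq_axis)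
  finally have "(\<Sum>b\<in>(Basis :: pt set). F b) = (\<Sum>i\<in>UNIV. F (axis i 1))" .
  then show ?thesis by (simp add: sum_3)
qed

text \<open>Points with first coordinate 1 suffice, since the value of the Laplacian there already determines
all its coefficients; this leaves polynomials in two variables.\<close>

lemma laplacian_homogeneous_eval:
  fixes y z :: real and l :: nat
  defines "n \<equiv> \<lambda>b c. l - b - c"
  shows "laplacian (homogeneous_eval l A) (vector [1, y, z])
    = (\<Sum>b\<le>l. \<Sum>c\<le>l. A b c * (real (n b c) * real (n b c - 1)) * (y ^ b * z ^ c))
    + (\<Sum>b\<le>l. \<Sum>c\<le>l. A b c * (real b * real (b - 1)) * (y ^ (b - 2) * z ^ c))
    + (\<Sum>b\<le>l. \<Sum>c\<le>l. A b c * (real c * real (c - 1)) * (y ^ b * z ^ (c - 2)))"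
proof -
  let ?x = "vector [1, y, z] :: pt"
  let ?S = "{..l} \<times> {..l}"
  have ax: "vec_nth (axis (1::3) (1::real)) 1 = 1" "vec_nth (axis (1::3) (1::real)) 2 = 0"
    "vec_nth (axis (1::3) (1::real)) 3 = 0" "vec_nth (axis (2::3) (1::real)) 1 = 0"
    "vec_nth (axis (2::3) (1::real)) 2 = 1" "vec_nth (axis (2::3) (1::real)) 3 = 0"
    "vec_nth (axis (3::3) (1::real)) 1 = 0" "vec_nth (axis (3::3) (1::real)) 2 = 0"
    "vec_nth (axis (3::3) (1::real)) 3 = 1"
    by (simp_all add: axis_def)
  have 1: "(\<lambda>t. homogeneous_eval l A (?x + t *\<^sub>R axis 1 1))
      = (\<lambda>t. \<Sum>(b, c)\<in>?S. (A b c * y ^ b * z ^ c) * (1 + t) ^ n b c)"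
    by (rule ext)
      (simp add: homogeneous_eval_def sum.cartesian_product monomial3_def vector_3 ax n_def
        mult.assoc mult.left_commute mult.commute)
  have 2: "(\<lambda>t. homogeneous_eval l A (?x + t *\<^sub>R axis 2 1))
      = (\<lambda>t. \<Sum>(b, c)\<in>?S. (A b c * z ^ c) * (y + t) ^ b)"
    by (rule ext)
      (simp add: homogeneous_eval_def sum.cartesian_product monomial3_def vector_3 ax
        mult.assoc mult.left_commute mult.commute)
  have 3: "(\<lambda>t. homogeneous_eval l A (?x + t *\<^sub>R axis 3 1))
      = (\<lambda>t. \<Sum>(b, c)\<in>?S. (A b c * y ^ b) * (z + t) ^ c)"
    by (rule ext)
      (simp add: homogeneous_eval_def sum.cartesian_product monomial3_def vector_3 ax
        mult.assoc mult.left_commute mult.commute)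
  have "laplacian (homogeneous_eval l A) ?x
      = (\<Sum>(b, c)\<in>?S. (A b c * y ^ b * z ^ c) * (real (n b c) * real (n b c - 1) * 1 ^ (n b c - 2)))
      + (\<Sum>(b, c)\<in>?S. (A b c * z ^ c) * (real b * real (b - 1) * y ^ (b - 2)))
      + (\<Sum>(b, c)\<in>?S. (A b c * y ^ b) * (real c * real (c - 1) * z ^ (c - 2)))"
    unfolding laplacian_def sum_Basis_axis 1 2 3 case_prod_beta' second_derivative_sum_powers ..
  also have "\<dots> = (\<Sum>(b, c)\<in>?S. A b c * (real (n b c) * real (n b c - 1)) * (y ^ b * z ^ c))
      + (\<Sum>(b, c)\<in>?S. A b c * (real b * real (b - 1)) * (y ^ (b - 2) * z ^ c))
      + (\<Sum>(b, c)\<in>?S. A b c * (real c * real (c - 1)) * (y ^ b * z ^ (c - 2)))"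
    by (simp add: mult.assoc mult.left_commute mult.commute)
  finally show ?thesis by (simp add: sum.cartesian_product)
qed

lemma shift_second_derivative:
  fixes g :: "nat \<Rightarrow> real"
  assumes "g (l + 1) = 0" "g (l + 2) = 0"
  shows "(\<Sum>b\<le>l. g b * (real b * real (b - 1)) * y ^ (b - 2))
    = (\<Sum>b\<le>l. g (b + 2) * (real (b + 2) * real (b + 1)) * y ^ b)"
proof -
  let ?f = "\<lambda>b. g b * (real b * real (b - 1)) * y ^ (b - 2)"
  have "(\<Sum>b\<le>l. ?f b) = (\<Sum>b\<le>Suc (Suc l). ?f b)"
    using assms by simp
  also have "\<dots> = (\<Sum>b\<le>l. ?f (Suc (Suc b)))"
    by (simp only: sum.atMost_Suc_shift) simp
  finally show ?thesis by simp
qed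

lemma polynomial2_zero:
  fixes C :: "nat \<Rightarrow> nat \<Rightarrow> real"
  assumes "\<And>y z. (\<Sum>b\<le>l. \<Sum>c\<le>l. C b c * (y ^ b * z ^ c)) = 0" and bc: "b \<le> l" "c \<le> l"
  shows "C b c = 0"
proof -
  have "(\<Sum>b\<le>l. (\<Sum>c\<le>l. C b c * z ^ c) * y ^ b) = 0" for y z
    using assms(1)[of y z]
    by (simp add: sum_distrib_left sum_distrib_right mult.assoc mult.commute mult.left_commute)
  then have "\<forall>y. (\<Sum>b\<le>l. (\<Sum>c\<le>l. C b c * z ^ c) * y ^ b) = 0" for z by blast
  then have "(\<Sum>c\<le>l. C b c * z ^ c) = 0" for z
    using polyfun_eq_0[of "\<lambda>b. \<Sum>c\<le>l. C b c * z ^ c" l] bc(1) by blast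
  then show ?thesis using polyfun_eq_0[of "C b" l] bc(2) by blast
qed

text \<open>The three summands are the coefficients of \<open>y\<^sup>b z\<^sup>c\<close> in the three second derivatives, at points with
first coordinate 1.\<close>

definition harmonic_coefficients :: "nat \<Rightarrow> (nat \<Rightarrow> nat \<Rightarrow> real) \<Rightarrow> bool" where
  "harmonic_coefficients l A \<longleftrightarrow> (\<forall>b c. l < b + c \<longrightarrow> A b c = 0) \<and>
    (\<forall>b c. A b c * (real (l - b - c) * real (l - b - c - 1))
      + A (b + 2) c * (real (b + 2) * real (b + 1)) + A b (c + 2) * (real (c + 2) * real (c + 1)) = 0)"

lemma harmonic_coefficientsI:
  assumes supp: "\<And>b c. l < b + c \<Longrightarrow> A b c = 0"
    and lap: "\<And>x. laplacian (homogeneous_eval l A) x = 0"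
  shows "harmonic_coefficients l A"
  unfolding harmonic_coefficients_def
proof (intro conjI allI impI)
  fix b c
  let ?C = "\<lambda>b c. A b c * (real (l - b - c) * real (l - b - c - 1))
      + A (b + 2) c * (real (b + 2) * real (b + 1)) + A b (c + 2) * (real (c + 2) * real (c + 1))"
  show "?C b c = 0"
  proof (cases "b \<le> l \<and> c \<le> l")
    case False
    then have "l < b + c" by auto
    then show ?thesis by (simp add: supp)
  next
    case True
    show ?thesis
    proof (rule polynomial2_zero[where l=l and C="?C"])
      fix y z :: real
      let ?X = "\<Sum>b\<le>l. \<Sum>c\<le>l. A b c * (real (l - b - c) * real (l - b - c - 1)) * (y ^ b * z ^ c)"
      have "(\<Sum>b\<le>l. \<Sum>c\<le>l. A b c * (real b * real (b - 1)) * (y ^ (b - 2) * z ^ c))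
          = (\<Sum>c\<le>l. z ^ c * (\<Sum>b\<le>l. A b c * (real b * real (b - 1)) * y ^ (b - 2)))"
        by (subst sum.swap) (simp add: sum_distrib_left algebra_simps)
      also have "\<dots> = (\<Sum>c\<le>l. z ^ c * (\<Sum>b\<le>l. A (b + 2) c * (real (b + 2) * real (b + 1)) * y ^ b))"
        by (subst shift_second_derivative[of "\<lambda>b. A b c" for c]) (simp_all add: supp)
      also have "\<dots> = (\<Sum>b\<le>l. \<Sum>c\<le>l. A (b + 2) c * (real (b + 2) * real (b + 1)) * (y ^ b * z ^ c))"
        by (subst sum.swap) (simp add: sum_distrib_left algebra_simps)
      finally have Y: "(\<Sum>b\<le>l. \<Sum>c\<le>l. A b c * (real b * real (b - 1)) * (y ^ (b - 2) * z ^ c)) = \<dots>" .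
      have "(\<Sum>b\<le>l. \<Sum>c\<le>l. A b c * (real c * real (c - 1)) * (y ^ b * z ^ (c - 2)))
          = (\<Sum>b\<le>l. y ^ b * (\<Sum>c\<le>l. A b c * (real c * real (c - 1)) * z ^ (c - 2)))"
        by (simp add: sum_distrib_left algebra_simps)
      also have "\<dots> = (\<Sum>b\<le>l. y ^ b * (\<Sum>c\<le>l. A b (c + 2) * (real (c + 2) * real (c + 1)) * z ^ c))"
        by (subst shift_second_derivative[of "A b" for b]) (simp_all add: supp)
      also have "\<dots> = (\<Sum>b\<le>l. \<Sum>c\<le>l. A b (c + 2) * (real (c + 2) * real (c + 1)) * (y ^ b * z ^ c))"
        by (simp add: sum_distrib_left algebra_simps)
      finally have Z: "(\<Sum>b\<le>l. \<Sum>c\<le>l. A b c * (real c * real (c - 1)) * (y ^ b * z ^ (c - 2))) = \<dots>" .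
      have "(\<Sum>b\<le>l. \<Sum>c\<le>l. ?C b c * (y ^ b * z ^ c)) = laplacian (homogeneous_eval l A) (vector [1, y, z])"
        unfolding laplacian_homogeneous_eval Y Z by (simp only: distrib_right sum.distrib)
      then show "(\<Sum>b\<le>l. \<Sum>c\<le>l. ?C b c * (y ^ b * z ^ c)) = 0" by (simp add: lap)
    qed (use True in auto)
  qed
qed (rule supp)

text \<open>The recurrence determines the coefficients with third exponent \<open>c + 2\<close> from those with third
exponent \<open>c\<close>. The initial data consists of \<open>(l + 1) + l = 2 l + 1\<close> numbers, the dimension of the
space of spherical harmonics of degree \<open>l\<close>.\<close>

lemma harmonic_coefficients_determined:
  assumes A: "harmonic_coefficients l A"
    and init: "\<And>b. b \<le> l \<Longrightarrow> A b 0 = 0" "\<And>b. b < l \<Longrightarrow> A b 1 = 0"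
  shows "A b c = 0"
proof -
  have supp: "A b c = 0" if "l < b + c" for b c
    using A that by (auto simp: harmonic_coefficients_def)
  show ?thesis
  proof (induction c arbitrary: b rule: less_induct)
    case (less c)
    consider "c = 0" | "c = 1" | c' where "c = c' + 2"
      by (metis One_nat_def Suc_1 add.commute add_Suc_right not0_implies_Suc plus_1_eq_Suc)
    then show ?case
    proof cases
      case 1
      then show ?thesis using init(1)[of b] supp[of b c] by (cases "b \<le> l") auto
    next
      case 2
      then show ?thesis using init(2)[of b] supp[of b c] by (cases "b < l") auto
    next
      case 3
      have "A b c' * (real (l - b - c') * real (l - b - c' - 1))
          + A (b + 2) c' * (real (b + 2) * real (b + 1))
          + A b (c' + 2) * (real (c' + 2) * real (c' + 1)) = 0"
        using A by (simp only: harmonic_coefficients_def)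
      moreover have "A b c' = 0" "A (b + 2) c' = 0" using less 3 by auto
      ultimately have "A b (c' + 2) * (real (c' + 2) * real (c' + 1)) = 0" by simp
      then show ?thesis using 3 by (simp add: of_nat_eq_0_iff[where 'a=real, symmetric] del: of_nat_add)
    qed
  qed
qed

lemma spherical_harmonic_coefficients:
  assumes "spherical_harmonic l f"
  obtains A where "harmonic_coefficients l A" "\<And>x. x \<in> S2 \<Longrightarrow> f x = homogeneous_eval l A x"
proof -
  obtain P where P: "real_polynomial_function P" "\<And>c x. P (c *\<^sub>R x) = c ^ l * P x"
    "\<And>x. laplacian P x = 0" "\<And>x. x \<in> S2 \<Longrightarrow> f x = P x"
    using assms unfolding spherical_harmonic_def by blast
  obtain A where A: "\<And>b c. l < b + c \<Longrightarrow> A b c = 0" "\<And>x. P x = homogeneous_eval l A x"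
    using homogeneous_polynomial[OF P(1,2)] by blast
  have "P = homogeneous_eval l A" using A(2) by blast
  then show ?thesis using P A by (intro that[of A] harmonic_coefficientsI) auto
qed

lemma harmonic_coefficients_lincomb:
  assumes "\<And>u. u \<in> U \<Longrightarrow> harmonic_coefficients l (A u)"
  shows "harmonic_coefficients l (\<lambda>b c. \<Sum>u\<in>U. \<xi> u * A u b c)"
  unfolding harmonic_coefficients_def
proof (intro conjI allI impI)
  fix b c
  show "(\<Sum>u\<in>U. \<xi> u * A u b c) = 0" if "l < b + c"
    using assms that by (intro sum.neutral) (auto simp: harmonic_coefficients_def)
  let ?p = "real (l - b - c) * real (l - b - c - 1)" and ?q = "real (b + 2) * real (b + 1)"
    and ?r = "real (c + 2) * real (c + 1)"
  have "(\<Sum>u\<in>U. \<xi> u * A u b c) * ?p + (\<Sum>u\<in>U. \<xi> u * A u (b + 2) c) * ?q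
        + (\<Sum>u\<in>U. \<xi> u * A u b (c + 2)) * ?r
      = (\<Sum>u\<in>U. \<xi> u * (A u b c * ?p + A u (b + 2) c * ?q + A u b (c + 2) * ?r))"
    by (simp only: sum_distrib_right sum.distrib[symmetric] distrib_left mult.assoc)
  also have "\<dots> = 0"
  proof (intro sum.neutral ballI)
    fix u assume "u \<in> U"
    from assms[OF this] have "A u b c * ?p + A u (b + 2) c * ?q + A u b (c + 2) * ?r = 0"
      unfolding harmonic_coefficients_def by blast
    then show "\<xi> u * (A u b c * ?p + A u (b + 2) c * ?q + A u b (c + 2) * ?r) = 0"
      by (simp only: mult_zero_right)
  qed
  finally show "(\<Sum>u\<in>U. \<xi> u * A u b c) * ?p + (\<Sum>u\<in>U. \<xi> u * A u (b + 2) c) * ?q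
        + (\<Sum>u\<in>U. \<xi> u * A u b (c + 2)) * ?r = 0" .
qed

lemma homogeneous_eval_lincomb:
  "homogeneous_eval l (\<lambda>b c. \<Sum>u\<in>U. \<xi> u * A u b c) x = (\<Sum>u\<in>U. \<xi> u * homogeneous_eval l (A u) x)"
proof -
  have "homogeneous_eval l (\<lambda>b c. \<Sum>u\<in>U. \<xi> u * A u b c) x
      = (\<Sum>b\<le>l. \<Sum>c\<le>l. \<Sum>u\<in>U. \<xi> u * (A u b c * monomial3 (l - b - c) b c x))"
    by (simp add: homogeneous_eval_def sum_distrib_right mult.assoc)
  also have "\<dots> = (\<Sum>b\<le>l. \<Sum>u\<in>U. \<Sum>c\<le>l. \<xi> u * (A u b c * monomial3 (l - b - c) b c x))"
    by (intro sum.cong refl sum.swap)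
  also have "\<dots> = (\<Sum>u\<in>U. \<Sum>b\<le>l. \<Sum>c\<le>l. \<xi> u * (A u b c * monomial3 (l - b - c) b c x))"
    by (rule sum.swap)
  finally show ?thesis by (simp add: homogeneous_eval_def sum_distrib_left)
qed

lemma spherical_harmonics_dependent:
  assumes U: "finite U" "card U > 2 * l + 1" and f: "\<And>u. u \<in> U \<Longrightarrow> spherical_harmonic l (f u)"
  obtains \<xi> where "\<exists>u\<in>U. \<xi> u \<noteq> 0" "\<And>x. x \<in> S2 \<Longrightarrow> (\<Sum>u\<in>U. \<xi> u * f u x) = 0"
proof -
  have "\<exists>A. harmonic_coefficients l A \<and> (\<forall>x\<in>S2. f u x = homogeneous_eval l A x)" if "u \<in> U" for u
    using spherical_harmonic_coefficients[OF f[OF that]] by metis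
  then obtain A where A: "\<And>u. u \<in> U \<Longrightarrow> harmonic_coefficients l (A u)"
    "\<And>u x. u \<in> U \<Longrightarrow> x \<in> S2 \<Longrightarrow> f u x = homogeneous_eval l (A u) x"
    by metis
  define E :: "(nat \<times> nat) set" where "E = (\<lambda>b. (b, 0)) ` {..l} \<union> (\<lambda>b. (b, 1)) ` {..<l}"
  have "card E \<le> card {..l} + card {..<l}"
    unfolding E_def by (intro order_trans[OF card_Un_le] add_mono card_image_le) auto
  then have "card E < card U" using U(2) by simp
  moreover have "finite E" by (simp add: E_def)
  ultimately obtain \<xi> where \<xi>: "\<exists>u\<in>U. \<xi> u \<noteq> 0"
    "\<And>e. e \<in> E \<Longrightarrow> (\<Sum>u\<in>U. (case e of (b, c) \<Rightarrow> A u b c) * \<xi> u) = 0"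
    using underdetermined_linear_system[of E U "\<lambda>e u. case e of (b, c) \<Rightarrow> A u b c"] U(1) by blast
  have zero: "(\<Sum>u\<in>U. \<xi> u * A u b c) = 0" for b c
  proof (rule harmonic_coefficients_determined[where A="\<lambda>b c. \<Sum>u\<in>U. \<xi> u * A u b c"])
    show "harmonic_coefficients l (\<lambda>b c. \<Sum>u\<in>U. \<xi> u * A u b c)"
      by (rule harmonic_coefficients_lincomb[OF A(1)])
    show "(\<Sum>u\<in>U. \<xi> u * A u b 0) = 0" if "b \<le> l" for b
      using \<xi>(2)[of "(b, 0)"] that by (simp add: E_def mult.commute)
    show "(\<Sum>u\<in>U. \<xi> u * A u b 1) = 0" if "b < l" for b
      using \<xi>(2)[of "(b, 1)"] that by (simp add: E_def mult.commute)
  qed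
  have "(\<Sum>u\<in>U. \<xi> u * f u x) = 0" if x: "x \<in> S2" for x
  proof -
    have "(\<Sum>u\<in>U. \<xi> u * f u x) = (\<Sum>u\<in>U. \<xi> u * homogeneous_eval l (A u) x)"
      using A(2) x by (intro sum.cong) auto
    also have "\<dots> = 0"
      unfolding homogeneous_eval_lincomb[symmetric] zero by (simp add: homogeneous_eval_def)
    finally show ?thesis .
  qed
  with \<xi>(1) show ?thesis by (rule that)
qed

section \<open>Rotations and zonal functions\<close>

text \<open>Only the fact that second directional derivatives form a quadratic form in the direction is needed
to rotate the Laplacian. Including first derivatives makes the statement inductive: the product rule
for second derivatives involves them.\<close>

lemma polynomial_second_derivative:
  fixes P :: "'a::real_normed_vector \<Rightarrow> real"
  assumes "real_polynomial_function P"
  shows "\<exists>D1 D2. (\<forall>x. linear (D1 x)) \<and> (\<forall>x. bilinear (D2 x)) \<and>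
    (\<forall>x v t. ((\<lambda>t. P (x + t *\<^sub>R v)) has_real_derivative D1 (x + t *\<^sub>R v) v) (at t)) \<and>
    (\<forall>x v t. ((\<lambda>t. D1 (x + t *\<^sub>R v) v) has_real_derivative D2 (x + t *\<^sub>R v) v v) (at t))"
  using assms
proof (induction P rule: real_polynomial_function.induct)
  case (linear f)
  interpret bounded_linear f by fact
  have "((\<lambda>t. f (x + t *\<^sub>R v)) has_real_derivative f v) (at t)" for x v t
    unfolding add scaleR by (auto intro!: derivative_eq_intros)
  then show ?case
    using linear_axioms
    by (intro exI[of _ "\<lambda>x v. f v"] exI[of _ "\<lambda>x v w. 0"]) (auto simp: bilinear_def linear_zero)
next
  case (const c)
  then show ?case
    by (intro exI[of _ "\<lambda>x v. 0"] exI[of _ "\<lambda>x v w. 0"]) (auto simp: bilinear_def linear_zero)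
next
  case (add f g)
  obtain F1 F2 where F: "\<forall>x. linear (F1 x)" "\<forall>x. bilinear (F2 x)"
    "\<forall>x v t. ((\<lambda>t. f (x + t *\<^sub>R v)) has_real_derivative F1 (x + t *\<^sub>R v) v) (at t)"
    "\<forall>x v t. ((\<lambda>t. F1 (x + t *\<^sub>R v) v) has_real_derivative F2 (x + t *\<^sub>R v) v v) (at t)"
    using add.IH(1) by blast
  obtain G1 G2 where G: "\<forall>x. linear (G1 x)" "\<forall>x. bilinear (G2 x)"
    "\<forall>x v t. ((\<lambda>t. g (x + t *\<^sub>R v)) has_real_derivative G1 (x + t *\<^sub>R v) v) (at t)"
    "\<forall>x v t. ((\<lambda>t. G1 (x + t *\<^sub>R v) v) has_real_derivative G2 (x + t *\<^sub>R v) v v) (at t)"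
    using add.IH(2) by blast
  show ?case
    using F G
    by (intro exI[of _ "\<lambda>x v. F1 x v + G1 x v"] exI[of _ "\<lambda>x v w. F2 x v w + G2 x v w"])
      (auto simp: bilinear_def intro!: linear_compose_add DERIV_add)
next
  case (mult f g)
  obtain F1 F2 where F: "\<And>x. linear (F1 x)" "\<And>x. bilinear (F2 x)"
    "\<And>x v t. ((\<lambda>t. f (x + t *\<^sub>R v)) has_real_derivative F1 (x + t *\<^sub>R v) v) (at t)"
    "\<And>x v t. ((\<lambda>t. F1 (x + t *\<^sub>R v) v) has_real_derivative F2 (x + t *\<^sub>R v) v v) (at t)"
    using mult.IH(1) by blast
  obtain G1 G2 where G: "\<And>x. linear (G1 x)" "\<And>x. bilinear (G2 x)"
    "\<And>x v t. ((\<lambda>t. g (x + t *\<^sub>R v)) has_real_derivative G1 (x + t *\<^sub>R v) v) (at t)"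
    "\<And>x v t. ((\<lambda>t. G1 (x + t *\<^sub>R v) v) has_real_derivative G2 (x + t *\<^sub>R v) v v) (at t)"
    using mult.IH(2) by blast
  have lin: "linear (\<lambda>v. h v * c)" if "linear h" for h :: "'a \<Rightarrow> real" and c
    using linear_compose_scale_right[OF that, of c] by (simp add: mult.commute)
  have F2: "linear (\<lambda>v. F2 x v w)" "linear (\<lambda>w. F2 x v w)" for x v w
    using F(2)[of x] by (auto simp: bilinear_def)
  have G2: "linear (\<lambda>v. G2 x v w)" "linear (\<lambda>w. G2 x v w)" for x v w
    using G(2)[of x] by (auto simp: bilinear_def)
  let ?D1 = "\<lambda>x v. F1 x v * g x + G1 x v * f x"
  let ?D2 = "\<lambda>x v w. (F2 x v w * g x + F1 x v * G1 x w) + (F1 x w * G1 x v + G2 x v w * f x)"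
  have l1: "linear (?D1 x)" for x
    by (intro linear_compose_add lin F(1) G(1))
  have "linear (\<lambda>w. F1 x v * G1 x w)" "linear (\<lambda>w. F1 x w * G1 x v)"
    "linear (\<lambda>v. F1 x v * G1 x w)" "linear (\<lambda>v. F1 x w * G1 x v)" for x v w
    by (rule linear_compose_scale_right[OF G(1), unfolded real_scaleR_def] lin[OF F(1)] lin[OF F(1)]
        linear_compose_scale_right[OF G(1), unfolded real_scaleR_def])+
  then have l2: "bilinear (?D2 x)" for x
    unfolding bilinear_def by (intro conjI allI linear_compose_add lin F2 G2 F(1) G(1))
  have d1: "((\<lambda>t. f (x + t *\<^sub>R v) * g (x + t *\<^sub>R v)) has_real_derivative ?D1 (x + t *\<^sub>R v) v) (at t)"
    for x v t
    by (rule DERIV_cong[OF DERIV_mult[OF F(3) G(3)]]) simp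
  have d2: "((\<lambda>t. ?D1 (x + t *\<^sub>R v) v) has_real_derivative ?D2 (x + t *\<^sub>R v) v v) (at t)"
    for x v t
    by (rule DERIV_cong[OF DERIV_add[OF DERIV_mult[OF F(4) G(3)] DERIV_mult[OF G(4) F(3)]]]) simp
  show ?case
    by (rule exI[of _ ?D1], rule exI[of _ ?D2]) (intro conjI allI l1 l2 d1 d2)
qed

text \<open>The trace of a bilinear form does not depend on the orthonormal basis.\<close>

lemma bilinear_trace_orthogonal:
  fixes B :: "real ^ 'n \<Rightarrow> real ^ 'n \<Rightarrow> real" and h :: "real ^ 'n \<Rightarrow> real ^ 'n"
  assumes B: "bilinear B" and h: "orthogonal_transformation h"
  shows "(\<Sum>b\<in>Basis. B (h b) (h b)) = (\<Sum>b\<in>Basis. B b b)"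
proof -
  define k where "k = inv_into UNIV h"
  have k: "orthogonal_transformation k"
    unfolding k_def by (rule orthogonal_transformation_inv[OF h])
  have hk: "h (k x) = x" for x
    unfolding k_def using orthogonal_transformation_surj[OF h] by (simp add: surj_f_inv_f)
  have adj: "inner (h b) c = inner b (k c)" for b c
    using h unfolding orthogonal_transformation_def by (metis hk)
  have ortho: "(\<Sum>b\<in>Basis. inner (h b) c * inner (h b) d) = inner c d" for c d
  proof -
    have "(\<Sum>b\<in>Basis. inner (h b) c * inner (h b) d) = inner (k c) (k d)"
      unfolding adj euclidean_inner[of "k c" "k d"] by (simp add: inner_commute)
    then show ?thesis using k by (simp add: orthogonal_transformation_def)
  qed
  have expand: "B (h b) (h b) = (\<Sum>(c, d)\<in>Basis \<times> Basis. inner (h b) c * inner (h b) d * B c d)" for b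
  proof -
    have "B (h b) (h b) = B (\<Sum>c\<in>Basis. inner (h b) c *\<^sub>R c) (\<Sum>d\<in>Basis. inner (h b) d *\<^sub>R d)"
      by (simp add: euclidean_representation)
    also have "\<dots> = (\<Sum>(c, d)\<in>Basis \<times> Basis. B (inner (h b) c *\<^sub>R c) (inner (h b) d *\<^sub>R d))"
      by (rule bilinear_sum[OF B])
    finally show ?thesis
      by (simp add: bilinear_lmul[OF B] bilinear_rmul[OF B] mult.assoc mult.left_commute)
  qed
  have "(\<Sum>b\<in>Basis. B (h b) (h b))
      = (\<Sum>(c, d)\<in>Basis \<times> Basis. (\<Sum>b\<in>Basis. inner (h b) c * inner (h b) d) * B c d)"
    unfolding expand by (subst sum.swap) (simp add: case_prod_beta' sum_distrib_right)
  also have "\<dots> = (\<Sum>c\<in>Basis. \<Sum>d\<in>Basis. inner c d * B c d)"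
    unfolding ortho by (simp add: sum.cartesian_product)
  also have "\<dots> = (\<Sum>c\<in>Basis. \<Sum>d\<in>Basis. if c = d then B c d else 0)"
    by (intro sum.cong refl) (auto simp: inner_Basis)
  finally show ?thesis by simp
qed

lemma laplacian_orthogonal:
  assumes P: "real_polynomial_function P" and h: "orthogonal_transformation h"
  shows "laplacian (\<lambda>x. P (h x)) x = laplacian P (h x)"
proof -
  obtain D1 D2 where D: "\<And>x. bilinear (D2 x)"
    "\<And>x v t. ((\<lambda>t. P (x + t *\<^sub>R v)) has_real_derivative D1 (x + t *\<^sub>R v) v) (at t)"
    "\<And>x v t. ((\<lambda>t. D1 (x + t *\<^sub>R v) v) has_real_derivative D2 (x + t *\<^sub>R v) v v) (at t)"
    using polynomial_second_derivative[OF P] by blast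
  have second: "(deriv ^^ 2) (\<lambda>t. P (x + t *\<^sub>R v)) 0 = D2 x v v" for x v
  proof -
    have "deriv (\<lambda>t. P (x + t *\<^sub>R v)) = (\<lambda>t. D1 (x + t *\<^sub>R v) v)"
      by (rule ext) (rule DERIV_imp_deriv[OF D(2)])
    then have "(deriv ^^ 2) (\<lambda>t. P (x + t *\<^sub>R v)) 0 = D2 (x + 0 *\<^sub>R v) v v"
      unfolding numeral_2_eq_2 by (simp add: DERIV_imp_deriv[OF D(3)] del: scaleR_zero_left)
    then show ?thesis by simp
  qed
  have lin: "h (x + t *\<^sub>R b) = h x + t *\<^sub>R h b" for t b
    using orthogonal_transformation_linear[OF h] by (simp add: linear_add linear_cmul)
  show ?thesis
    unfolding laplacian_def lin second by (rule bilinear_trace_orthogonal[OF D(1) h])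
qed

lemma spherical_harmonic_orthogonal:
  assumes f: "spherical_harmonic l f" and h: "orthogonal_transformation h"
  shows "spherical_harmonic l (\<lambda>x. f (h x))"
proof -
  obtain P where P: "real_polynomial_function P" "\<And>c x. P (c *\<^sub>R x) = c ^ l * P x"
    "\<And>x. laplacian P x = 0" "\<And>x. x \<in> S2 \<Longrightarrow> f x = P x"
    using f unfolding spherical_harmonic_def by blast
  have "polynomial_function h"
    using orthogonal_transformation_linear[OF h]
    by (intro polynomial_function_bounded_linear) (simp add: linear_conv_bounded_linear)
  then have "real_polynomial_function (P \<circ> h)"
    by (rule real_polynomial_function_compose[OF _ P(1)])
  then show ?thesis
    unfolding spherical_harmonic_def
    using P orthogonal_transformation_norm[OF h]
    by (intro exI[of _ "P \<circ> h"])
      (auto simp: comp_def laplacian_orthogonal[OF P(1) h] orthogonal_transformation_scaleR[OF h])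
qed

lemma spherical_harmonic_continuous:
  assumes "spherical_harmonic l f"
  shows "continuous_on S2 f"
proof -
  obtain P where P: "real_polynomial_function P" "\<And>x. x \<in> S2 \<Longrightarrow> f x = P x"
    using assms unfolding spherical_harmonic_def by blast
  have "continuous_on S2 P"
    using P(1) by (intro continuous_on_polymonial_function) (simp add: real_polynomial_function_eq)
  then show ?thesis
    by (rule continuous_on_cong[OF refl, THEN iffD2, rotated]) (rule P(2))
qed

lemma continuous_on_S2_L2: "continuous_on S2 f \<Longrightarrow> f \<in> L2 sph"
  using continuous_on_compact_L2[OF finite_measure_sph compact_space_sph id_measurable_sph, of f]
  by simp

definition harmonic_index :: "(nat \<times> int) set" where
  "harmonic_index = (SIGMA l:UNIV. orders l)"

lemma countable_harmonic_index: "countable harmonic_index"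
  by simp

locale spherical_basis =
  fixes Y :: harmonics
  assumes basis: "spherical_harmonics_basis Y"
begin

definition e :: "nat \<times> int \<Rightarrow> pt \<Rightarrow> real" where
  "e = (\<lambda>(l, m). Y l m)"

lemma Y_harmonic: "m \<in> orders l \<Longrightarrow> spherical_harmonic l (Y l m)"
  using basis by (auto simp: spherical_harmonics_basis_def)

lemma Y_continuous: "m \<in> orders l \<Longrightarrow> continuous_on S2 (Y l m)"
  by (rule spherical_harmonic_continuous[OF Y_harmonic])

lemma Y_L2: "m \<in> orders l \<Longrightarrow> Y l m \<in> L2 sph"
  by (rule continuous_on_S2_L2[OF Y_continuous])

lemma Y_orthonormal:
  "m \<in> orders l \<Longrightarrow> m' \<in> orders l' \<Longrightarrow>
    L2_inner sph (Y l m) (Y l' m') = (if l = l' \<and> m = m' then 1 else 0)"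
  using basis unfolding spherical_harmonics_basis_def by blast

sublocale orthonormal_basis sph harmonic_index e
proof (intro orthonormal_basis.intro finite_measure_sph orthonormal_basis_axioms.intro)
  show "e i \<in> L2 sph" if "i \<in> harmonic_index" for i
    using that Y_L2 by (auto simp: e_def harmonic_index_def)
  show "L2_inner sph (e i) (e j) = (if i = j then 1 else 0)"
    if ij: "i \<in> harmonic_index" "j \<in> harmonic_index" for i j
  proof -
    obtain l m l' m' where "i = (l, m)" "m \<in> orders l" "j = (l', m')" "m' \<in> orders l'"
      using ij unfolding harmonic_index_def by blast
    then show ?thesis using Y_orthonormal[of m l m' l'] by (simp add: e_def)
  qed
  show "AE x in sph. f x = 0"
    if "f \<in> L2 sph" "\<And>i. i \<in> harmonic_index \<Longrightarrow> L2_inner sph f (e i) = 0" for f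
  proof -
    have "L2_inner sph f (Y l m) = 0" if "m \<in> orders l" for l m
      using \<open>\<And>i. i \<in> harmonic_index \<Longrightarrow> L2_inner sph f (e i) = 0\<close>[of "(l, m)"] that
      by (simp add: e_def harmonic_index_def)
    with \<open>f \<in> L2 sph\<close> basis show ?thesis unfolding spherical_harmonics_basis_def by blast
  qed
qed

text \<open>The function \<open>f\<close> and the \<open>2l + 1\<close> functions \<open>Y l m\<close> are \<open>2l + 2\<close> spherical harmonics of degree \<open>l\<close>, one
too many to be independent. As the \<open>Y l m\<close> are independent, \<open>f\<close> occurs in the relation. Working with
option values keeps \<open>f\<close> apart from the basis even when it coincides with one of its members.\<close>

lemma spherical_harmonic_expansion:
  assumes f: "spherical_harmonic l f" and x: "x \<in> S2"
  shows "f x = (\<Sum>m\<in>orders l. L2_inner sph f (Y l m) * Y l m x)"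
proof -
  define U where "U = insert None (Some ` orders l)"
  define F where "F u = (case u of None \<Rightarrow> f | Some m \<Rightarrow> Y l m)" for u
  have card: "card U > 2 * l + 1"
  proof -
    have "card U = Suc (card (orders l))"
      unfolding U_def by (subst card_insert_disjoint) (auto simp: card_image)
    then show ?thesis by simp
  qed
  obtain \<xi> where \<xi>: "\<exists>u\<in>U. \<xi> u \<noteq> 0" "\<And>x. x \<in> S2 \<Longrightarrow> (\<Sum>u\<in>U. \<xi> u * F u x) = 0"
    by (rule spherical_harmonics_dependent[of U l F])
      (use card f Y_harmonic in \<open>auto simp: U_def F_def\<close>)
  have sumU: "(\<Sum>u\<in>U. \<xi> u * F u x) = \<xi> None * f x + (\<Sum>m\<in>orders l. \<xi> (Some m) * Y l m x)" for x
    unfolding U_def by (subst sum.insert) (auto simp: F_def sum.reindex)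
  have inner_sum: "L2_inner sph (\<lambda>x. \<Sum>m\<in>orders l. c m * Y l m x) (Y l k) = c k"
    if k: "k \<in> orders l" for c k
  proof -
    have "L2_inner sph (\<lambda>x. \<Sum>m\<in>orders l. c m * Y l m x) (Y l k)
        = (\<Sum>m\<in>orders l. c m * L2_inner sph (Y l m) (Y l k))"
      by (rule L2_inner_sum[OF Y_L2 Y_L2[OF k]])
    also have "\<dots> = (\<Sum>m\<in>orders l. if m = k then c m else 0)"
      using k by (intro sum.cong refl) (simp add: Y_orthonormal)
    finally show ?thesis using k by simp
  qed
  have ne: "\<xi> None \<noteq> 0"
  proof
    assume 0: "\<xi> None = 0"
    have "\<xi> (Some k) = 0" if k: "k \<in> orders l" for k
    proof -
      have "\<xi> (Some k) = L2_inner sph (\<lambda>x. \<Sum>m\<in>orders l. \<xi> (Some m) * Y l m x) (Y l k)"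
        by (rule inner_sum[OF k, symmetric])
      also have "\<dots> = L2_inner sph (\<lambda>x. 0) (Y l k)"
        using \<xi>(2) sumU 0 by (intro L2_inner_cong) auto
      finally show ?thesis by (simp add: L2_inner_def)
    qed
    with 0 \<xi>(1) show False by (auto simp: U_def)
  qed
  define c where "c m = - \<xi> (Some m) / \<xi> None" for m
  have fc: "f x = (\<Sum>m\<in>orders l. c m * Y l m x)" if "x \<in> S2" for x
  proof -
    have "f x = - (\<Sum>m\<in>orders l. \<xi> (Some m) * Y l m x) / \<xi> None"
      using \<xi>(2)[OF that] sumU[of x] ne by (simp add: field_simps)
    then show ?thesis by (simp add: c_def sum_divide_distrib sum_negf[symmetric])
  qed
  have "L2_inner sph f (Y l k) = c k" if "k \<in> orders l" for k
    using inner_sum[OF that, of c] L2_inner_cong[of sph f "\<lambda>x. \<Sum>m\<in>orders l. c m * Y l m x"] fc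
    by simp
  then show ?thesis using fc[OF x] by simp
qed

definition zonal :: "nat \<Rightarrow> pt \<Rightarrow> pt \<Rightarrow> real" where
  "zonal l u v = (\<Sum>m\<in>orders l. Y l m u * Y l m v)"

text \<open>Expand \<open>Y l m \<circ> h\<close> in the basis. Since \<open>h\<close> preserves the measure, its matrix is the transpose of the
matrix of \<open>h\<^sup>-\<^sup>1\<close>, so summing over \<open>m\<close> re-assembles \<open>Y l j \<circ> h\<^sup>-\<^sup>1\<close> at the point \<open>h u\<close>.\<close>

lemma zonal_orthogonal:
  assumes h: "orthogonal_transformation h" and u: "u \<in> S2" and v: "v \<in> S2"
  shows "zonal l (h u) (h v) = zonal l u v"
proof -
  define k where "k = inv_into UNIV h"
  have k: "orthogonal_transformation k"
    unfolding k_def by (rule orthogonal_transformation_inv[OF h])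
  have kh: "k (h x) = x" for x
    unfolding k_def using orthogonal_transformation_inj[OF h] by (simp add: inv_f_f)
  have hu: "h u \<in> S2" using u orthogonal_transformation_norm[OF h] by simp
  let ?C = "\<lambda>m j. L2_inner sph (\<lambda>x. Y l m (h x)) (Y l j)"
  have C: "?C m j = L2_inner sph (\<lambda>x. Y l j (k x)) (Y l m)" if "m \<in> orders l" "j \<in> orders l" for m j
  proof -
    have jk: "spherical_harmonic l (\<lambda>x. Y l j (k x))"
      by (rule spherical_harmonic_orthogonal[OF Y_harmonic[OF that(2)] k])
    have "?C m j = L2_inner sph (\<lambda>x. Y l m (h x)) (\<lambda>x. Y l j (k (h x)))"
      by (simp add: kh)
    also have "\<dots> = L2_inner sph (Y l m) (\<lambda>x. Y l j (k x))"
      by (rule L2_inner_sph_orthogonal[OF h L2_D(1)[OF Y_L2[OF that(1)]]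
            L2_D(1)[OF continuous_on_S2_L2[OF spherical_harmonic_continuous[OF jk]]]])
    finally show ?thesis by (simp only: L2_inner_commute)
  qed
  have "zonal l (h u) (h v) = (\<Sum>m\<in>orders l. Y l m (h u) * (\<Sum>j\<in>orders l. ?C m j * Y l j v))"
    unfolding zonal_def
    by (intro sum.cong refl arg_cong2[where f="(*)"]
        spherical_harmonic_expansion[OF spherical_harmonic_orthogonal[OF Y_harmonic h] v])
  also have "\<dots> = (\<Sum>m\<in>orders l. \<Sum>j\<in>orders l. Y l m (h u) * (?C m j * Y l j v))"
    by (simp add: sum_distrib_left)
  also have "\<dots> = (\<Sum>j\<in>orders l. \<Sum>m\<in>orders l. Y l m (h u) * (?C m j * Y l j v))"
    by (rule sum.swap)
  also have "\<dots> = (\<Sum>j\<in>orders l. (\<Sum>m\<in>orders l. L2_inner sph (\<lambda>x. Y l j (k x)) (Y l m) * Y l m (h u)) * Y l j v)"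
    by (intro sum.cong refl) (simp add: C sum_distrib_left sum_distrib_right mult.assoc mult.left_commute mult.commute)
  also have "\<dots> = (\<Sum>j\<in>orders l. Y l j (k (h u)) * Y l j v)"
    by (intro sum.cong refl arg_cong2[where f="(*)"] sym[OF
        spherical_harmonic_expansion[OF spherical_harmonic_orthogonal[OF Y_harmonic k] hu]])
  finally show ?thesis by (simp add: kh zonal_def)
qed

text \<open>By invariance under rotations the left-hand side is constant on the sphere, and its integral is the
number \<open>2l + 1\<close> of orders; the sphere has area \<open>4\<pi>\<close>.\<close>

lemma addition_theorem:
  assumes u: "u \<in> S2"
  shows "zonal l u u = (2 * real l + 1) / (4 * pi)"
proof -
  have const: "zonal l x x = zonal l u u" if x: "x \<in> S2" for x
  proof -
    obtain h where "orthogonal_transformation h" "h x = u"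
      using orthogonal_transformation_exists_1[of x u] x u by auto
    then show ?thesis using zonal_orthogonal[of h x x l] x by simp
  qed
  have meas: "measure sph (space sph) = 4 * pi"
    by (simp add: measure_def emeasure_sph_space)
  have "(\<integral>x. zonal l x x \<partial>sph) = (\<Sum>m\<in>orders l. (\<integral>x. Y l m x * Y l m x \<partial>sph))"
    unfolding zonal_def
    by (rule Bochner_Integration.integral_sum) (rule L2_mult_integrable[OF Y_L2 Y_L2])
  also have "\<dots> = (\<Sum>m\<in>orders l. 1)"
    using Y_orthonormal by (intro sum.cong refl) (simp add: L2_inner_def)
  also have "\<dots> = 2 * real l + 1" by simp
  finally have "2 * real l + 1 = (\<integral>x. zonal l x x \<partial>sph)" by simp
  also have "\<dots> = (\<integral>x. zonal l u u \<partial>sph)"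
    by (rule Bochner_Integration.integral_cong) (simp_all add: const)
  also have "\<dots> = zonal l u u * (4 * pi)" using meas by simp
  finally show ?thesis by (simp add: field_simps)
qed

end

section \<open>Green's functions\<close>

text \<open>A positive operator whose Green's functions are continuous. The summability condition is the bound on
the kernel diagonal, rewritten by the addition theorem.\<close>

locale elliptic_operator = spherical_basis +
  fixes E :: "nat \<Rightarrow> real"
  assumes E_pos: "0 < E l"
    and E_summable: "summable (\<lambda>l. (2 * real l + 1) / (4 * pi) / E l)"
begin

lemma finite_index_bound:
  assumes "finite F" "F \<subseteq> harmonic_index"
  obtains N where "F \<subseteq> (SIGMA l:{..<N}. orders l)"
proof -
  obtain N where "\<forall>l\<in>fst ` F. l < N" using finite_nat_set_iff_bounded assms(1) by blast
  then show ?thesis using assms(2) by (intro that[of N]) (force simp: harmonic_index_def)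
qed

sublocale mercer_system sph harmonic_index e "\<lambda>(l, m). E l" "\<Sum>l. (2 * real l + 1) / (4 * pi) / E l"
proof
  let ?B = "\<lambda>l. (2 * real l + 1) / (4 * pi) / E l"
  have B: "0 \<le> ?B l" for l using E_pos[of l] by simp
  show "0 < (case i of (l, m) \<Rightarrow> E l)" for i using E_pos by (cases i) simp
  show "continuous_on (space sph) (e i)" if "i \<in> harmonic_index" for i
    using that Y_continuous by (auto simp: e_def harmonic_index_def)
  show "0 \<le> suminf ?B" by (rule suminf_nonneg[OF E_summable B])
  show "f \<in> L2 sph" if "continuous_on (space sph) f" for f
    using continuous_on_S2_L2 that by simp
  show "f x = 0" if "continuous_on (space sph) f" "AE x in sph. f x = 0" "x \<in> space sph"
    for f :: "pt \<Rightarrow> real" and x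
    using that by (intro sph_full_support[of f]) auto
  fix x F assume x: "x \<in> space sph" and F: "finite F" "F \<subseteq> harmonic_index"
  obtain N where N: "F \<subseteq> (SIGMA l:{..<N}. orders l)" using finite_index_bound[OF F] .
  have "(\<Sum>i\<in>F. (e i x)\<^sup>2 / (case i of (l, m) \<Rightarrow> E l))
      \<le> (\<Sum>i\<in>(SIGMA l:{..<N}. orders l). (e i x)\<^sup>2 / (case i of (l, m) \<Rightarrow> E l))"
    by (rule sum_mono2) (use N E_pos in \<open>auto simp: less_imp_le\<close>)
  also have "\<dots> = (\<Sum>l<N. \<Sum>m\<in>orders l. (Y l m x)\<^sup>2 / E l)"
    by (simp add: sum.Sigma e_def case_prod_beta')
  also have "\<dots> = (\<Sum>l<N. ?B l)"
  proof (rule sum.cong[OF refl])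
    fix l
    have "(\<Sum>m\<in>orders l. (Y l m x)\<^sup>2) = (2 * real l + 1) / (4 * pi)"
      using addition_theorem[of x l] x by (simp add: zonal_def power2_eq_square)
    then show "(\<Sum>m\<in>orders l. (Y l m x)\<^sup>2 / E l) = ?B l"
      by (simp only: sum_divide_distrib[symmetric])
  qed
  also have "\<dots> \<le> suminf ?B"
    by (rule sum_le_suminf[OF E_summable]) (use B in auto)
  finally show "(\<Sum>i\<in>F. (e i x)\<^sup>2 / (case i of (l, m) \<Rightarrow> E l)) \<le> suminf ?B" .
qed

lemma kernel_zonal_series:
  assumes "u \<in> S2" "v \<in> S2"
  shows "kernel u v = (\<Sum>\<^sub>\<infinity>l. zonal l u v / E l)"
proof -
  let ?t = "\<lambda>i. e i u / (case i of (l, m) \<Rightarrow> E l) * e i v"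
  have "?t summable_on harmonic_index"
    using kernel_section(4)[of u v] assms by (intro has_sum_imp_summable) auto
  then have "infsum ?t harmonic_index = (\<Sum>\<^sub>\<infinity>l. \<Sum>\<^sub>\<infinity>m\<in>orders l. ?t (l, m))"
    unfolding harmonic_index_def by (rule infsum_Sigma_banach[symmetric])
  also have "\<dots> = (\<Sum>\<^sub>\<infinity>l. zonal l u v / E l)"
    by (intro infsum_cong) (simp add: e_def zonal_def sum_divide_distrib)
  finally show ?thesis by (simp add: kernel_def)
qed

lemma kernel_depends_on_inner:
  assumes "u \<in> S2" "v \<in> S2" "u' \<in> S2" "v' \<in> S2" "inner u v = inner u' v'"
  shows "kernel u v = kernel u' v'"
proof -
  obtain h where "orthogonal_transformation h" "h u = u'" "h v = v'"
    by (rule orthogonal_transformation_pair[OF assms])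
  then have "zonal l u' v' = zonal l u v" for l
    using zonal_orthogonal[of h u v l] assms by simp
  then show ?thesis
    unfolding kernel_zonal_series[OF assms(1,2)] kernel_zonal_series[OF assms(3,4)] by simp
qed

lemma kernel_symmetric:
  assumes "u \<in> S2" "v \<in> S2"
  shows "kernel u v = kernel v u"
  by (rule kernel_depends_on_inner) (use assms in \<open>simp_all add: inner_commute\<close>)

text \<open>A continuous function is determined by its Fourier coefficients, and \<open>kernel u\<close> has the prescribed ones.\<close>

lemma green_function_eq:
  assumes u: "u \<in> S2"
  shows "green_function Y E u = restrict (kernel u) S2"
  unfolding green_function_def
proof (rule the_equality)
  have k: "continuous_on S2 (kernel u)" using kernel_section(1)[of u] u by simp
  have c: "L2_inner sph (restrict (kernel u) S2) (Y l m) = Y l m u / E l" if "m \<in> orders l" for l m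
  proof -
    have "L2_inner sph (restrict (kernel u) S2) (Y l m) = L2_inner sph (kernel u) (e (l, m))"
      by (rule L2_inner_cong) (simp_all add: e_def)
    also have "\<dots> = e (l, m) u / E l"
      using kernel_section(2)[of u "(l, m)"] u that by (simp add: harmonic_index_def)
    finally show ?thesis by (simp add: e_def)
  qed
  show "restrict (kernel u) S2 \<in> extensional S2 \<and> continuous_on S2 (restrict (kernel u) S2) \<and>
      is_inverse_image Y E (dirac u) (regular_distribution (restrict (kernel u) S2))"
    using k c by (auto simp: is_inverse_image_def dirac_def regular_distribution_def
        cong: continuous_on_cong_simp)
  fix f assume f: "f \<in> extensional S2 \<and> continuous_on S2 f \<and>
      is_inverse_image Y E (dirac u) (regular_distribution f)"
  have "f x = kernel u x" if "x \<in> S2" for x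
  proof (rule continuous_determined)
    show "L2_inner sph f (e i) = L2_inner sph (kernel u) (e i)" if "i \<in> harmonic_index" for i
      using f kernel_section(2)[of u i] u that
      by (auto simp: is_inverse_image_def dirac_def regular_distribution_def e_def harmonic_index_def)
  qed (use f k that in auto)
  then show "f = restrict (kernel u) S2"
    using f by (intro extensionalityI[where A=S2]) auto
qed

text \<open>Every \<open>t\<close> in \<open>[-1, 1]\<close> is the inner product of two unit vectors, so the defining condition determines
the function on the whole interval; the witnesses \<open>a\<close> and \<open>b t\<close> lie on a great circle.\<close>

lemma zonal_green_kernel_eq:
  assumes u: "u \<in> S2" and v: "v \<in> S2"
  shows "zonal_green_kernel Y E (inner u v) = kernel u v"
proof -
  let ?P = "\<lambda>\<psi>. \<psi> \<in> extensional {-1..1} \<and>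
     (\<forall>u\<in>S2. \<forall>v\<in>S2. green_function Y E u v = \<psi> (inner u v))"
  have range: "inner u v \<in> {-1..1}" if "u \<in> S2" "v \<in> S2" for u v :: pt
    using Cauchy_Schwarz_ineq2[of u v] that by (auto simp: abs_le_iff)
  define a b where "a = (axis 1 1 :: pt)" and "b t = t *\<^sub>R axis 1 1 + sqrt (1 - t\<^sup>2) *\<^sub>R (axis 2 1 :: pt)" for t
  have ab: "a \<in> S2" "b t \<in> S2" "inner a (b t) = t" if "t \<in> {-1..1}" for t
  proof -
    have "t\<^sup>2 \<le> 1" using that by (simp add: abs_square_le_1 abs_le_iff)
    moreover have "inner (b t) (b t) = t\<^sup>2 + (sqrt (1 - t\<^sup>2))\<^sup>2"
      by (simp add: b_def inner_add_left inner_add_right inner_axis_axis power2_eq_square)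
    ultimately show "b t \<in> S2" by (simp add: norm_eq_sqrt_inner)
    show "a \<in> S2" "inner a (b t) = t"
      by (simp_all add: a_def b_def inner_add_right inner_axis_axis)
  qed
  define \<psi> where "\<psi> = restrict (\<lambda>t. kernel a (b t)) {-1..1}"
  have "zonal_green_kernel Y E = \<psi>"
    unfolding zonal_green_kernel_def
  proof (rule the_equality)
    have "green_function Y E u v = \<psi> (inner u v)" if "u \<in> S2" "v \<in> S2" for u v
      using kernel_depends_on_inner[of u v a "b (inner u v)"] that ab range[OF that]
      by (simp add: green_function_eq \<psi>_def)
    then show "?P \<psi>" by (simp add: \<psi>_def)
    fix \<phi> assume \<phi>: "?P \<phi>"
    have "\<phi> t = \<psi> t" if "t \<in> {-1..1}" for t
    proof -
      have "\<phi> t = green_function Y E a (b t)" using \<phi> ab[OF that] by metis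
      then show ?thesis using ab[OF that] that by (simp add: green_function_eq \<psi>_def)
    qed
    then show "\<phi> = \<psi>"
      using \<phi> by (intro extensionalityI[where A="{-1..1}"]) (auto simp: \<psi>_def)
  qed
  then show ?thesis
    using kernel_depends_on_inner[of u v a "b (inner u v)"] u v ab range[OF u v]
    by (simp add: \<psi>_def)
qed

end

section \<open>The tensor square of an admissible operator\<close>

lemma suminf_ennreal_partial:
  fixes f :: "nat \<Rightarrow> ennreal"
  shows "(\<Sum>l<N. f l) \<le> suminf f"
  by (rule sum_le_suminf) auto

lemma tendsto_zero_of_ennreal_bound:
  fixes f :: "nat \<Rightarrow> real"
  assumes le: "\<And>n. ennreal (f n) \<le> F n" and lim: "F \<longlonglongrightarrow> 0" and nonneg: "\<And>n. 0 \<le> f n"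
  shows "f \<longlonglongrightarrow> 0"
proof -
  have "(\<lambda>n. ennreal (f n)) \<longlonglongrightarrow> ennreal 0"
    unfolding ennreal_0
  proof (rule tendsto_sandwich[OF _ _ tendsto_const lim])
    show "\<forall>\<^sub>F n in sequentially. 0 \<le> ennreal (f n)" by simp
    show "\<forall>\<^sub>F n in sequentially. ennreal (f n) \<le> F n" using le by simp
  qed
  then show ?thesis
    by (rule tendsto_ennreal_iff[THEN iffD1, rotated 2]) (use nonneg in auto)
qed

text \<open>The growth condition compares \<open>D\<^sub>l\<^sup>2\<close> with \<open>((1 + l)\<^sup>2)\<^sup>p\<close>, the Sobolev weight is
\<open>(1 + l (l + 1))\<^sup>p\<close>, and \<open>1 + l (l + 1) \<le> (1 + l)\<^sup>2 \<le> 2 (1 + l (l + 1))\<close>.\<close>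

lemma admissible_weight_bounds:
  assumes adm: "admissible D p"
  shows "\<exists>K>0. \<forall>l. ((1 + real l) powr p)\<^sup>2 \<le> K * (D l)\<^sup>2"
    and "\<exists>K>0. \<forall>l. sobolev_weight p l \<le> K * (D l)\<^sup>2"
    and "\<exists>K>0. \<forall>l. (D l)\<^sup>2 \<le> K * sobolev_weight p l"
proof -
  obtain C1 C2 where C: "0 < C1" "0 < C2"
    "\<And>l. C1 * (1 + real l) powr p \<le> \<bar>D l\<bar>" "\<And>l. \<bar>D l\<bar> \<le> C2 * (1 + real l) powr p"
    and p: "0 \<le> p"
    using adm unfolding admissible_def by blast
  have sq: "((1 + real l) powr p)\<^sup>2 = ((1 + real l) * (1 + real l)) powr p" for l
    by (simp add: powr_mult power2_eq_square)
  have w_le: "sobolev_weight p l \<le> ((1 + real l) powr p)\<^sup>2" for l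
    unfolding sq sobolev_weight_def by (rule powr_mono2[OF p]) (auto simp: algebra_simps)
  have w_ge: "((1 + real l) powr p)\<^sup>2 \<le> 2 powr p * sobolev_weight p l" for l
  proof -
    have "0 \<le> (real l)\<^sup>2" by simp
    then have "(1 + real l) * (1 + real l) \<le> 2 * (1 + real l * (real l + 1))"
      by (simp add: algebra_simps power2_eq_square)
    then have "((1 + real l) * (1 + real l)) powr p \<le> (2 * (1 + real l * (real l + 1))) powr p"
      by (intro powr_mono2[OF p]) auto
    also have "\<dots> = 2 powr p * (1 + real l * (real l + 1)) powr p"
      by (rule powr_mult)
    finally show ?thesis unfolding sq sobolev_weight_def .
  qed
  have D_ge: "((1 + real l) powr p)\<^sup>2 \<le> (1 / C1\<^sup>2) * (D l)\<^sup>2" for l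
  proof -
    have "(C1 * (1 + real l) powr p)\<^sup>2 \<le> \<bar>D l\<bar>\<^sup>2"
      using C by (intro power_mono) auto
    then show ?thesis using C(1) by (simp add: power_mult_distrib field_simps)
  qed
  have D_le: "(D l)\<^sup>2 \<le> C2\<^sup>2 * ((1 + real l) powr p)\<^sup>2" for l
  proof -
    have "\<bar>D l\<bar>\<^sup>2 \<le> (C2 * (1 + real l) powr p)\<^sup>2"
      using C by (intro power_mono) auto
    then show ?thesis by (simp add: power_mult_distrib)
  qed
  have "0 < 1 / C1\<^sup>2" using C(1) by simp
  with D_ge show "\<exists>K>0. \<forall>l. ((1 + real l) powr p)\<^sup>2 \<le> K * (D l)\<^sup>2" by blast
  show "\<exists>K>0. \<forall>l. sobolev_weight p l \<le> K * (D l)\<^sup>2"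
    using \<open>0 < 1 / C1\<^sup>2\<close> order_trans[OF w_le D_ge] by blast
  have "(D l)\<^sup>2 \<le> C2\<^sup>2 * 2 powr p * sobolev_weight p l" for l
    using order_trans[OF D_le mult_left_mono[OF w_ge, of "C2\<^sup>2"]] by (simp add: mult.assoc)
  moreover have "0 < C2\<^sup>2 * 2 powr p" using C(2) by simp
  ultimately show "\<exists>K>0. \<forall>l. (D l)\<^sup>2 \<le> K * sobolev_weight p l" by blast
qed

lemma sobolev_weight_pos: "0 < sobolev_weight p l"
proof -
  have "0 < 1 + real l * (real l + 1)"
    by (intro add_pos_nonneg mult_nonneg_nonneg) auto
  then have "1 + real l * (real l + 1) \<noteq> 0" by (rule less_imp_neq[symmetric])
  then show ?thesis unfolding sobolev_weight_def by (metis powr_gt_zero)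
qed

text \<open>The terms are of order \<open>l\<^sup>1\<^sup>-\<^sup>2\<^sup>p\<close>, and \<open>1 - 2p < -1\<close> exactly when \<open>p > 1\<close>.\<close>

lemma admissible_summable:
  assumes adm: "admissible D p" and p: "p > 1"
  shows "summable (\<lambda>l. (2 * real l + 1) / (4 * pi) / (D l)\<^sup>2)"
proof -
  obtain K1 where K1: "0 < K1" "\<And>l. ((1 + real l) powr p)\<^sup>2 \<le> K1 * (D l)\<^sup>2"
    using admissible_weight_bounds(1)[OF adm] by blast
  have D: "0 < (D l)\<^sup>2" for l using adm by (simp add: admissible_def)
  have "summable (\<lambda>l. real l powr (1 - 2 * p))"
    using p by (simp add: summable_real_powr_iff)
  then have "summable (\<lambda>l. real (Suc l) powr (1 - 2 * p))"
    using summable_Suc_iff[of "\<lambda>l. real l powr (1 - 2 * p)"] by blast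
  then have "summable (\<lambda>l. (2 * K1 / (4 * pi)) * real (Suc l) powr (1 - 2 * p))"
    by (rule summable_mult)
  then show ?thesis
  proof (rule summable_comparison_test')
    fix l :: nat
    let ?a = "1 + real l"
    have a: "0 < ?a" by simp
    have "?a / (D l)\<^sup>2 \<le> K1 * ?a / (?a powr p)\<^sup>2"
    proof -
      have "?a * (?a powr p)\<^sup>2 \<le> ?a * (K1 * (D l)\<^sup>2)"
        using K1(2)[of l] a by (intro mult_left_mono) auto
      moreover have "0 < (?a powr p)\<^sup>2" using a by simp
      ultimately show ?thesis
        using D[of l] by (simp add: pos_divide_le_eq pos_le_divide_eq mult.assoc mult.commute mult.left_commute)
    qed
    also have "\<dots> = K1 * ?a powr (1 - 2 * p)"
      using a by (simp add: powr_diff powr_add[symmetric] power2_eq_square)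
    finally have *: "?a / (D l)\<^sup>2 \<le> K1 * ?a powr (1 - 2 * p)" .
    have "(2 * real l + 1) / (4 * pi) / (D l)\<^sup>2 \<le> (2 * ?a) / (4 * pi) / (D l)\<^sup>2"
      by (intro divide_right_mono) auto
    also have "\<dots> = 2 / (4 * pi) * (?a / (D l)\<^sup>2)" by (simp only: times_divide_times_eq divide_divide_eq_left mult.assoc)
    also have "\<dots> \<le> 2 / (4 * pi) * (K1 * ?a powr (1 - 2 * p))"
      by (rule mult_left_mono[OF *]) simp
    finally show "norm ((2 * real l + 1) / (4 * pi) / (D l)\<^sup>2)
        \<le> 2 * K1 / (4 * pi) * real (Suc l) powr (1 - 2 * p)"
      using D[of l] by (simp add: add.commute)
  qed
qed

lemma algebraic_tensor_product_minus:
  assumes B: "\<And>f. f \<in> B \<Longrightarrow> (\<lambda>x. - f x) \<in> B"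
    and s: "s \<in> algebraic_tensor_product A B" and t: "t \<in> algebraic_tensor_product A B"
  shows "(\<lambda>x. s x - t x) \<in> algebraic_tensor_product A B"
proof -
  obtain a b N where s': "s = (\<lambda>x. \<Sum>i<N. tensor (a i) (b i) x)" "\<forall>i<(N::nat). a i \<in> A \<and> b i \<in> B"
    using s unfolding algebraic_tensor_product_def by blast
  obtain a' b' N' where t': "t = (\<lambda>x. \<Sum>i<N'. tensor (a' i) (b' i) x)"
      "\<forall>i<(N'::nat). a' i \<in> A \<and> b' i \<in> B"
    using t unfolding algebraic_tensor_product_def by blast
  define \<alpha> where "\<alpha> i = (if i < N then a i else a' (i - N))" for i
  define \<beta> where "\<beta> i = (if i < N then b i else (\<lambda>x. - b' (i - N) x))" for i
  have "(\<Sum>i<N + K. tensor (\<alpha> i) (\<beta> i) x) = s x - (\<Sum>i<K. tensor (a' i) (b' i) x)" for K x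
  proof (induction K)
    case 0
    then show ?case by (simp add: s'(1) \<alpha>_def \<beta>_def)
  next
    case (Suc K)
    have "tensor (\<alpha> (N + K)) (\<beta> (N + K)) x = - tensor (a' K) (b' K) x"
      by (cases x) (simp add: \<alpha>_def \<beta>_def tensor_apply)
    with Suc show ?case by simp
  qed
  then have "(\<lambda>x. s x - t x) = (\<lambda>x. \<Sum>i<N + N'. tensor (\<alpha> i) (\<beta> i) x)"
    by (simp add: t'(1))
  moreover have "\<alpha> i \<in> A \<and> \<beta> i \<in> B" if "i < N + N'" for i
  proof (cases "i < N")
    case False
    then have "i - N < N'" using that by linarith
    then show ?thesis using False t'(2) B by (simp add: \<alpha>_def \<beta>_def)
  qed (use s'(2) in \<open>simp add: \<alpha>_def \<beta>_def\<close>)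
  ultimately show ?thesis unfolding algebraic_tensor_product_def by blast
qed

locale admissible_operator = spherical_basis +
  fixes D :: "nat \<Rightarrow> real" and p :: real
  assumes adm: "admissible D p" and p_gt_1: "p > 1"
begin

sublocale elliptic_operator Y "\<lambda>l. (D l)\<^sup>2"
proof
  show "0 < (D l)\<^sup>2" for l using adm by (simp add: admissible_def)
  show "summable (\<lambda>l. (2 * real l + 1) / (4 * pi) / (D l)\<^sup>2)"
    by (rule admissible_summable[OF adm p_gt_1])
qed

abbreviation index2 :: "((nat \<times> int) \<times> (nat \<times> int)) set" where
  "index2 \<equiv> harmonic_index \<times> harmonic_index"

text \<open>Weights and operator coefficients as functions on the index set of the basis, where they do not
depend on the order \<open>m\<close>.\<close>

definition weight :: "nat \<times> int \<Rightarrow> real" where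
  "weight i = sobolev_weight p (fst i)"

definition symbol :: "nat \<times> int \<Rightarrow> real" where
  "symbol i = D (fst i)"

definition weight2 :: "(nat \<times> int) \<times> (nat \<times> int) \<Rightarrow> real" where
  "weight2 i = weight (fst i) * weight (snd i)"

definition symbol2 :: "(nat \<times> int) \<times> (nat \<times> int) \<Rightarrow> real" where
  "symbol2 i = symbol (fst i) * symbol (snd i)"

sublocale T: mercer_system sph2 index2 "tensor_family e"
  "\<lambda>(i, j). (case i of (l, m) \<Rightarrow> (D l)\<^sup>2) * (case j of (l, m) \<Rightarrow> (D l)\<^sup>2)"
  "(\<Sum>l. (2 * real l + 1) / (4 * pi) / (D l)\<^sup>2) * (\<Sum>l. (2 * real l + 1) / (4 * pi) / (D l)\<^sup>2)"
  by (rule mercer_system_tensor[OF mercer_system_axioms countable_harmonic_index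
        compact_space_sph id_measurable_sph])

abbreviation coeff2 :: "(pt \<times> pt \<Rightarrow> real) \<Rightarrow> (nat \<times> int) \<times> (nat \<times> int) \<Rightarrow> real" where
  "coeff2 g i \<equiv> L2_inner sph2 g (tensor_family e i)"

lemma energy_weight:
  "(case i of (i, j) \<Rightarrow> (case i of (l, m) \<Rightarrow> (D l)\<^sup>2) * (case j of (l, m) \<Rightarrow> (D l)\<^sup>2)) = (symbol2 i)\<^sup>2"
  by (simp add: symbol2_def symbol_def case_prod_beta' power_mult_distrib)

lemma weight_pos: "0 < weight i" "0 < weight2 j"
  by (simp_all add: weight_def weight2_def sobolev_weight_pos)

lemma symbol_bounds:
  shows "\<exists>K. \<forall>i. (symbol i)\<^sup>2 \<le> K * weight i"
    and "\<exists>K\<ge>0. \<forall>j. (symbol2 j)\<^sup>2 \<le> K * weight2 j"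
proof -
  obtain K where K: "0 < K" "\<And>l. (D l)\<^sup>2 \<le> K * sobolev_weight p l"
    using admissible_weight_bounds(3)[OF adm] by blast
  have s: "(symbol i)\<^sup>2 \<le> K * weight i" for i by (simp add: symbol_def weight_def K)
  then show "\<exists>K. \<forall>i. (symbol i)\<^sup>2 \<le> K * weight i" by blast
  have "(symbol (fst j))\<^sup>2 * (symbol (snd j))\<^sup>2 \<le> (K * weight (fst j)) * (K * weight (snd j))" for j
    by (intro mult_mono s mult_nonneg_nonneg zero_le_power2 less_imp_le[OF weight_pos(1)] less_imp_le[OF K(1)])
  then have "(symbol2 j)\<^sup>2 \<le> K\<^sup>2 * weight2 j" for j
    by (simp add: symbol2_def weight2_def power_mult_distrib power2_eq_square mult.assoc mult.left_commute)
  moreover have "0 \<le> K\<^sup>2" by simp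
  ultimately show "\<exists>K\<ge>0. \<forall>j. (symbol2 j)\<^sup>2 \<le> K * weight2 j" by blast
qed

lemma sum_degrees:
  fixes h :: "nat \<times> int \<Rightarrow> 'b::comm_monoid_add"
  shows "(\<Sum>i\<in>(SIGMA l:{..<N}. orders l). h i) = (\<Sum>l<N. \<Sum>m\<in>orders l. h (l, m))"
  by (subst sum.Sigma) auto

lemma H_sqnorm_partial:
  assumes F: "finite F" "F \<subseteq> harmonic_index"
  shows "ennreal (\<Sum>i\<in>F. weight i * (L2_inner sph f (e i))\<^sup>2) \<le> H_sqnorm Y p f"
proof -
  obtain N where N: "F \<subseteq> (SIGMA l:{..<N}. orders l)" using finite_index_bound[OF F] .
  have "(\<Sum>i\<in>F. weight i * (L2_inner sph f (e i))\<^sup>2)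
      \<le> (\<Sum>i\<in>(SIGMA l:{..<N}. orders l). weight i * (L2_inner sph f (e i))\<^sup>2)"
    by (rule sum_mono2) (use N weight_pos in \<open>auto simp: less_imp_le\<close>)
  also have "\<dots> = (\<Sum>l<N. \<Sum>m\<in>orders l. sobolev_weight p l * (L2_inner sph f (Y l m))\<^sup>2)"
    by (simp add: sum.Sigma weight_def e_def case_prod_beta')
  also have "\<dots> = (\<Sum>l<N. sobolev_weight p l * (\<Sum>m\<in>orders l. (L2_inner sph f (Y l m))\<^sup>2))"
    by (simp add: sum_distrib_left)
  finally have "ennreal (\<Sum>i\<in>F. weight i * (L2_inner sph f (e i))\<^sup>2)
      \<le> ennreal (\<Sum>l<N. sobolev_weight p l * (\<Sum>m\<in>orders l. (L2_inner sph f (Y l m))\<^sup>2))"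
    by (rule ennreal_leI)
  also have "\<dots> = (\<Sum>l<N. ennreal (sobolev_weight p l * (\<Sum>m\<in>orders l. (L2_inner sph f (Y l m))\<^sup>2)))"
    by (rule sum_ennreal[symmetric]) (simp add: sum_nonneg less_imp_le[OF sobolev_weight_pos])
  also have "\<dots> \<le> H_sqnorm Y p f"
    unfolding H_sqnorm_def by (rule suminf_ennreal_partial)
  finally show ?thesis .
qed

text \<open>The squared Sobolev norm is an extended real given by iterated series over degrees. Bounds on finite
partial sums over indices are all that is needed to recover summability and an upper bound for the
sum (\<open>nonneg_partial_sums_ennreal\<close>).\<close>

lemma HH_sqnorm_partial:
  assumes F: "finite F" "F \<subseteq> index2"
  shows "ennreal (\<Sum>i\<in>F. weight2 i * (coeff2 g i)\<^sup>2) \<le> HH_sqnorm Y p g"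
proof -
  let ?t = "\<lambda>l l'. \<Sum>m\<in>orders l. \<Sum>m'\<in>orders l'. (L2_inner sph2 g (tensor (Y l m) (Y l' m')))\<^sup>2"
  let ?w = "\<lambda>l l'. sobolev_weight p l * sobolev_weight p l'"
  have w: "0 \<le> ?w l l' * ?t l l'" for l l'
    by (intro mult_nonneg_nonneg sum_nonneg) (simp_all add: less_imp_le[OF sobolev_weight_pos])
  have "finite (fst ` F \<union> snd ` F)" "fst ` F \<union> snd ` F \<subseteq> harmonic_index"
    using F by auto
  then obtain N where N: "fst ` F \<union> snd ` F \<subseteq> (SIGMA l:{..<N}. orders l)"
    using finite_index_bound by blast
  let ?S = "SIGMA l:{..<N}. orders l"
  have "F \<subseteq> ?S \<times> ?S"
  proof
    fix i assume "i \<in> F"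
    then have "fst i \<in> ?S" "snd i \<in> ?S" using N by blast+
    then show "i \<in> ?S \<times> ?S" by (simp add: mem_Times_iff)
  qed
  then have "(\<Sum>i\<in>F. weight2 i * (coeff2 g i)\<^sup>2) \<le> (\<Sum>i\<in>?S \<times> ?S. weight2 i * (coeff2 g i)\<^sup>2)"
    by (rule sum_mono2[rotated]) (auto simp: less_imp_le[OF weight_pos(2)])
  also have "\<dots> = (\<Sum>i\<in>?S. \<Sum>j\<in>?S. weight2 (i, j) * (coeff2 g (i, j))\<^sup>2)"
    by (simp add: sum.cartesian_product)
  also have "\<dots> = (\<Sum>l<N. \<Sum>m\<in>orders l. \<Sum>l'<N. \<Sum>m'\<in>orders l'.
      weight2 ((l, m), (l', m')) * (coeff2 g ((l, m), (l', m')))\<^sup>2)"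
    by (simp only: sum_degrees)
  also have "\<dots> = (\<Sum>l<N. \<Sum>l'<N. \<Sum>m\<in>orders l. \<Sum>m'\<in>orders l'.
      weight2 ((l, m), (l', m')) * (coeff2 g ((l, m), (l', m')))\<^sup>2)"
    by (intro sum.cong[OF refl] sum.swap)
  also have "\<dots> = (\<Sum>l<N. \<Sum>l'<N. ?w l l' * ?t l l')"
    by (simp add: weight2_def weight_def tensor_family_def e_def sum_distrib_left)
  finally have "ennreal (\<Sum>i\<in>F. weight2 i * (coeff2 g i)\<^sup>2) \<le> ennreal (\<Sum>l<N. \<Sum>l'<N. ?w l l' * ?t l l')"
    by (rule ennreal_leI)
  also have "\<dots> = (\<Sum>l<N. \<Sum>l'<N. ennreal (?w l l' * ?t l l'))"
    by (simp only: sum_ennreal[symmetric] w sum_nonneg)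
  also have "\<dots> \<le> (\<Sum>l<N. \<Sum>l'. ennreal (?w l l' * ?t l l'))"
    by (intro sum_mono suminf_ennreal_partial)
  also have "\<dots> \<le> HH_sqnorm Y p g"
    unfolding HH_sqnorm_def by (rule suminf_ennreal_partial)
  finally show ?thesis .
qed

lemma nonneg_partial_sums_ennreal:
  fixes f :: "'i \<Rightarrow> real"
  assumes nonneg: "\<And>i. i \<in> J \<Longrightarrow> 0 \<le> f i" and fin: "C < \<infinity>"
    and partial: "\<And>F. finite F \<Longrightarrow> F \<subseteq> J \<Longrightarrow> ennreal (\<Sum>i\<in>F. f i) \<le> C"
  shows "f summable_on J" "ennreal (\<Sum>\<^sub>\<infinity>i\<in>J. f i) \<le> C"
proof -
  obtain c where c: "C = ennreal c" "0 \<le> c" using fin by (cases C) auto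
  have le: "(\<Sum>i\<in>F. f i) \<le> c" if "finite F" "F \<subseteq> J" for F
    using partial[OF that] c by (simp add: ennreal_le_iff)
  show s: "f summable_on J"
    by (rule nonneg_bounded_partial_sums_imp_summable_on[OF nonneg])
      (auto intro!: eventually_finite_subsets_at_top_weakI le)
  show "ennreal (\<Sum>\<^sub>\<infinity>i\<in>J. f i) \<le> C"
    unfolding c(1) by (rule ennreal_leI[OF infsum_le_finite_sums[OF s le]])
qed

lemma H_coefficients_summable:
  assumes "f \<in> H Y p"
  shows "(\<lambda>i. (symbol i * L2_inner sph f (e i))\<^sup>2) summable_on harmonic_index"
proof -
  obtain K where K: "\<And>i. (symbol i)\<^sup>2 \<le> K * weight i" using symbol_bounds(1) by blast
  have "(\<lambda>i. weight i * (L2_inner sph f (e i))\<^sup>2) summable_on harmonic_index"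
    using assms
    by (intro nonneg_partial_sums_ennreal(1)[where C="H_sqnorm Y p f"] H_sqnorm_partial)
      (auto simp: H_def less_imp_le[OF weight_pos(1)])
  then have "(\<lambda>i. K * (weight i * (L2_inner sph f (e i))\<^sup>2)) summable_on harmonic_index"
    by (rule summable_on_cmult_right)
  then show ?thesis
  proof (rule summable_on_comparison_test)
    fix i
    have "(symbol i)\<^sup>2 * (L2_inner sph f (e i))\<^sup>2 \<le> (K * weight i) * (L2_inner sph f (e i))\<^sup>2"
      by (rule mult_right_mono[OF K]) simp
    then show "(symbol i * L2_inner sph f (e i))\<^sup>2 \<le> K * (weight i * (L2_inner sph f (e i))\<^sup>2)"
      by (simp add: power_mult_distrib mult.assoc)
  qed simp
qed

lemma HH_coefficients_summable:
  assumes "HH_sqnorm Y p g < \<infinity>"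
  shows "(\<lambda>i. (symbol2 i * coeff2 g i)\<^sup>2) summable_on index2"
    and "\<exists>C\<ge>0. \<forall>g. HH_sqnorm Y p g < \<infinity> \<longrightarrow>
      ennreal (\<Sum>\<^sub>\<infinity>i\<in>index2. (symbol2 i * coeff2 g i)\<^sup>2) \<le> ennreal C * HH_sqnorm Y p g"
proof -
  obtain K where K: "0 \<le> K" "\<And>i. (symbol2 i)\<^sup>2 \<le> K * weight2 i"
    using symbol_bounds(2) by blast
  have w: "(\<lambda>i. weight2 i * (coeff2 g i)\<^sup>2) summable_on index2"
      "ennreal (\<Sum>\<^sub>\<infinity>i\<in>index2. weight2 i * (coeff2 g i)\<^sup>2) \<le> HH_sqnorm Y p g"
    if "HH_sqnorm Y p g < \<infinity>" for g
    by (rule nonneg_partial_sums_ennreal[OF _ that HH_sqnorm_partial],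
        simp add: less_imp_le[OF weight_pos(2)], assumption, assumption)+
  have le: "(symbol2 i * coeff2 g i)\<^sup>2 \<le> K * (weight2 i * (coeff2 g i)\<^sup>2)" for g i
    using mult_right_mono[OF K(2), of "(coeff2 g i)\<^sup>2" i]
    by (simp add: power_mult_distrib mult.assoc)
  have sm: "(\<lambda>i. (symbol2 i * coeff2 g i)\<^sup>2) summable_on index2" if "HH_sqnorm Y p g < \<infinity>" for g
    by (rule summable_on_comparison_test[OF summable_on_cmult_right[OF w(1)[OF that]] le]) simp
  show "(\<lambda>i. (symbol2 i * coeff2 g i)\<^sup>2) summable_on index2" by (rule sm[OF assms])
  show "\<exists>C\<ge>0. \<forall>g. HH_sqnorm Y p g < \<infinity> \<longrightarrow>
      ennreal (\<Sum>\<^sub>\<infinity>i\<in>index2. (symbol2 i * coeff2 g i)\<^sup>2) \<le> ennreal C * HH_sqnorm Y p g"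
  proof (intro exI[of _ "K"] conjI allI impI)
    fix g assume g: "HH_sqnorm Y p g < \<infinity>"
    have "(\<Sum>\<^sub>\<infinity>i\<in>index2. (symbol2 i * coeff2 g i)\<^sup>2)
        \<le> (\<Sum>\<^sub>\<infinity>i\<in>index2. K * (weight2 i * (coeff2 g i)\<^sup>2))"
      by (rule infsum_mono[OF sm[OF g] summable_on_cmult_right[OF w(1)[OF g]] le])
    also have "\<dots> = K * (\<Sum>\<^sub>\<infinity>i\<in>index2. weight2 i * (coeff2 g i)\<^sup>2)"
      by (rule infsum_cmult_right) (use w(1)[OF g] in simp)
    finally have "ennreal (\<Sum>\<^sub>\<infinity>i\<in>index2. (symbol2 i * coeff2 g i)\<^sup>2)
        \<le> ennreal (K * (\<Sum>\<^sub>\<infinity>i\<in>index2. weight2 i * (coeff2 g i)\<^sup>2))"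
      by (rule ennreal_leI)
    also have "\<dots> = ennreal K * ennreal (\<Sum>\<^sub>\<infinity>i\<in>index2. weight2 i * (coeff2 g i)\<^sup>2)"
      by (rule ennreal_mult[OF K(1)])
        (intro infsum_nonneg mult_nonneg_nonneg zero_le_power2 less_imp_le[OF weight_pos(2)])
    also have "\<dots> \<le> ennreal K * HH_sqnorm Y p g"
      by (rule mult_left_mono[OF w(2)[OF g]]) simp
    finally show "ennreal (\<Sum>\<^sub>\<infinity>i\<in>index2. (symbol2 i * coeff2 g i)\<^sup>2) \<le> ennreal K * HH_sqnorm Y p g" .
  qed (rule K(1))
qed

definition degrees_below :: "nat \<Rightarrow> (nat \<times> int) set" where
  "degrees_below N = (SIGMA l:{..<N}. orders l)"

lemma degrees_below_subset: "finite (degrees_below N)" "degrees_below N \<subseteq> harmonic_index"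
  by (auto simp: degrees_below_def harmonic_index_def)

text \<open>Connects sums over the index set with the partial sums over degrees \<open>l < N\<close> by which the operator is
defined.\<close>

lemma filterlim_degrees_below: "filterlim degrees_below (finite_subsets_at_top harmonic_index) sequentially"
  unfolding filterlim_iff
proof (intro allI impI)
  fix P assume "\<forall>\<^sub>F X in finite_subsets_at_top harmonic_index. P X"
  then have "\<exists>X. finite X \<and> X \<subseteq> harmonic_index \<and>
      (\<forall>Z. finite Z \<and> X \<subseteq> Z \<and> Z \<subseteq> harmonic_index \<longrightarrow> P Z)"
    by (simp only: eventually_finite_subsets_at_top)
  then obtain X where X: "finite X" "X \<subseteq> harmonic_index"
    "\<forall>Z. finite Z \<and> X \<subseteq> Z \<and> Z \<subseteq> harmonic_index \<longrightarrow> P Z" by (elim exE conjE)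
  obtain N0 where N0: "X \<subseteq> (SIGMA l:{..<N0}. orders l)" using finite_index_bound[OF X(1,2)] .
  have "P (degrees_below N)" if "N0 \<le> N" for N
  proof -
    have "(SIGMA l:{..<N0}. orders l) \<subseteq> degrees_below N" unfolding degrees_below_def using that by (intro Sigma_mono) auto
    then have "X \<subseteq> degrees_below N" by (rule order_trans[OF N0])
    then show ?thesis using X(3) degrees_below_subset[of N] by simp
  qed
  then show "\<forall>\<^sub>F N in sequentially. P (degrees_below N)" unfolding eventually_sequentially by blast
qed

lemma partial_operator_sum:
  "(\<Sum>l<N. D l * (\<Sum>m\<in>orders l. L2_inner sph f (Y l m) * Y l m x))
    = (\<Sum>i\<in>degrees_below N. (symbol i * L2_inner sph f (e i)) * e i x)"
  unfolding degrees_below_def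
  by (simp add: sum.Sigma symbol_def e_def case_prod_beta' sum_distrib_left mult.assoc)

text \<open>The coefficients of any function to which the series converges in norm are forced, so it does not
matter which representative is chosen.\<close>

lemma admissible_op:
  assumes f: "f \<in> H Y p"
  shows "admissible_op Y D f \<in> L2 sph"
    and "i \<in> harmonic_index \<Longrightarrow>
      L2_inner sph (admissible_op Y D f) (e i) = symbol i * L2_inner sph f (e i)"
proof -
  let ?c = "\<lambda>i. symbol i * L2_inner sph f (e i)"
  let ?s = "\<lambda>N x. \<Sum>i\<in>degrees_below N. ?c i * e i x"
  let ?P = "\<lambda>h. h \<in> L2 sph \<and> (\<lambda>N. L2_norm sph (\<lambda>x. h x - ?s N x)) \<longlonglongrightarrow> 0"
  have s: "?s N \<in> L2 sph" for N by (rule finite_expansion_L2[OF degrees_below_subset(2)])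
  obtain h where h: "h \<in> L2 sph" "\<And>i. i \<in> harmonic_index \<Longrightarrow> L2_inner sph h (e i) = ?c i"
    "L2_inner sph h h = (\<Sum>\<^sub>\<infinity>i\<in>harmonic_index. (?c i)\<^sup>2)"
    using Riesz_Fischer[OF H_coefficients_summable[OF f]] by blast
  have "(\<lambda>N. \<Sum>i\<in>degrees_below N. (?c i)\<^sup>2) \<longlonglongrightarrow> L2_inner sph h h"
    unfolding h(3)
    by (rule filterlim_compose[OF infsum_tendsto[OF H_coefficients_summable[OF f]] filterlim_degrees_below])
  then have "(\<lambda>N. L2_inner sph h h - (\<Sum>i\<in>degrees_below N. (?c i)\<^sup>2)) \<longlonglongrightarrow> L2_inner sph h h - L2_inner sph h h"
    by (intro tendsto_diff tendsto_const)
  moreover have "L2_inner sph h h - (\<Sum>i\<in>degrees_below N. (?c i)\<^sup>2) = (L2_norm sph (\<lambda>x. h x - ?s N x))\<^sup>2" for N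
  proof -
    have "L2_inner sph h (?s N) = (\<Sum>i\<in>degrees_below N. ?c i * L2_inner sph h (e i))"
      by (rule inner_finite_expansion[OF degrees_below_subset h(1)])
    also have "\<dots> = (\<Sum>i\<in>degrees_below N. (?c i)\<^sup>2)"
      using degrees_below_subset(2)[of N] by (intro sum.cong refl) (auto simp: h(2) power2_eq_square subset_iff)
    finally have "L2_inner sph h (?s N) = (\<Sum>i\<in>degrees_below N. (?c i)\<^sup>2)" .
    then show ?thesis
      using L2_inner_self_lincomb[OF h(1) s[of N], of 1 "-1"] finite_expansion_norm[OF degrees_below_subset[of N], of ?c]
      by (simp add: L2_norm_squared)
  qed
  ultimately have "(\<lambda>N. (L2_norm sph (\<lambda>x. h x - ?s N x))\<^sup>2) \<longlonglongrightarrow> 0" by simp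
  from tendsto_real_sqrt[OF this] have "?P h"
    using h(1) by (simp add: L2_norm_def L2_inner_self_nonneg)
  then have P: "?P (admissible_op Y D f)"
    unfolding admissible_op_def partial_operator_sum by (rule someI[where P="?P"])
  then show L2: "admissible_op Y D f \<in> L2 sph" by blast
  show "L2_inner sph (admissible_op Y D f) (e i) = ?c i" if i: "i \<in> harmonic_index"
  proof -
    let ?h = "admissible_op Y D f"
    have "(\<lambda>N. (L2_norm sph (\<lambda>x. ?h x - ?s N x))\<^sup>2) \<longlonglongrightarrow> 0\<^sup>2"
      using P by (intro tendsto_power) blast
    then have lim: "(\<lambda>N. L2_inner sph (\<lambda>x. ?h x - ?s N x) (\<lambda>x. ?h x - ?s N x)) \<longlonglongrightarrow> 0"
      by (simp add: L2_norm_squared)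
    have "(\<lambda>N. L2_inner sph (?s N) (e i)) \<longlonglongrightarrow> L2_inner sph ?h (e i)"
      by (rule L2_inner_tendsto[OF s L2 e_L2[OF i] lim])
    moreover have "\<forall>\<^sub>F N in sequentially. L2_inner sph (?s N) (e i) = ?c i"
      using eventually_gt_at_top[of "fst i"]
    proof eventually_elim
      case (elim N)
      then have "i \<in> degrees_below N" using i by (auto simp: degrees_below_def harmonic_index_def)
      then show ?case using finite_expansion_coefficient[OF degrees_below_subset i] by simp
    qed
    then have "(\<lambda>N. L2_inner sph (?s N) (e i)) \<longlonglongrightarrow> ?c i" by (rule tendsto_eventually)
    ultimately show ?thesis by (rule LIMSEQ_unique)
  qed
qed

lemma H_minus: "f \<in> H Y p \<Longrightarrow> (\<lambda>x. - f x) \<in> H Y p"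
  using L2_scale[of f sph "-1"] L2_inner_scale[of sph "-1" f]
  by (simp add: H_def H_sqnorm_def)

lemma HH_sqnorm_tensor:
  assumes "f1 \<in> L2 sph" "f2 \<in> L2 sph"
  shows "HH_sqnorm Y p (tensor f1 f2) = H_sqnorm Y p f1 * H_sqnorm Y p f2"
proof -
  let ?a = "\<lambda>f l. sobolev_weight p l * (\<Sum>m\<in>orders l. (L2_inner sph f (Y l m))\<^sup>2)"
  have nonneg: "0 \<le> ?a f l" for f l
    by (intro mult_nonneg_nonneg sum_nonneg) (simp_all add: less_imp_le[OF sobolev_weight_pos])
  have "sobolev_weight p l * sobolev_weight p l' *
        (\<Sum>m\<in>orders l. \<Sum>m'\<in>orders l'. (L2_inner sph2 (tensor f1 f2) (tensor (Y l m) (Y l' m')))\<^sup>2)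
      = ?a f1 l * ?a f2 l'" for l l'
  proof -
    have "(\<Sum>m\<in>orders l. \<Sum>m'\<in>orders l'. (L2_inner sph2 (tensor f1 f2) (tensor (Y l m) (Y l' m')))\<^sup>2)
        = (\<Sum>m\<in>orders l. \<Sum>m'\<in>orders l'. (L2_inner sph f1 (Y l m))\<^sup>2 * (L2_inner sph f2 (Y l' m'))\<^sup>2)"
      by (intro sum.cong refl) (simp add: tensor_inner[OF finite_measure_sph] assms Y_L2 power_mult_distrib)
    also have "\<dots> = (\<Sum>m\<in>orders l. (L2_inner sph f1 (Y l m))\<^sup>2) * (\<Sum>m'\<in>orders l'. (L2_inner sph f2 (Y l' m'))\<^sup>2)"
      by (simp add: sum_product)
    finally show ?thesis by (simp add: mult.assoc mult.left_commute)
  qed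
  then have "HH_sqnorm Y p (tensor f1 f2) = (\<Sum>l. \<Sum>l'. ennreal (?a f1 l) * ennreal (?a f2 l'))"
    unfolding HH_sqnorm_def by (simp only: ennreal_mult[OF nonneg nonneg])
  then show ?thesis by (simp add: H_sqnorm_def)
qed

lemma HH_sqnorm_lincomb:
  assumes g: "g \<in> L2 sph2" and h: "h \<in> L2 sph2"
  shows "HH_sqnorm Y p (\<lambda>x. a * g x + b * h x)
    \<le> ennreal (2 * a\<^sup>2) * HH_sqnorm Y p g + ennreal (2 * b\<^sup>2) * HH_sqnorm Y p h"
proof -
  let ?t = "\<lambda>g l l'. sobolev_weight p l * sobolev_weight p l' *
    (\<Sum>m\<in>orders l. \<Sum>m'\<in>orders l'. (L2_inner sph2 g (tensor (Y l m) (Y l' m')))\<^sup>2)"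
  have nonneg: "0 \<le> ?t g l l'" for g l l'
    by (intro mult_nonneg_nonneg sum_nonneg) (simp_all add: less_imp_le[OF sobolev_weight_pos])
  have "?t (\<lambda>x. a * g x + b * h x) l l' \<le> 2 * a\<^sup>2 * ?t g l l' + 2 * b\<^sup>2 * ?t h l l'" for l l'
  proof -
    let ?c = "\<lambda>g m m'. L2_inner sph2 g (tensor (Y l m) (Y l' m'))"
    have "(\<Sum>m\<in>orders l. \<Sum>m'\<in>orders l'. (?c (\<lambda>x. a * g x + b * h x) m m')\<^sup>2)
        \<le> (\<Sum>m\<in>orders l. \<Sum>m'\<in>orders l'. 2 * a\<^sup>2 * (?c g m m')\<^sup>2 + 2 * b\<^sup>2 * (?c h m m')\<^sup>2)"
    proof (intro sum_mono)
      fix m m' assume m: "m \<in> orders l" "m' \<in> orders l'"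
      have "?c (\<lambda>x. a * g x + b * h x) m m' = a * ?c g m m' + b * ?c h m m'"
        by (rule L2_inner_lincomb[OF g h tensor_L2[OF finite_measure_sph Y_L2[OF m(1)] Y_L2[OF m(2)]]])
      moreover have "0 \<le> (a * ?c g m m' - b * ?c h m m')\<^sup>2" by simp
      ultimately show "(?c (\<lambda>x. a * g x + b * h x) m m')\<^sup>2 \<le> 2 * a\<^sup>2 * (?c g m m')\<^sup>2 + 2 * b\<^sup>2 * (?c h m m')\<^sup>2"
        by (simp add: power2_eq_square algebra_simps)
    qed
    also have "\<dots> = 2 * a\<^sup>2 * (\<Sum>m\<in>orders l. \<Sum>m'\<in>orders l'. (?c g m m')\<^sup>2)
        + 2 * b\<^sup>2 * (\<Sum>m\<in>orders l. \<Sum>m'\<in>orders l'. (?c h m m')\<^sup>2)"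
      by (simp only: sum.distrib sum_distrib_left)
    finally have "?t (\<lambda>x. a * g x + b * h x) l l' \<le> sobolev_weight p l * sobolev_weight p l' * \<dots>"
      by (rule mult_left_mono) (simp add: less_imp_le[OF sobolev_weight_pos])
    then show ?thesis by (simp only: distrib_left mult.left_commute)
  qed
  then have "HH_sqnorm Y p (\<lambda>x. a * g x + b * h x)
      \<le> (\<Sum>l. \<Sum>l'. ennreal (2 * a\<^sup>2 * ?t g l l' + 2 * b\<^sup>2 * ?t h l l'))"
    unfolding HH_sqnorm_def by (intro suminf_le ennreal_leI) auto
  also have "\<dots> = (\<Sum>l. \<Sum>l'. ennreal (2 * a\<^sup>2) * ennreal (?t g l l') + ennreal (2 * b\<^sup>2) * ennreal (?t h l l'))"
  proof -
    have "ennreal (2 * a\<^sup>2 * ?t g l l' + 2 * b\<^sup>2 * ?t h l l')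
        = ennreal (2 * a\<^sup>2) * ennreal (?t g l l') + ennreal (2 * b\<^sup>2) * ennreal (?t h l l')" for l l'
      proof -
      have "0 \<le> 2 * a\<^sup>2" "0 \<le> 2 * b\<^sup>2" by simp_all
      then show ?thesis
        by (simp only: ennreal_plus[OF mult_nonneg_nonneg[OF _ nonneg] mult_nonneg_nonneg[OF _ nonneg]]
            ennreal_mult[OF _ nonneg])
    qed
    then show ?thesis by (simp only:)
  qed
  also have "\<dots> = ennreal (2 * a\<^sup>2) * HH_sqnorm Y p g + ennreal (2 * b\<^sup>2) * HH_sqnorm Y p h"
    unfolding HH_sqnorm_def by (simp add: suminf_add[symmetric] summableI)
  finally show ?thesis .
qed

lemma HH_sqnorm_lincomb_finite:
  assumes "g \<in> L2 sph2" "h \<in> L2 sph2" "HH_sqnorm Y p g < \<infinity>" "HH_sqnorm Y p h < \<infinity>"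
  shows "HH_sqnorm Y p (\<lambda>x. a * g x + b * h x) < \<infinity>"
proof (rule le_less_trans[OF HH_sqnorm_lincomb[OF assms(1,2)]])
  show "ennreal (2 * a\<^sup>2) * HH_sqnorm Y p g + ennreal (2 * b\<^sup>2) * HH_sqnorm Y p h < \<infinity>"
    using assms(3,4) by (simp add: ennreal_mult_less_top)
qed

lemma algebraic_finite:
  assumes "s \<in> algebraic_tensor_product (H Y p) (H Y p)"
  shows "s \<in> L2 sph2 \<and> HH_sqnorm Y p s < \<infinity>"
proof -
  obtain a b N where s: "s = (\<lambda>x. \<Sum>i<N. tensor (a i) (b i) x)"
    and ab: "\<And>i. i < (N::nat) \<Longrightarrow> a i \<in> H Y p \<and> b i \<in> H Y p"
    using assms unfolding algebraic_tensor_product_def by blast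
  have "(\<lambda>x. \<Sum>i<n. tensor (a i) (b i) x) \<in> L2 sph2
      \<and> HH_sqnorm Y p (\<lambda>x. \<Sum>i<n. tensor (a i) (b i) x) < \<infinity>" if "n \<le> N" for n
    using that
  proof (induction n)
    case 0
    show ?case by (simp add: L2_zero HH_sqnorm_def L2_inner_def)
  next
    case (Suc n)
    let ?s = "\<lambda>x. \<Sum>i<n. tensor (a i) (b i) x"
    have ab': "a n \<in> L2 sph" "b n \<in> L2 sph" "H_sqnorm Y p (a n) < \<infinity>" "H_sqnorm Y p (b n) < \<infinity>"
      using ab[of n] Suc.prems by (auto simp: H_def)
    have t: "tensor (a n) (b n) \<in> L2 sph2" "HH_sqnorm Y p (tensor (a n) (b n)) < \<infinity>"
      using ab' by (auto simp: HH_sqnorm_tensor ennreal_mult_less_top intro!: tensor_L2 finite_measure_sph)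
    have IH: "?s \<in> L2 sph2" "HH_sqnorm Y p ?s < \<infinity>" using Suc by auto
    show ?case
      using L2_add[OF IH(1) t(1)] HH_sqnorm_lincomb_finite[OF IH(1) t(1) IH(2) t(2), of 1 1] by simp
  qed
  then show ?thesis by (simp add: s)
qed

lemma HH_finite:
  assumes "g \<in> HH Y p"
  shows "g \<in> L2 sph2" "HH_sqnorm Y p g < \<infinity>"
proof -
  show g: "g \<in> L2 sph2" using assms by (simp add: HH_def)
  obtain s where s: "\<And>N. s N \<in> algebraic_tensor_product (H Y p) (H Y p)"
    "(\<lambda>N::nat. HH_sqnorm Y p (\<lambda>x. g x - s N x)) \<longlonglongrightarrow> 0"
    using assms unfolding HH_def by blast
  have "\<forall>\<^sub>F N in sequentially. HH_sqnorm Y p (\<lambda>x. g x - s N x) < \<infinity>"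
    by (rule order_tendstoD(2)[OF s(2)]) simp
  then obtain N where N: "HH_sqnorm Y p (\<lambda>x. g x - s N x) < \<infinity>"
    by (auto simp: eventually_sequentially)
  note sN = algebraic_finite[OF s(1)[of N]]
  have "HH_sqnorm Y p (\<lambda>x. 1 * (g x - s N x) + 1 * s N x) < \<infinity>"
    by (rule HH_sqnorm_lincomb_finite[OF L2_diff[OF g]]) (use sN N in auto)
  then show "HH_sqnorm Y p g < \<infinity>" by simp
qed

text \<open>The remainders belong to the Hilbert tensor product as well. This makes the continuity bound for the
tensor operator applicable to them.\<close>

lemma HH_approximation:
  assumes g: "g \<in> HH Y p"
  obtains s where "\<And>N. s N \<in> algebraic_tensor_product (H Y p) (H Y p)"
    "(\<lambda>N::nat. HH_sqnorm Y p (\<lambda>x. g x - s N x)) \<longlonglongrightarrow> 0"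
    "\<And>N. (\<lambda>x. g x - s N x) \<in> HH Y p"
proof -
  obtain s where s: "\<And>N. s N \<in> algebraic_tensor_product (H Y p) (H Y p)"
    "(\<lambda>N::nat. HH_sqnorm Y p (\<lambda>x. g x - s N x)) \<longlonglongrightarrow> 0"
    using g unfolding HH_def by blast
  have "(\<lambda>x. g x - s N x) \<in> HH Y p" for N
    unfolding HH_def
  proof (intro CollectI conjI exI[of _ "\<lambda>M x. s M x - s N x"] allI)
    show "(\<lambda>x. g x - s N x) \<in> L2 sph2"
      using HH_finite(1)[OF g] algebraic_finite[OF s(1)] by (intro L2_diff) auto
    show "(\<lambda>x. s M x - s N x) \<in> algebraic_tensor_product (H Y p) (H Y p)" for M
      by (rule algebraic_tensor_product_minus[OF H_minus s(1) s(1)])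
    show "(\<lambda>M. HH_sqnorm Y p (\<lambda>x. (g x - s N x) - (s M x - s N x))) \<longlonglongrightarrow> 0"
      using s(2) by simp
  qed
  with s show ?thesis by (rule that)
qed

lemma algebraic_HH:
  assumes "s \<in> algebraic_tensor_product (H Y p) (H Y p)"
  shows "s \<in> HH Y p"
proof -
  have "HH_sqnorm Y p (\<lambda>x. s x - s x) = 0" by (simp add: HH_sqnorm_def L2_inner_def)
  then show ?thesis
    using assms algebraic_finite[OF assms] unfolding HH_def
    by (intro CollectI conjI exI[of _ "\<lambda>N. s"]) auto
qed

text \<open>The operator is defined by multiplying Fourier coefficients, using the Riesz-Fischer theorem on \<open>S2 \<times> S2\<close>.\<close>

lemma tensor_op_exists: "\<exists>T. is_tensor_op Y p D T"
proof -
  define T where "T g = (SOME F. F \<in> L2 sph2 \<and> (\<forall>i\<in>index2. coeff2 F i = symbol2 i * coeff2 g i))" for g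
  have T: "T g \<in> L2 sph2" "\<And>i. i \<in> index2 \<Longrightarrow> coeff2 (T g) i = symbol2 i * coeff2 g i"
    if g: "HH_sqnorm Y p g < \<infinity>" for g
  proof -
    obtain F where "F \<in> L2 sph2" "\<And>i. i \<in> index2 \<Longrightarrow> coeff2 F i = symbol2 i * coeff2 g i"
      using T.Riesz_Fischer[OF HH_coefficients_summable(1)[OF g]] by blast
    then have "\<exists>F. F \<in> L2 sph2 \<and> (\<forall>i\<in>index2. coeff2 F i = symbol2 i * coeff2 g i)" by blast
    from someI_ex[OF this]
    show "T g \<in> L2 sph2" "\<And>i. i \<in> index2 \<Longrightarrow> coeff2 (T g) i = symbol2 i * coeff2 g i"
      by (auto simp: T_def)
  qed
  have "is_tensor_op Y p D T"
    unfolding is_tensor_op_def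
  proof (intro conjI ballI allI)
    show "T g \<in> L2 sph2" if "g \<in> HH Y p" for g
      by (rule T(1)[OF HH_finite(2)[OF that]])
  next
    fix g h a b assume "g \<in> HH Y p" "h \<in> HH Y p"
    note g = HH_finite[OF this(1)] and h = HH_finite[OF this(2)]
    have gh: "HH_sqnorm Y p (\<lambda>y. a * g y + b * h y) < \<infinity>"
      by (rule HH_sqnorm_lincomb_finite[OF g(1) h(1) g(2) h(2)])
    show "AE x in sph2. T (\<lambda>y. a * g y + b * h y) x = a * T g x + b * T h x"
    proof (rule T.coefficients_determine[OF T(1)[OF gh] L2_lincomb[OF T(1)[OF g(2)] T(1)[OF h(2)]]])
      fix i assume i: "i \<in> index2"
      show "coeff2 (T (\<lambda>y. a * g y + b * h y)) i = coeff2 (\<lambda>x. a * T g x + b * T h x) i"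
        using T(2)[OF gh i] T(2)[OF g(2) i] T(2)[OF h(2) i]
          L2_inner_lincomb[OF T(1)[OF g(2)] T(1)[OF h(2)] T.e_L2[OF i], of a b]
          L2_inner_lincomb[OF g(1) h(1) T.e_L2[OF i], of a b]
        by (simp add: algebra_simps)
    qed
  next
    have "HH_sqnorm Y p (\<lambda>x. 0) < \<infinity>" by (simp add: HH_sqnorm_def L2_inner_def)
    from HH_coefficients_summable(2)[OF this] obtain C where C: "0 \<le> C"
      "\<And>g. HH_sqnorm Y p g < \<infinity> \<Longrightarrow>
        ennreal (\<Sum>\<^sub>\<infinity>i\<in>index2. (symbol2 i * coeff2 g i)\<^sup>2) \<le> ennreal C * HH_sqnorm Y p g"
      by blast
    have "ennreal ((L2_norm sph2 (T g))\<^sup>2) \<le> ennreal C * HH_sqnorm Y p g" if "g \<in> HH Y p" for g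
    proof -
      note g = HH_finite[OF that]
      have "(L2_norm sph2 (T g))\<^sup>2 = (\<Sum>\<^sub>\<infinity>i\<in>index2. (coeff2 (T g) i)\<^sup>2)"
        by (simp only: L2_norm_squared T.Parseval[OF T(1)[OF g(2)]])
      also have "\<dots> = (\<Sum>\<^sub>\<infinity>i\<in>index2. (symbol2 i * coeff2 g i)\<^sup>2)"
        by (rule infsum_cong) (simp only: T(2)[OF g(2)])
      finally show ?thesis using C(2)[OF g(2)] by simp
    qed
    with C(1) show "\<exists>C\<ge>0. \<forall>g\<in>HH Y p. ennreal ((L2_norm sph2 (T g))\<^sup>2) \<le> ennreal C * HH_sqnorm Y p g"
      by blast
  next
    fix f1 f2 assume f: "f1 \<in> H Y p" "f2 \<in> H Y p"
    then have f': "f1 \<in> L2 sph" "f2 \<in> L2 sph" "H_sqnorm Y p f1 < \<infinity>" "H_sqnorm Y p f2 < \<infinity>"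
      by (auto simp: H_def)
    then have fin: "HH_sqnorm Y p (tensor f1 f2) < \<infinity>"
      by (simp add: HH_sqnorm_tensor ennreal_mult_less_top)
    note Df = admissible_op(1)[OF f(1)] admissible_op(1)[OF f(2)]
    show "AE x in sph2. T (tensor f1 f2) x = tensor (admissible_op Y D f1) (admissible_op Y D f2) x"
    proof (rule T.coefficients_determine[OF T(1)[OF fin] tensor_L2[OF finite_measure_sph Df]])
      fix i assume i: "i \<in> index2"
      obtain j k where jk: "i = (j, k)" "j \<in> harmonic_index" "k \<in> harmonic_index"
        using i by (rule SigmaE)
      have "coeff2 (tensor g1 g2) i = L2_inner sph g1 (e j) * L2_inner sph g2 (e k)"
        if "g1 \<in> L2 sph" "g2 \<in> L2 sph" for g1 g2
        using tensor_inner[OF finite_measure_sph that e_L2[OF jk(2)] e_L2[OF jk(3)]]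
        by (simp add: jk(1) tensor_family_def)
      note coeff = this[OF f'(1,2)] this[OF Df]
      show "coeff2 (T (tensor f1 f2)) i
          = coeff2 (tensor (admissible_op Y D f1) (admissible_op Y D f2)) i"
        unfolding T(2)[OF fin i] coeff admissible_op(2)[OF f(1) jk(2)] admissible_op(2)[OF f(2) jk(3)]
        by (simp add: symbol2_def jk(1))
    qed
  qed
  then show ?thesis by blast
qed

text \<open>On elementary tensors the coefficients are products; linearity extends this to finite sums.\<close>

lemma tensor_op_coefficients_algebraic:
  assumes T: "is_tensor_op Y p D T" and s: "s \<in> algebraic_tensor_product (H Y p) (H Y p)"
    and i: "i \<in> index2"
  shows "coeff2 (T s) i = symbol2 i * coeff2 s i"
proof -
  have T_L2: "\<And>g. g \<in> HH Y p \<Longrightarrow> T g \<in> L2 sph2"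
    and T_lin: "\<And>g h a b. g \<in> HH Y p \<Longrightarrow> h \<in> HH Y p \<Longrightarrow>
        AE x in sph2. T (\<lambda>y. a * g y + b * h y) x = a * T g x + b * T h x"
    and T_tensor: "\<And>f1 f2. f1 \<in> H Y p \<Longrightarrow> f2 \<in> H Y p \<Longrightarrow>
        AE x in sph2. T (tensor f1 f2) x = tensor (admissible_op Y D f1) (admissible_op Y D f2) x"
    using T unfolding is_tensor_op_def by blast+
  have coeff_AE: "coeff2 f i = coeff2 g i" if "f \<in> L2 sph2" "g \<in> L2 sph2" "AE x in sph2. f x = g x" for f g
    using that T.e_L2[OF i] by (intro L2_inner_cong_AE) (auto dest: L2_D)
  obtain a b N where s: "s = (\<lambda>x. \<Sum>i<N. tensor (a i) (b i) x)"
    and ab: "\<And>i. i < (N::nat) \<Longrightarrow> a i \<in> H Y p \<and> b i \<in> H Y p"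
    using s unfolding algebraic_tensor_product_def by blast
  obtain j k where jk: "i = (j, k)" "j \<in> harmonic_index" "k \<in> harmonic_index"
    using i by (rule SigmaE)
  have alg: "(\<lambda>x. \<Sum>i<n. tensor (a i) (b i) x) \<in> HH Y p" if "n \<le> N" for n
    by (rule algebraic_HH) (use that ab in \<open>force simp: algebraic_tensor_product_def\<close>)
  have "coeff2 (T (\<lambda>x. \<Sum>i<n. tensor (a i) (b i) x)) i
      = symbol2 i * coeff2 (\<lambda>x. \<Sum>i<n. tensor (a i) (b i) x) i" if "n \<le> N" for n
    using that
  proof (induction n)
    case 0
    have z: "(\<lambda>x. 0) \<in> HH Y p" using alg[of 0] by simp
    have "coeff2 (T (\<lambda>x. 0)) i = coeff2 (\<lambda>x. 0) i"
      using T_lin[OF z z, of 0 0] by (intro coeff_AE T_L2 z L2_zero) simp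
    then show ?case by (simp add: L2_inner_def)
  next
    case (Suc n)
    let ?s = "\<lambda>x. \<Sum>i<n. tensor (a i) (b i) x" and ?t = "tensor (a n) (b n)"
    have sH: "?s \<in> HH Y p" using alg Suc.prems by simp
    have H: "a n \<in> H Y p" "b n \<in> H Y p" using ab[of n] Suc.prems by auto
    have HL: "a n \<in> L2 sph" "b n \<in> L2 sph" using H by (auto simp: H_def)
    have tH: "?t \<in> HH Y p"
    proof (rule algebraic_HH)
      have "?t = (\<lambda>x. \<Sum>i<(1::nat). tensor (a n) (b n) x)" by simp
      then show "?t \<in> algebraic_tensor_product (H Y p) (H Y p)"
        unfolding algebraic_tensor_product_def using H
        by (intro CollectI exI[of _ "\<lambda>i. a n"] exI[of _ "\<lambda>i. b n"] exI[of _ "1::nat"]) simp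
    qed
    note Da = admissible_op(1)[OF H(1)] admissible_op(1)[OF H(2)]
    have coeff: "coeff2 (tensor g1 g2) i = L2_inner sph g1 (e j) * L2_inner sph g2 (e k)"
      if "g1 \<in> L2 sph" "g2 \<in> L2 sph" for g1 g2
      using tensor_inner[OF finite_measure_sph that e_L2[OF jk(2)] e_L2[OF jk(3)]]
      by (simp add: jk(1) tensor_family_def)
    have "coeff2 (T ?t) i = coeff2 (tensor (admissible_op Y D (a n)) (admissible_op Y D (b n))) i"
      by (rule coeff_AE[OF T_L2[OF tH] tensor_L2[OF finite_measure_sph Da] T_tensor[OF H]])
    also have "\<dots> = symbol2 i * coeff2 ?t i"
      unfolding coeff[OF Da] coeff[OF HL] admissible_op(2)[OF H(1) jk(2)] admissible_op(2)[OF H(2) jk(3)]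
      by (simp add: symbol2_def jk(1))
    finally have Tt: "coeff2 (T ?t) i = symbol2 i * coeff2 ?t i" .
    have sumH: "(\<lambda>y. 1 * ?s y + 1 * ?t y) \<in> HH Y p"
      using alg[OF Suc.prems] by simp
    have "coeff2 (T (\<lambda>y. 1 * ?s y + 1 * ?t y)) i = coeff2 (\<lambda>x. 1 * T ?s x + 1 * T ?t x) i"
      by (rule coeff_AE[OF T_L2[OF sumH] L2_lincomb[OF T_L2[OF sH] T_L2[OF tH]] T_lin[OF sH tH]])
    also have "\<dots> = 1 * coeff2 (T ?s) i + 1 * coeff2 (T ?t) i"
      by (rule L2_inner_lincomb[OF T_L2[OF sH] T_L2[OF tH] T.e_L2[OF i]])
    also have "\<dots> = symbol2 i * (1 * coeff2 ?s i + 1 * coeff2 ?t i)"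
      using Suc Tt by (simp add: distrib_left)
    also have "1 * coeff2 ?s i + 1 * coeff2 ?t i = coeff2 (\<lambda>y. 1 * ?s y + 1 * ?t y) i"
      by (rule L2_inner_lincomb[OF HH_finite(1)[OF sH] HH_finite(1)[OF tH] T.e_L2[OF i], symmetric])
    finally show ?case by simp
  qed
  then show ?thesis by (simp add: s)
qed

text \<open>Both sides depend continuously on \<open>g\<close>, and finite sums of elementary tensors are dense.\<close>

lemma tensor_op_coefficients:
  assumes T: "is_tensor_op Y p D T" and g: "g \<in> HH Y p" and i: "i \<in> index2"
  shows "coeff2 (T g) i = symbol2 i * coeff2 g i"
proof -
  have T_L2: "\<And>g. g \<in> HH Y p \<Longrightarrow> T g \<in> L2 sph2"
    and T_lin: "\<And>g h a b. g \<in> HH Y p \<Longrightarrow> h \<in> HH Y p \<Longrightarrow>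
        AE x in sph2. T (\<lambda>y. a * g y + b * h y) x = a * T g x + b * T h x"
    using T unfolding is_tensor_op_def by blast+
  obtain C where C: "0 \<le> C"
    "\<And>g. g \<in> HH Y p \<Longrightarrow> ennreal ((L2_norm sph2 (T g))\<^sup>2) \<le> ennreal C * HH_sqnorm Y p g"
    using T unfolding is_tensor_op_def by blast
  obtain s where s: "\<And>N. s N \<in> algebraic_tensor_product (H Y p) (H Y p)"
    "(\<lambda>N::nat. HH_sqnorm Y p (\<lambda>x. g x - s N x)) \<longlonglongrightarrow> 0"
    "\<And>N. (\<lambda>x. g x - s N x) \<in> HH Y p"
    using HH_approximation[OF g] by blast
  have sH: "s N \<in> HH Y p" for N by (rule algebraic_HH[OF s(1)])
  have norm0: "(\<lambda>N. (coeff2 g i - coeff2 (s N) i)\<^sup>2) \<longlonglongrightarrow> 0"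
    and normT: "(\<lambda>N. (coeff2 (T g) i - coeff2 (T (s N)) i)\<^sup>2) \<longlonglongrightarrow> 0"
  proof -
    have "(\<lambda>N. ennreal C * HH_sqnorm Y p (\<lambda>x. g x - s N x)) \<longlonglongrightarrow> ennreal C * 0"
      by (rule tendsto_mult_ennreal[OF tendsto_const s(2)]) simp
    then have lim: "(\<lambda>N. ennreal C * HH_sqnorm Y p (\<lambda>x. g x - s N x)) \<longlonglongrightarrow> 0" by simp
    have "(coeff2 (T g) i - coeff2 (T (s N)) i)\<^sup>2 \<le> (L2_norm sph2 (T (\<lambda>x. g x - s N x)))\<^sup>2" for N
    proof -
      have "AE x in sph2. T (\<lambda>x. g x - s N x) x = 1 * T g x + (-1) * T (s N) x"
        using T_lin[OF g sH, of 1 "-1" N] by simp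
      then have "coeff2 (T (\<lambda>x. g x - s N x)) i = coeff2 (\<lambda>x. 1 * T g x + (-1) * T (s N) x) i"
        using T_L2[OF s(3)] L2_lincomb[OF T_L2[OF g] T_L2[OF sH[of N]], of 1 "-1"] T.e_L2[OF i]
        by (intro L2_inner_cong_AE) (auto dest: L2_D)
      also have "\<dots> = coeff2 (T g) i - coeff2 (T (s N)) i"
        using L2_inner_lincomb[OF T_L2[OF g] T_L2[OF sH[of N]] T.e_L2[OF i], of 1 "-1"] by simp
      finally have "coeff2 (T g) i - coeff2 (T (s N)) i = coeff2 (T (\<lambda>x. g x - s N x)) i" ..
      then show ?thesis
        using L2_Cauchy_Schwarz[OF T_L2[OF s(3)[of N]] T.e_L2[OF i]] T.orthonormal[OF i i]
        by (simp add: L2_norm_squared)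
    qed
    then have "ennreal ((coeff2 (T g) i - coeff2 (T (s N)) i)\<^sup>2) \<le> ennreal C * HH_sqnorm Y p (\<lambda>x. g x - s N x)" for N
      using C(2)[OF s(3)[of N]] by (meson ennreal_leI order_trans)
    then show "(\<lambda>N. (coeff2 (T g) i - coeff2 (T (s N)) i)\<^sup>2) \<longlonglongrightarrow> 0"
      by (rule tendsto_zero_of_ennreal_bound[OF _ lim]) simp
    have eq: "(coeff2 g i - coeff2 (s N) i)\<^sup>2 = (1 / weight2 i) * (weight2 i * (coeff2 (\<lambda>x. g x - s N x) i)\<^sup>2)" for N
      using L2_inner_diff[OF HH_finite(1)[OF g] HH_finite(1)[OF sH[of N]] T.e_L2[OF i]]
        weight_pos(2)[of i] by simp
    have "(\<lambda>N. weight2 i * (coeff2 (\<lambda>x. g x - s N x) i)\<^sup>2) \<longlonglongrightarrow> 0"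
    proof -
      have "ennreal (weight2 i * (coeff2 (\<lambda>x. g x - s N x) i)\<^sup>2) \<le> HH_sqnorm Y p (\<lambda>x. g x - s N x)" for N
        using HH_sqnorm_partial[of "{i}" "\<lambda>x. g x - s N x"] i by simp
      then show ?thesis
        by (rule tendsto_zero_of_ennreal_bound[OF _ s(2)])
          (intro mult_nonneg_nonneg less_imp_le[OF weight_pos(2)] zero_le_power2)
    qed
    then have "(\<lambda>N. (1 / weight2 i) * (weight2 i * (coeff2 (\<lambda>x. g x - s N x) i)\<^sup>2)) \<longlonglongrightarrow> (1 / weight2 i) * 0"
      by (intro tendsto_mult tendsto_const)
    then show "(\<lambda>N. (coeff2 g i - coeff2 (s N) i)\<^sup>2) \<longlonglongrightarrow> 0"
      by (simp only: eq mult_zero_right)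
  qed
  have sqrt_lim: "f \<longlonglongrightarrow> c" if "(\<lambda>N. (c - f N)\<^sup>2) \<longlonglongrightarrow> 0" for f :: "nat \<Rightarrow> real" and c
  proof -
    from tendsto_real_sqrt[OF that] have "(\<lambda>N. \<bar>c - f N\<bar>) \<longlonglongrightarrow> 0" by simp
    then have "(\<lambda>N. c - f N) \<longlonglongrightarrow> 0" by (simp only: tendsto_rabs_zero_iff)
    then have "(\<lambda>N. c - (c - f N)) \<longlonglongrightarrow> c - 0" by (intro tendsto_diff tendsto_const)
    then show ?thesis by simp
  qed
  have "(\<lambda>N. symbol2 i * coeff2 (s N) i) \<longlonglongrightarrow> symbol2 i * coeff2 g i"
    by (intro tendsto_mult tendsto_const sqrt_lim[OF norm0])
  then have "(\<lambda>N. coeff2 (T (s N)) i) \<longlonglongrightarrow> symbol2 i * coeff2 g i"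
    by (simp only: tensor_op_coefficients_algebraic[OF T s(1) i])
  with sqrt_lim[OF normT] show ?thesis by (rule LIMSEQ_unique)
qed

text \<open>The penalty of the optimization problem is the energy of the reproducing kernel Hilbert space.\<close>

theorem tensor_op_energy:
  assumes g: "g \<in> HH Y p"
  shows "T.finite_energy g" "(L2_norm sph2 (tensor_op Y p D g))\<^sup>2 = T.energy g"
proof -
  have T: "is_tensor_op Y p D (tensor_op Y p D)"
    unfolding tensor_op_def by (rule someI_ex[OF tensor_op_exists])
  show "T.finite_energy g"
    using HH_coefficients_summable(1)[OF HH_finite(2)[OF g]]
    unfolding T.finite_energy_def energy_weight by (simp only: power_mult_distrib)
  have "(L2_norm sph2 (tensor_op Y p D g))\<^sup>2 = (\<Sum>\<^sub>\<infinity>i\<in>index2. (coeff2 (tensor_op Y p D g) i)\<^sup>2)"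
    unfolding L2_norm_squared by (rule T.Parseval) (use T g in \<open>auto simp: is_tensor_op_def\<close>)
  also have "\<dots> = (\<Sum>\<^sub>\<infinity>i\<in>index2. (symbol2 i)\<^sup>2 * (coeff2 g i)\<^sup>2)"
    by (rule infsum_cong) (simp only: tensor_op_coefficients[OF T g] power_mult_distrib)
  finally show "(L2_norm sph2 (tensor_op Y p D g))\<^sup>2 = T.energy g"
    unfolding T.energy_def energy_weight .
qed

text \<open>Its coefficients are \<open>Y l m u / D\<^sub>l\<^sup>2\<close>; one factor \<open>D\<^sub>l\<^sup>2\<close> compensates the Sobolev weight and the other
makes the series converge, by the addition theorem.\<close>

lemma kernel_in_H:
  assumes u: "u \<in> S2"
  shows "kernel u \<in> H Y p"
proof -
  obtain K where K: "0 < K" "\<And>l. sobolev_weight p l \<le> K * (D l)\<^sup>2"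
    using admissible_weight_bounds(2)[OF adm] by blast
  let ?b = "\<lambda>l. (2 * real l + 1) / (4 * pi) / (D l)\<^sup>2"
  have "H_sqnorm Y p (kernel u) \<le> (\<Sum>l. ennreal (K * ?b l))"
    unfolding H_sqnorm_def
  proof (intro suminf_le ennreal_leI)
    fix l
    have "(\<Sum>m\<in>orders l. (L2_inner sph (kernel u) (Y l m))\<^sup>2) = (\<Sum>m\<in>orders l. Y l m u * Y l m u / ((D l)\<^sup>2)\<^sup>2)"
    proof (rule sum.cong[OF refl])
      fix m assume "m \<in> orders l"
      then show "(L2_inner sph (kernel u) (Y l m))\<^sup>2 = Y l m u * Y l m u / ((D l)\<^sup>2)\<^sup>2"
        using kernel_section(2)[of u "(l, m)"] u
        by (simp add: e_def harmonic_index_def power_divide power2_eq_square)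
    qed
    also have "\<dots> = ?b l / (D l)\<^sup>2"
      using addition_theorem[OF u, of l]
      by (simp add: zonal_def sum_divide_distrib[symmetric] power2_eq_square)
    finally have "sobolev_weight p l * (\<Sum>m\<in>orders l. (L2_inner sph (kernel u) (Y l m))\<^sup>2)
        \<le> K * (D l)\<^sup>2 * (?b l / (D l)\<^sup>2)"
      using K(2)[of l] by (simp only:) (intro mult_right_mono, auto)
    also have "\<dots> = K * ?b l" using E_pos[of l] by simp
    finally show "sobolev_weight p l * (\<Sum>m\<in>orders l. (L2_inner sph (kernel u) (Y l m))\<^sup>2) \<le> K * ?b l" .
  qed auto
  also have "\<dots> = ennreal (\<Sum>l. K * ?b l)"
    using K(1) by (intro suminf_ennreal2 summable_mult E_summable) simp
  also have "\<dots> < \<infinity>" by simp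
  finally have "H_sqnorm Y p (kernel u) < \<infinity>" .
  moreover have "kernel u \<in> L2 sph"
    using kernel_section(1)[of u] u by (intro continuous_L2) auto
  ultimately show ?thesis by (simp add: H_def)
qed

end

section \<open>Regularised linear systems\<close>

text \<open>Pairing the equations with \<open>b\<close> gives \<open>c * \<Sum> (b t)\<^sup>2 \<le> 0\<close>.\<close>

lemma regularised_system_injective:
  fixes G :: "'t \<Rightarrow> 't \<Rightarrow> real"
  assumes psd: "\<And>b. 0 \<le> (\<Sum>t\<in>T. b t * (\<Sum>s\<in>T. G t s * b s))" and c: "0 < c"
    and T: "finite T" and zero: "\<And>t. t \<in> T \<Longrightarrow> (\<Sum>s\<in>T. G t s * b s) + c * b t = 0" and t: "t \<in> T"
  shows "b t = 0"
proof -
  have "0 = (\<Sum>t\<in>T. b t * ((\<Sum>s\<in>T. G t s * b s) + c * b t))"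
    using zero by simp
  also have "\<dots> = (\<Sum>t\<in>T. b t * (\<Sum>s\<in>T. G t s * b s)) + c * (\<Sum>t\<in>T. (b t)\<^sup>2)"
    by (simp add: distrib_left sum.distrib sum_distrib_left power2_eq_square mult.left_commute)
  finally have "c * (\<Sum>t\<in>T. (b t)\<^sup>2) \<le> 0" using psd[of b] by linarith
  then have "(\<Sum>t\<in>T. (b t)\<^sup>2) \<le> 0" using c by (simp add: mult_le_0_iff)
  then have "(\<Sum>t\<in>T. (b t)\<^sup>2) = 0" by (intro antisym sum_nonneg) auto
  then show ?thesis using T t by (simp add: sum_nonneg_eq_0_iff)
qed

text \<open>Treat the right-hand side as a column with one further unknown. The enlarged homogeneous system has a
nontrivial solution, and injectivity shows that the further unknown is not zero in it.\<close>

lemma regularised_system_solvable: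
  fixes G :: "'t \<Rightarrow> 't \<Rightarrow> real"
  assumes psd: "\<And>b. 0 \<le> (\<Sum>t\<in>T. b t * (\<Sum>s\<in>T. G t s * b s))" and c: "0 < c" and T: "finite T"
  shows "\<exists>b. \<forall>t\<in>T. (\<Sum>s\<in>T. G t s * b s) + c * b t = z t"
proof -
  define U where "U = insert None (Some ` T)"
  define a where "a t u = (case u of None \<Rightarrow> - z t | Some s \<Rightarrow> G t s + (if s = t then c else 0))" for t u
  have "card U = Suc (card T)"
    unfolding U_def using T by (subst card_insert_disjoint) (auto simp: card_image)
  then obtain \<xi> where \<xi>: "\<exists>u\<in>U. \<xi> u \<noteq> 0" "\<forall>t\<in>T. (\<Sum>u\<in>U. a t u * \<xi> u) = 0"
    using underdetermined_linear_system[of T U a] T by (auto simp: U_def)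
  have sumU: "(\<Sum>s\<in>T. G t s * \<xi> (Some s)) + c * \<xi> (Some t) = z t * \<xi> None" if t: "t \<in> T" for t
  proof -
    have "0 = (\<Sum>u\<in>U. a t u * \<xi> u)" using \<xi>(2) t by simp
    also have "\<dots> = - z t * \<xi> None + (\<Sum>s\<in>T. a t (Some s) * \<xi> (Some s))"
      unfolding U_def using T by (subst sum.insert) (auto simp: a_def sum.reindex)
    also have "(\<Sum>s\<in>T. a t (Some s) * \<xi> (Some s))
        = (\<Sum>s\<in>T. G t s * \<xi> (Some s) + (if s = t then c * \<xi> (Some s) else 0))"
      by (intro sum.cong refl) (simp add: a_def distrib_right)
    also have "\<dots> = (\<Sum>s\<in>T. G t s * \<xi> (Some s)) + c * \<xi> (Some t)"
      using T t by (simp add: sum.distrib)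
    finally show ?thesis by simp
  qed
  have ne: "\<xi> None \<noteq> 0"
  proof
    assume 0: "\<xi> None = 0"
    have "\<xi> (Some t) = 0" if "t \<in> T" for t
      by (rule regularised_system_injective[where T=T and G=G and c=c and b="\<lambda>t. \<xi> (Some t)", OF psd c T _ that])
        (simp add: sumU 0)
    with 0 \<xi>(1) show False by (auto simp: U_def)
  qed
  show ?thesis
  proof (intro exI[of _ "\<lambda>t. \<xi> (Some t) / \<xi> None"] ballI)
    fix t assume "t \<in> T"
    then have "(\<Sum>s\<in>T. G t s * (\<xi> (Some s) / \<xi> None)) + c * (\<xi> (Some t) / \<xi> None)
        = (z t * \<xi> None) / \<xi> None"
      by (simp add: sumU[symmetric] add_divide_distrib sum_divide_distrib)
    then show "(\<Sum>s\<in>T. G t s * (\<xi> (Some s) / \<xi> None)) + c * (\<xi> (Some t) / \<xi> None) = z t"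
      using ne by simp
  qed
qed

text \<open>Transfers the system over \<open>T\<close> to matrices along an arbitrary enumeration \<open>\<tau>\<close>. The solution \<open>b\<close> does not
refer to \<open>\<tau>\<close>, so one family of coefficients serves all enumerations.\<close>

lemma regularised_matrix:
  fixes G :: "'t \<Rightarrow> 't \<Rightarrow> real" and A :: "real Matrix.mat"
  assumes psd: "\<And>b. 0 \<le> (\<Sum>t\<in>T. b t * (\<Sum>s\<in>T. G t s * b s))" and c: "0 < c" and T: "finite T"
    and \<tau>: "bij_betw \<tau> {..<L} T" and A: "A \<in> carrier_mat L L"
    and entries: "\<And>i j. i < L \<Longrightarrow> j < L \<Longrightarrow> A $$ (i, j) = G (\<tau> i) (\<tau> j) + (if i = j then c else 0)"
    and b: "\<And>t. t \<in> T \<Longrightarrow> (\<Sum>s\<in>T. G t s * b s) + c * b t = z t"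
  shows "invertible_mat A"
    and "Matrix.vec L (\<lambda>i. b (\<tau> i)) = the (mat_inverse A) *\<^sub>v Matrix.vec L (\<lambda>i. z (\<tau> i))"
proof -
  have mult: "vec_index (A *\<^sub>v Matrix.vec L (\<lambda>i. f (\<tau> i))) i = (\<Sum>s\<in>T. G (\<tau> i) s * f s) + c * f (\<tau> i)"
    if i: "i < L" for f i
  proof -
    have "vec_index (A *\<^sub>v Matrix.vec L (\<lambda>i. f (\<tau> i))) i = (\<Sum>j<L. A $$ (i, j) * f (\<tau> j))"
      using A i by (simp add: scalar_prod_def lessThan_atLeast0)
    also have "\<dots> = (\<Sum>j<L. G (\<tau> i) (\<tau> j) * f (\<tau> j) + (if i = j then c * f (\<tau> j) else 0))"
      using i by (intro sum.cong refl) (simp add: entries distrib_right)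
    also have "\<dots> = (\<Sum>j<L. G (\<tau> i) (\<tau> j) * f (\<tau> j)) + c * f (\<tau> i)"
      using i by (simp add: sum.distrib)
    also have "(\<Sum>j<L. G (\<tau> i) (\<tau> j) * f (\<tau> j)) = (\<Sum>s\<in>T. G (\<tau> i) s * f s)"
      by (rule sum.reindex_bij_betw[OF \<tau>])
    finally show ?thesis .
  qed
  have det: "det A \<noteq> 0"
  proof
    assume "det A = 0"
    then obtain v where v: "v \<in> carrier_vec L" "v \<noteq> 0\<^sub>v L" "A *\<^sub>v v = 0\<^sub>v L"
      using det_0_iff_vec_prod_zero_field[OF A] by blast
    define f where "f t = vec_index v (the_inv_into {..<L} \<tau> t)" for t
    have f: "f (\<tau> i) = vec_index v i" if "i < L" for i
      using the_inv_into_f_f[of \<tau> "{..<L}" i] \<tau> that by (simp add: f_def bij_betw_def)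
    have vf: "v = Matrix.vec L (\<lambda>i. f (\<tau> i))"
      using v(1) f by (intro eq_vecI) auto
    have "f t = 0" if t: "t \<in> T" for t
    proof (rule regularised_system_injective[where T=T and G=G and c=c and b=f, OF psd c T _ t])
      fix s assume "s \<in> T"
      then obtain i where "i < L" "s = \<tau> i" using \<tau> by (auto simp: bij_betw_def)
      then show "(\<Sum>u\<in>T. G s u * f u) + c * f s = 0"
        using mult[of i f] v(3) by (simp add: vf[symmetric])
    qed
    then have "v = 0\<^sub>v L"
      using vf \<tau> by (intro eq_vecI) (auto simp: bij_betw_def)
    with v(2) show False ..
  qed
  have "mat_inverse A \<noteq> None"
    using mat_inverse(1)[OF A, where b="()"] det_non_zero_imp_unit[OF A det, where b="()"] by blast
  then obtain B where B: "mat_inverse A = Some B" by blast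
  note AB = mat_inverse(2)[OF A B]
  show "invertible_mat A"
    unfolding invertible_mat_def inverts_mat_def using A AB
    by (intro conjI exI[of _ B]) auto
  have Ab: "A *\<^sub>v Matrix.vec L (\<lambda>i. b (\<tau> i)) = Matrix.vec L (\<lambda>i. z (\<tau> i))"
  proof (rule eq_vecI)
    fix i assume "i < dim_vec (Matrix.vec L (\<lambda>i. z (\<tau> i)))"
    then have i: "i < L" by simp
    then have "\<tau> i \<in> T" using \<tau> by (auto simp: bij_betw_def)
    then show "vec_index (A *\<^sub>v Matrix.vec L (\<lambda>i. b (\<tau> i))) i = vec_index (Matrix.vec L (\<lambda>i. z (\<tau> i))) i"
      using mult[OF i, of b] b i by simp
  qed (use A in simp)
  have "B *\<^sub>v (A *\<^sub>v Matrix.vec L (\<lambda>i. b (\<tau> i))) = (B * A) *\<^sub>v Matrix.vec L (\<lambda>i. b (\<tau> i))"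
    using A AB by (intro assoc_mult_mat_vec[symmetric]) auto
  then show "Matrix.vec L (\<lambda>i. b (\<tau> i)) = the (mat_inverse A) *\<^sub>v Matrix.vec L (\<lambda>i. z (\<tau> i))"
    using AB by (simp add: B Ab)
qed

section \<open>The covariance estimation problem\<close>

lemma triplets_Sigma: "triplets n r = (SIGMA i:{1..n}. offdiag (r i))"
  by (auto simp: triplets_def)

lemma finite_offdiag: "finite (offdiag m)"
  by (rule finite_subset[of _ "{1..m} \<times> {1..m}"]) (auto simp: offdiag_def)

lemma finite_triplets: "finite (triplets n r)"
  by (simp add: triplets_Sigma finite_offdiag)

lemma sum_triplets:
  fixes f :: "nat \<times> nat \<times> nat \<Rightarrow> real"
  shows "(\<Sum>i=1..n. \<Sum>(j, k)\<in>offdiag (r i). f (i, j, k)) = (\<Sum>t\<in>triplets n r. f t)"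
  by (simp add: triplets_Sigma finite_offdiag sum.Sigma case_prod_beta')

context admissible_operator
begin

lemma finite_tensor_sum_algebraic:
  assumes "finite S" "\<And>t. t \<in> S \<Longrightarrow> a t \<in> H Y p" "\<And>t. t \<in> S \<Longrightarrow> b t \<in> H Y p"
  shows "(\<lambda>x. \<Sum>t\<in>S. tensor (a t) (b t) x) \<in> algebraic_tensor_product (H Y p) (H Y p)"
proof -
  obtain f where f: "bij_betw f {0..<card S} S" using ex_bij_betw_nat_finite[OF assms(1)] by blast
  have f': "bij_betw f {..<card S} S" using f by (simp add: lessThan_atLeast0)
  have "(\<lambda>x. \<Sum>t\<in>S. tensor (a t) (b t) x) = (\<lambda>x. \<Sum>i<card S. tensor (a (f i)) (b (f i)) x)"
    by (rule ext) (rule sum.reindex_bij_betw[OF f', symmetric])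
  moreover have "\<forall>i<card S. a (f i) \<in> H Y p \<and> b (f i) \<in> H Y p"
    using f' assms by (auto simp: bij_betw_def)
  ultimately show ?thesis
    unfolding algebraic_tensor_product_def
    by (intro CollectI exI[of _ "\<lambda>i. a (f i)"] exI[of _ "\<lambda>i. b (f i)"] exI[of _ "card S"]) simp
qed

lemma HH_cong:
  assumes g: "g \<in> HH Y p" and eq: "\<And>x. x \<in> S2 \<times> S2 \<Longrightarrow> f x = g x"
  shows "f \<in> HH Y p"
proof -
  have sp: "space sph2 = S2 \<times> S2" by (simp add: space_pair_measure)
  have "HH_sqnorm Y p (\<lambda>x. f x - s x) = HH_sqnorm Y p (\<lambda>x. g x - s x)" for s
  proof -
    have "L2_inner sph2 (\<lambda>x. f x - s x) h = L2_inner sph2 (\<lambda>x. g x - s x) h" for h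
      by (rule L2_inner_cong) (simp_all only: sp eq)
    then show ?thesis by (simp only: HH_sqnorm_def)
  qed
  moreover have "f \<in> L2 sph2 \<longleftrightarrow> g \<in> L2 sph2"
    by (rule L2_cong) (simp only: sp eq)
  ultimately show ?thesis using g by (simp only: HH_def mem_Collect_eq)
qed

lemma H_scale: "f \<in> H Y p \<Longrightarrow> (\<lambda>x. a * f x) \<in> H Y p"
proof -
  assume f: "f \<in> H Y p"
  have "H_sqnorm Y p (\<lambda>x. a * f x) = (\<Sum>l. ennreal (a\<^sup>2) *
      ennreal (sobolev_weight p l * (\<Sum>m\<in>orders l. (L2_inner sph f (Y l m))\<^sup>2)))"
    unfolding H_sqnorm_def
    by (intro suminf_cong, subst ennreal_mult[symmetric])
      (auto simp: L2_inner_scale power_mult_distrib sum_distrib_left mult.left_commute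
        intro!: sum_nonneg mult_nonneg_nonneg less_imp_le[OF sobolev_weight_pos])
  then have "H_sqnorm Y p (\<lambda>x. a * f x) = ennreal (a\<^sup>2) * H_sqnorm Y p f"
    by (simp add: H_sqnorm_def)
  with f show ?thesis by (auto simp: H_def ennreal_mult_less_top intro!: L2_scale)
qed

end

locale covariance_problem = admissible_operator +
  fixes n :: nat and r :: "nat \<Rightarrow> nat" and w :: "nat \<Rightarrow> nat \<Rightarrow> real"
    and u :: "nat \<Rightarrow> nat \<Rightarrow> pt" and \<eta> :: real
  assumes n: "n \<ge> 1" and r: "i \<in> {1..n} \<Longrightarrow> r i \<ge> 2"
    and u: "i \<in> {1..n} \<Longrightarrow> j \<in> {1..r i} \<Longrightarrow> u i j \<in> S2"
    and \<eta>: "\<eta> > 0"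
begin

abbreviation triples :: "(nat \<times> nat \<times> nat) set" where
  "triples \<equiv> triplets n r"

abbreviation J :: "(pt \<times> pt \<Rightarrow> real) \<Rightarrow> real" where
  "J \<equiv> objective Y p D n r w u \<eta>"

definition node :: "nat \<times> nat \<times> nat \<Rightarrow> pt \<times> pt" where
  "node = (\<lambda>(i, j, k). (u i j, u i k))"

definition count :: "nat \<times> nat \<times> nat \<Rightarrow> real" where
  "count = (\<lambda>(i, j, k). pairs_count (r i))"

definition datum :: "nat \<times> nat \<times> nat \<Rightarrow> real" where
  "datum = (\<lambda>(i, j, k). w i j * w i k)"

definition \<kappa> :: real where
  "\<kappa> = (4 * pi)\<^sup>2 / real n"

text \<open>The normalisation by square roots makes the Gram matrix symmetric; \<open>b t / sqrt (count t)\<close> is then the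
coefficient of the kernel section at \<open>node t\<close>.\<close>

definition gram :: "nat \<times> nat \<times> nat \<Rightarrow> nat \<times> nat \<times> nat \<Rightarrow> real" where
  "gram t s = T.kernel (node s) (node t) / (sqrt (count t) * sqrt (count s))"

lemma space_sph2: "space sph2 = S2 \<times> S2"
  by (simp add: space_pair_measure)

lemma node_space: "t \<in> triples \<Longrightarrow> node t \<in> space sph2"
  using u by (auto simp: triplets_def offdiag_def node_def space_sph2)

lemma node_S2: "t \<in> triples \<Longrightarrow> fst (node t) \<in> S2" "t \<in> triples \<Longrightarrow> snd (node t) \<in> S2"
  using node_space[of t] by (auto simp: space_sph2)

lemma count_pos: "t \<in> triples \<Longrightarrow> 0 < count t"
proof -
  assume "t \<in> triples"
  then obtain i j k where t: "t = (i, j, k)" "i \<in> {1..n}" by (auto simp: triplets_def)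
  have "2 \<le> real (r i)" using r[OF t(2)] by simp
  then show "0 < count t" by (simp add: t(1) count_def pairs_count_def)
qed

lemma \<kappa>_pos: "0 < \<kappa>"
  using n by (simp add: \<kappa>_def)

lemma kernel2:
  assumes "x \<in> S2 \<times> S2" "y \<in> S2 \<times> S2"
  shows "T.kernel x y = kernel (fst x) (fst y) * kernel (snd x) (snd y)"
  using mercer_kernel_tensor[OF mercer_system_axioms countable_harmonic_index compact_space_sph
      id_measurable_sph, of x y] assms
  by (simp add: space_sph2 tensor_def case_prod_beta')

lemma gram_psd: "0 \<le> (\<Sum>t\<in>triples. b t * (\<Sum>s\<in>triples. gram t s * b s))"
proof -
  let ?b = "\<lambda>t. b t / sqrt (count t)"
  have "b t * (\<Sum>s\<in>triples. gram t s * b s)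
      = ?b t * (\<Sum>s\<in>triples. ?b s * T.kernel (node s) (node t))" for t
    by (simp add: gram_def sum_distrib_left mult.commute mult.left_commute)
  then show ?thesis
    using T.kernel_positive_semidefinite[OF finite_triplets node_space, where b="?b"] by simp
qed

lemma objective_eq:
  assumes "g \<in> HH Y p"
  shows "J g
    = \<kappa> * (\<Sum>t\<in>triples. (datum t - g (node t))\<^sup>2 / count t) + \<eta> * T.energy g"
proof -
  have "(\<Sum>i=1..n. 1 / pairs_count (r i) * (\<Sum>(j, k)\<in>offdiag (r i). (w i j * w i k - g (u i j, u i k))\<^sup>2))
      = (\<Sum>i=1..n. \<Sum>(j, k)\<in>offdiag (r i). (datum (i, j, k) - g (node (i, j, k)))\<^sup>2 / count (i, j, k))"
    by (simp add: datum_def node_def count_def sum_distrib_left case_prod_beta')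
  also have "\<dots> = (\<Sum>t\<in>triples. (datum t - g (node t))\<^sup>2 / count t)"
    by (rule sum_triplets)
  finally show ?thesis
    unfolding objective_def tensor_op_energy(2)[OF assms] \<kappa>_def by (simp only:)
qed

text \<open>Multiplying an equation of the linear system by \<open>\<kappa> / sqrt (count t)\<close> turns it into the stationarity
condition of the least squares problem, so the expansion around the kernel combination applies.\<close>

theorem representer:
  "\<exists>b R. (\<forall>t\<in>triples. (\<Sum>s\<in>triples. gram t s * b s) + \<eta> / \<kappa> * b t = datum t / sqrt (count t))
    \<and> is_minimizer J (HH_cont Y p) R
    \<and> (\<forall>g. is_minimizer J (HH_cont Y p) g \<longrightarrow> g = R)
    \<and> (\<forall>x\<in>S2 \<times> S2. R x = (\<Sum>t\<in>triples. b t / sqrt (count t) * T.kernel (node t) x))"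
proof -
  have c: "0 < \<eta> / \<kappa>" using \<eta> \<kappa>_pos by simp
  obtain b where b: "\<And>t. t \<in> triples \<Longrightarrow>
      (\<Sum>s\<in>triples. gram t s * b s) + \<eta> / \<kappa> * b t = datum t / sqrt (count t)"
    using regularised_system_solvable[where T=triples and G=gram
          and z="\<lambda>t. datum t / sqrt (count t)", OF gram_psd c finite_triplets] by blast
  define b' where "b' t = b t / sqrt (count t)" for t
  define R0 where "R0 = (\<lambda>x. \<Sum>t\<in>triples. b' t * T.kernel (node t) x)"
  define R where "R = restrict R0 (S2 \<times> S2)"
  have R0_cont: "continuous_on (S2 \<times> S2) R0"
    using T.kernel_combination(1)[OF finite_triplets node_space, where b=b'] by (simp add: R0_def space_sph2)
  have R_eq: "R x = R0 x" if "x \<in> S2 \<times> S2" for x using that by (simp add: R_def)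
  have R_HH: "R \<in> HH Y p"
  proof (rule HH_cong)
    show "(\<lambda>x. \<Sum>t\<in>triples. tensor (\<lambda>v. b' t * kernel (fst (node t)) v) (kernel (snd (node t))) x) \<in> HH Y p"
      by (intro algebraic_HH finite_tensor_sum_algebraic finite_triplets H_scale kernel_in_H node_S2)
    show "R x = (\<Sum>t\<in>triples. tensor (\<lambda>v. b' t * kernel (fst (node t)) v) (kernel (snd (node t))) x)"
      if x: "x \<in> S2 \<times> S2" for x
      unfolding R_eq[OF x] R0_def
      using kernel2[OF _ x] node_space
      by (intro sum.cong refl) (simp add: space_sph2 tensor_def case_prod_beta' mult.assoc)
  qed
  have "continuous_on (S2 \<times> S2) R"
    using R0_cont by (rule continuous_on_cong[OF refl, THEN iffD2, rotated]) (rule R_eq)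
  then have R_in: "R \<in> HH_cont Y p"
    using R_HH by (simp add: HH_cont_def R_def)
  have stationary: "\<eta> * b' t = \<kappa> * ((datum t - R0 (node t)) / count t)" if t: "t \<in> triples" for t
  proof -
    have sq: "sqrt (count t) * sqrt (count t) = count t" "0 < sqrt (count t)"
      using count_pos[OF t] by auto
    have "(\<Sum>s\<in>triples. gram t s * b s) = R0 (node t) / sqrt (count t)"
      by (simp add: gram_def R0_def b'_def sum_divide_distrib mult.commute)
    with b[OF t] have "\<eta> / \<kappa> * b t = (datum t - R0 (node t)) / sqrt (count t)"
      by (simp add: diff_divide_distrib)
    then have "\<kappa> * (\<eta> / \<kappa> * b t) / sqrt (count t)
        = \<kappa> * ((datum t - R0 (node t)) / sqrt (count t)) / sqrt (count t)" by simp
    moreover have "\<kappa> * (\<eta> / \<kappa> * b t) / sqrt (count t) = \<eta> * b' t"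
      using \<kappa>_pos by (simp add: b'_def)
    moreover have "\<kappa> * ((datum t - R0 (node t)) / sqrt (count t)) / sqrt (count t)
        = \<kappa> * ((datum t - R0 (node t)) / count t)"
      by (simp only: times_divide_eq_right divide_divide_eq_left sq(1))
    ultimately show ?thesis by simp
  qed
  have expand: "J g = J R
      + \<kappa> * (\<Sum>t\<in>triples. (g (node t) - R0 (node t))\<^sup>2 / count t) + \<eta> * T.energy (\<lambda>x. g x - R0 x)"
    if g: "g \<in> HH_cont Y p" for g
  proof -
    have g': "g \<in> HH Y p" "continuous_on (space sph2) g" "T.finite_energy g"
      using g tensor_op_energy(1)[of g] by (auto simp: HH_cont_def space_sph2)
    have "T.energy R = T.energy R0"
      unfolding T.energy_def
      using L2_inner_cong[of sph2 R R0] R_eq by (simp add: space_sph2)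
    moreover have "R (node t) = R0 (node t)" if "t \<in> triples" for t
      using node_space[OF that] R_eq by (simp add: space_sph2)
    ultimately have "J R
        = \<kappa> * (\<Sum>t\<in>triples. (datum t - R0 (node t))\<^sup>2 / count t) + \<eta> * T.energy R0"
      unfolding objective_eq[OF R_HH] by simp
    moreover have "\<kappa> * (\<Sum>t\<in>triples. (datum t - g (node t))\<^sup>2 / count t) + \<eta> * T.energy g
        = \<kappa> * (\<Sum>t\<in>triples. (datum t - R0 (node t))\<^sup>2 / count t) + \<eta> * T.energy R0
          + \<kappa> * (\<Sum>t\<in>triples. (g (node t) - R0 (node t))\<^sup>2 / count t)
          + \<eta> * T.energy (\<lambda>x. g x - R0 x)"
      unfolding R0_def
      by (rule T.regularised_least_squares[where x=node and P=count and b=b' and y=datum])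
        (fact finite_triplets node_space count_pos g'(2,3) stationary[unfolded R0_def])+
    ultimately show ?thesis unfolding objective_eq[OF g'(1)] by simp
  qed
  have misfit: "0 \<le> \<kappa> * (\<Sum>t\<in>triples. (g (node t) - R0 (node t))\<^sup>2 / count t)" for g
    by (intro mult_nonneg_nonneg sum_nonneg less_imp_le[OF \<kappa>_pos]) (simp add: less_imp_le[OF count_pos])
  have min: "is_minimizer J (HH_cont Y p) R"
    unfolding is_minimizer_def
  proof (intro conjI ballI R_in)
    fix g assume "g \<in> HH_cont Y p"
    from expand[OF this] show "J R \<le> J g"
      using misfit[of g] mult_nonneg_nonneg[OF less_imp_le[OF \<eta>] T.energy_nonneg[of "\<lambda>x. g x - R0 x"]]
      by linarith
  qed
  have uniq: "g = R" if g_min: "is_minimizer J (HH_cont Y p) g" for g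
  proof -
    have g: "g \<in> HH_cont Y p" "J g \<le> J R"
      using g_min R_in by (auto simp: is_minimizer_def)
    have g': "continuous_on (space sph2) g" "T.finite_energy g" "g \<in> extensional (S2 \<times> S2)"
      using g(1) tensor_op_energy(1)[of g] by (auto simp: HH_cont_def space_sph2)
    have "\<eta> * T.energy (\<lambda>x. g x - R0 x) \<le> 0"
      using expand[OF g(1)] g(2) misfit[of g] by linarith
    then have en: "T.energy (\<lambda>x. g x - R0 x) \<le> 0" using \<eta> by (simp add: mult_le_0_iff)
    have fe: "T.finite_energy (\<lambda>x. g x - R0 x)"
      unfolding R0_def by (rule T.energy_expansion(2)[OF finite_triplets node_space g'(1,2)])
    have "g x = R x" if x: "x \<in> S2 \<times> S2" for x
    proof -
      have "g x - R0 x = 0"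
        using g'(1) R0_cont x
        by (intro T.energy_eq_0[OF _ fe en]) (auto simp: space_sph2 intro!: continuous_on_diff)
      then show ?thesis by (simp add: R_eq[OF x])
    qed
    then show ?thesis
      using g'(3) by (intro extensionalityI[where A="S2 \<times> S2"]) (auto simp: R_def)
  qed
  show ?thesis
  proof (rule exI[of _ b], rule exI[of _ R], intro conjI ballI allI impI)
    fix t assume "t \<in> triples"
    then show "(\<Sum>s\<in>triples. gram t s * b s) + \<eta> / \<kappa> * b t = datum t / sqrt (count t)" by (rule b)
  next
    fix g assume "is_minimizer J (HH_cont Y p) g"
    then show "g = R" by (rule uniq)
  next
    fix x assume "x \<in> S2 \<times> S2"
    then show "R x = (\<Sum>t\<in>triples. b t / sqrt (count t) * T.kernel (node t) x)"
      by (simp only: R_eq R0_def b'_def)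
  qed (rule min)
qed

definition swap :: "nat \<times> nat \<times> nat \<Rightarrow> nat \<times> nat \<times> nat" where
  "swap = (\<lambda>(i, j, k). (i, k, j))"

lemma swap_bij: "bij_betw swap triples triples"
proof (rule bij_betwI[where g=swap])
  show "swap \<in> triples \<rightarrow> triples" by (auto simp: swap_def triplets_def offdiag_def)
  show "swap \<in> triples \<rightarrow> triples" by (auto simp: swap_def triplets_def offdiag_def)
qed (auto simp: swap_def)

lemma swap_simps: "count (swap t) = count t" "datum (swap t) = datum t"
  "fst (node (swap t)) = snd (node t)" "snd (node (swap t)) = fst (node t)"
  by (cases t; simp add: swap_def count_def datum_def node_def mult.commute)+

lemma gram_swap:
  assumes "t \<in> triples" "s \<in> triples"
  shows "gram (swap t) (swap s) = gram t s"
proof -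
  have st: "swap t \<in> triples" "swap s \<in> triples" using swap_bij assms by (auto simp: bij_betw_def)
  show ?thesis
    using node_space[OF assms(1)] node_space[OF assms(2)] node_space[OF st(1)] node_space[OF st(2)]
    by (simp add: gram_def kernel2 space_sph2 swap_simps mult.commute)
qed

text \<open>The system is invariant under exchanging the two positions in all triples, so \<open>b \<circ> swap\<close> is a
solution too, and solutions are unique.\<close>

lemma solution_symmetric:
  assumes b: "\<And>t. t \<in> triples \<Longrightarrow>
      (\<Sum>s\<in>triples. gram t s * b s) + \<eta> / \<kappa> * b t = datum t / sqrt (count t)"
    and t: "t \<in> triples"
  shows "b (swap t) = b t"
proof -
  have c: "0 < \<eta> / \<kappa>" using \<eta> \<kappa>_pos by simp
  have swapped: "(\<Sum>s\<in>triples. gram t s * b (swap s)) + \<eta> / \<kappa> * b (swap t) = datum t / sqrt (count t)"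
    if t: "t \<in> triples" for t
  proof -
    have st: "swap t \<in> triples" using swap_bij t by (auto simp: bij_betw_def)
    have "(\<Sum>s\<in>triples. gram t s * b (swap s)) = (\<Sum>s\<in>triples. gram (swap t) (swap s) * b (swap s))"
      by (intro sum.cong refl) (simp add: gram_swap t)
    also have "\<dots> = (\<Sum>s\<in>triples. gram (swap t) s * b s)"
      by (rule sum.reindex_bij_betw[OF swap_bij])
    finally show ?thesis using b[OF st] by (simp add: swap_simps)
  qed
  have "b (swap t) - b t = 0"
  proof (rule regularised_system_injective[where T=triples and G=gram and b="\<lambda>t. b (swap t) - b t",
        OF gram_psd c finite_triplets _ t])
    fix t assume t: "t \<in> triples"
    show "(\<Sum>s\<in>triples. gram t s * (b (swap s) - b s)) + \<eta> / \<kappa> * (b (swap t) - b t) = 0"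
      using swapped[OF t] b[OF t] by (simp add: right_diff_distrib sum_subtractf)
  qed
  then show ?thesis by simp
qed

lemma estimator_symmetric:
  assumes b: "\<And>t. t \<in> triples \<Longrightarrow>
      (\<Sum>s\<in>triples. gram t s * b s) + \<eta> / \<kappa> * b t = datum t / sqrt (count t)"
    and v: "v1 \<in> S2" "v2 \<in> S2"
  shows "(\<Sum>t\<in>triples. b t / sqrt (count t) * T.kernel (node t) (v1, v2))
    = (\<Sum>t\<in>triples. b t / sqrt (count t) * T.kernel (node t) (v2, v1))"
proof -
  have "(\<Sum>t\<in>triples. b t / sqrt (count t) * T.kernel (node t) (v1, v2))
      = (\<Sum>t\<in>triples. b (swap t) / sqrt (count (swap t)) * T.kernel (node (swap t)) (v1, v2))"
    by (rule sum.reindex_bij_betw[OF swap_bij, symmetric])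
  also have "\<dots> = (\<Sum>t\<in>triples. b t / sqrt (count t) * T.kernel (node t) (v2, v1))"
  proof (rule sum.cong[OF refl])
    fix t assume t: "t \<in> triples"
    have st: "swap t \<in> triples" using swap_bij t by (auto simp: bij_betw_def)
    show "b (swap t) / sqrt (count (swap t)) * T.kernel (node (swap t)) (v1, v2)
        = b t / sqrt (count t) * T.kernel (node t) (v2, v1)"
      using node_space[OF t] node_space[OF st] v
      by (simp add: kernel2 space_sph2 swap_simps solution_symmetric[OF b t])
  qed
  finally show ?thesis .
qed

end

theorem theorem10:
  fixes Y :: harmonics
    and D :: "nat \<Rightarrow> real"
    and p \<eta> :: real
    and n :: nat
    and r :: "nat \<Rightarrow> nat"
    and w :: "nat \<Rightarrow> nat \<Rightarrow> real"
    and u :: "nat \<Rightarrow> nat \<Rightarrow> pt"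
  assumes "spherical_harmonics_basis Y"
    and "admissible D p" and "p > 1"
    and "n \<ge> 1" and "\<And>i. i \<in> {1..n} \<Longrightarrow> r i \<ge> 2"
    and "\<And>i j. i \<in> {1..n} \<Longrightarrow> j \<in> {1..r i} \<Longrightarrow> u i j \<in> S2"
    and "inj_on (\<lambda>(i, j). u i j) (SIGMA i:{1..n}. {1..r i})"
    and "\<eta> > 0"
  defines "\<psi> \<equiv> zonal_green_kernel Y (\<lambda>l. (D l)\<^sup>2)"
    and "L \<equiv> \<Sum>i=1..n. r i * (r i - 1)"
  shows "\<exists>R \<beta>.
    is_minimizer (objective Y p D n r w u \<eta>) (HH_cont Y p) R \<and>
    (\<forall>g. is_minimizer (objective Y p D n r w u \<eta>) (HH_cont Y p) g \<longrightarrow> g = R) \<and>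
    (\<forall>x\<in>S2 \<times> S2. R x =
       (\<Sum>i=1..n. 1 / sqrt (pairs_count (r i)) *
          (\<Sum>(j, k)\<in>offdiag (r i).
             \<beta> i j k * tensor (\<lambda>v. \<psi> (inner v (u i j))) (\<lambda>v. \<psi> (inner v (u i k))) x))) \<and>
    (\<forall>\<tau>. bij_betw \<tau> {..<L} (triplets n r) \<longrightarrow>
       (let A = gram_matrix \<psi> r u L \<tau> + (\<eta> * real n / (4 * pi)\<^sup>2) \<cdot>\<^sub>m 1\<^sub>m L;
            z = vectorize L \<tau> (\<lambda>i j k. w i j * w i k / sqrt (pairs_count (r i)))
        in invertible_mat A \<and> vectorize L \<tau> \<beta> = the (mat_inverse A) *\<^sub>v z)) \<and>
    (\<forall>v1\<in>S2. \<forall>v2\<in>S2. R (v1, v2) = R (v2, v1))"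
proof -
  interpret covariance_problem Y D p n r w u \<eta>
    by unfold_locales (use assms in auto)
  obtain b R where
    b': "\<forall>t\<in>triples. (\<Sum>s\<in>triples. gram t s * b s) + \<eta> / \<kappa> * b t = datum t / sqrt (count t)"
    and min: "is_minimizer (objective Y p D n r w u \<eta>) (HH_cont Y p) R"
    and uniq: "\<forall>g. is_minimizer (objective Y p D n r w u \<eta>) (HH_cont Y p) g \<longrightarrow> g = R"
    and R': "\<forall>x\<in>S2 \<times> S2. R x = (\<Sum>t\<in>triples. b t / sqrt (count t) * T.kernel (node t) x)"
    using representer by (elim exE conjE)
  note b = bspec[OF b'] and R = bspec[OF R']
  define \<beta> where "\<beta> i j k = b (i, j, k)" for i j k
  have psi: "\<psi> (inner x y) = kernel x y" if "x \<in> S2" "y \<in> S2" for x y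
    unfolding \<psi>_def by (rule zonal_green_kernel_eq[OF that])
  have c: "0 < \<eta> / \<kappa>" using \<eta> \<kappa>_pos by simp
  have formula: "R x = (\<Sum>i=1..n. 1 / sqrt (pairs_count (r i)) *
          (\<Sum>(j, k)\<in>offdiag (r i).
             \<beta> i j k * tensor (\<lambda>v. \<psi> (inner v (u i j))) (\<lambda>v. \<psi> (inner v (u i k))) x))"
    if x: "x \<in> S2 \<times> S2" for x
  proof -
    have "R x = (\<Sum>t\<in>triples. case t of (i, j, k) \<Rightarrow> 1 / sqrt (pairs_count (r i)) *
        (\<beta> i j k * tensor (\<lambda>v. \<psi> (inner v (u i j))) (\<lambda>v. \<psi> (inner v (u i k))) x))"
      unfolding R[OF x]
    proof (rule sum.cong[OF refl])
      fix t assume t: "t \<in> triples"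
      obtain i j k where ijk: "t = (i, j, k)" by (cases t) auto
      have S: "u i j \<in> S2" "u i k \<in> S2" using node_S2[OF t] by (simp_all add: ijk node_def)
      show "b t / sqrt (count t) * T.kernel (node t) x = (case t of (i, j, k) \<Rightarrow> 1 / sqrt (pairs_count (r i)) *
        (\<beta> i j k * tensor (\<lambda>v. \<psi> (inner v (u i j))) (\<lambda>v. \<psi> (inner v (u i k))) x))"
        using x S kernel2[of "node t" x] node_space[OF t]
        by (auto simp: ijk count_def \<beta>_def node_def tensor_apply psi kernel_symmetric[of _ "u i _"] space_sph2)
    qed
    also have "\<dots> = (\<Sum>i=1..n. \<Sum>(j, k)\<in>offdiag (r i). 1 / sqrt (pairs_count (r i)) *
        (\<beta> i j k * tensor (\<lambda>v. \<psi> (inner v (u i j))) (\<lambda>v. \<psi> (inner v (u i k))) x))"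
      by (subst sum_triplets[symmetric]) simp
    finally show ?thesis by (simp add: sum_distrib_left case_prod_beta')
  qed
  have matrix: "let A = gram_matrix \<psi> r u L \<tau> + (\<eta> * real n / (4 * pi)\<^sup>2) \<cdot>\<^sub>m 1\<^sub>m L;
            z = vectorize L \<tau> (\<lambda>i j k. w i j * w i k / sqrt (pairs_count (r i)))
        in invertible_mat A \<and> vectorize L \<tau> \<beta> = the (mat_inverse A) *\<^sub>v z"
    if \<tau>: "bij_betw \<tau> {..<L} triples" for \<tau>
  proof -
    let ?A = "gram_matrix \<psi> r u L \<tau> + (\<eta> * real n / (4 * pi)\<^sup>2) \<cdot>\<^sub>m 1\<^sub>m L"
    have A: "?A \<in> carrier_mat L L" by (simp add: gram_matrix_def)
    have entries: "?A $$ (l1, l2) = gram (\<tau> l1) (\<tau> l2) + (if l1 = l2 then \<eta> / \<kappa> else 0)"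
      if l: "l1 < L" "l2 < L" for l1 l2
    proof -
      have t: "\<tau> l1 \<in> triples" "\<tau> l2 \<in> triples" using \<tau> l by (auto simp: bij_betw_def)
      obtain i1 j1 k1 where 1: "\<tau> l1 = (i1, j1, k1)" by (cases "\<tau> l1") auto
      obtain i2 j2 k2 where 2: "\<tau> l2 = (i2, j2, k2)" by (cases "\<tau> l2") auto
      have S: "u i1 j1 \<in> S2" "u i1 k1 \<in> S2" "u i2 j2 \<in> S2" "u i2 k2 \<in> S2"
        using node_S2[OF t(1)] node_S2[OF t(2)] by (simp_all add: 1 2 node_def)
      have "gram_matrix \<psi> r u L \<tau> $$ (l1, l2) = gram (\<tau> l1) (\<tau> l2)"
        using l S kernel2[of "node (\<tau> l2)" "node (\<tau> l1)"]
        by (simp add: gram_matrix_def gram_def 1 2 psi node_def count_def real_sqrt_mult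
            kernel_symmetric[of "u i1 j1" "u i2 j2"] kernel_symmetric[of "u i1 k1" "u i2 k2"])
      then show ?thesis using l by (simp add: gram_matrix_def \<kappa>_def)
    qed
    note M = regularised_matrix[where T=triples and G=gram, OF gram_psd c finite_triplets \<tau> A entries b]
    have "vectorize L \<tau> \<beta> = Matrix.vec L (\<lambda>i. b (\<tau> i))"
      by (simp add: vectorize_def \<beta>_def case_prod_beta')
    moreover have "vectorize L \<tau> (\<lambda>i j k. w i j * w i k / sqrt (pairs_count (r i)))
        = Matrix.vec L (\<lambda>i. datum (\<tau> i) / sqrt (count (\<tau> i)))"
      by (simp add: vectorize_def datum_def count_def case_prod_beta')
    ultimately show ?thesis using M by (simp add: Let_def)
  qed
  have sym: "R (v1, v2) = R (v2, v1)" if "v1 \<in> S2" "v2 \<in> S2" for v1 v2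
    using R[of "(v1, v2)"] R[of "(v2, v1)"] estimator_symmetric[OF b that] that by simp
  show ?thesis
    by (rule exI[of _ R], rule exI[of _ \<beta>], intro conjI ballI allI impI)
      (fact min, fact uniq[rule_format], fact formula, fact matrix, fact sym)
qed

end
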